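(* For complex $q$ with $|q|<1$, $$\varphi(-q)\varphi^3(-q^5) = \frac{1}{5}\left(\frac{E^5(q)}{E(q^5)} + 4\frac{E^5(q^2)}{E(q^{10})}\right) - \left(q\frac{E^5(q^5)}{E(q)} - 4q^2\frac{E^5(q^{10})}{E(q^2)}\right),$$ $$\varphi^3(-q)\varphi(-q^5) = \frac{1}{5}\left(\frac{E^5(q)}{E(q^5)} + 4\frac{E^5(q^2)}{E(q^{10})}\right) - 5\left(q\frac{E^5(q^5)}{E(q)} - 4q^2\frac{E^5(q^{10})}{E(q^2)}\right),$$ $$4q\psi^3(q)\psi(q^5) = \frac{1}{5}\left(\frac{E^5(q)}{E(q^5)} - \frac{E^5(q^2)}{E(q^{10})}\right) + 5\left(q\frac{E^5(q^5)}{E(q)} + q^2\frac{E^5(q^{10})}{E(q^2)}\right),$$ $$4q^2\psi(q)\psi^3(q^5) = \frac{1}{5}\left(\frac{E^5(q)}{E(q^5)} - \frac{E^5(q^2)}{E(q^{10})}\right) + \left(q\frac{E^5(q^5)}{E(q)} + q^2\frac{E^5(q^{10})}{E(q^2)}\right).$$ Furthermore, define $a(n),b(n),c(n),d(n)$ by $$\varphi(q)\varphi^3(q^5) = 1 + \sum_{n=1}^{\infty} a(n)q^n,\quad \varphi^3(q)\varphi(q^5) = 1 + \sum_{n=1}^{\infty} b(n)q^n,\quad 4q\psi^3(q)\psi(q^5) = \sum_{n=1}^{\infty} c(n)q^n,\quad 4q^2\psi(q)\psi^3(q^5) = \sum_{n=1}^{\infty} d(n)q^n.$$ For a positive integer $n$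 write $n = 2^g 5^d \prod_{i=1}^r p_i^{v_i} \prod_{j=1}^s q_j^{w_j}$, where the $p_i$ are the distinct primes dividing $n$ with $p_i \equiv \pm 1 \pmod{5}$ and the $q_j$ are the distinct odd primes dividing $n$ with $q_j \equiv \pm 2 \pmod{5}$, and let $t$ be the number of odd prime divisors of $n$, counted with multiplicity, that are congruent to $\pm 2 \pmod{5}$. Then $$a(n) = (-1)^{n-1}(1 + 5^d(-1)^{g+t}) \frac{5 + (-2)^{g+1}}{3} \prod_{i=1}^r \frac{1 - p_i^{v_i+1}}{1 - p_i} \prod_{j=1}^s \frac{1 - (-q_j)^{w_j+1}}{1 + q_j},$$ $$b(n) = (-1)^{n-1}(1 + 5^{d+1}(-1)^{g+t}) \frac{5 + (-2)^{g+1}}{3} \prod_{i=1}^r \frac{1 - p_i^{v_i+1}}{1 - p_i} \prod_{j=1}^s \frac{1 - (-q_j)^{w_j+1}}{1 + q_j},$$ $$c(n) = (-2)^g(-1 + 5^{d+1}(-1)^{g+t}) \prod_{i=1}^r \frac{1 - p_i^{v_i+1}}{1 - p_i} \prod_{j=1}^s \frac{1 - (-q_j)^{w_j+1}}{1 + q_j},$$ $$d(n) = (-2)^g(-1 + 5^d(-1)^{g+t}) \prod_{i=1}^r \frac{1 - p_i^{v_i+1}}{1 - p_i} \prod_{j=1}^s \frac{1 - (-q_j)^{w_j+1}}{1 + q_j}.$$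
   Context: For $|q|<1$: $E(q):=\prod_{n\ge 1}(1-q^n)$, $\varphi(q):=\sum_{n=-\infty}^{\infty} q^{n^2}$, and $\psi(q):=\sum_{n=-\infty}^{\infty} q^{2n^2-n}=\sum_{n\ge 0}q^{n(n+1)/2}$. *)

theory Defs
  imports "HOL-Analysis.Analysis" "HOL-Number_Theory.Cong"
begin

definition euler_E :: "complex \<Rightarrow> complex" where
  "euler_E q = (\<Prod>n. 1 - q ^ Suc n)"

(* All exponents n^2 and 2 n^2 - n occurring below are nonnegative, so the integer powers
   are ordinary powers, also at q = 0. *)

definition theta_phi :: "complex \<Rightarrow> complex" where
  "theta_phi q = (\<Sum>\<^sub>\<infinity>n\<in>(UNIV :: int set). q powi (n\<^sup>2))"

definition theta_psi :: "complex \<Rightarrow> complex" where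
  "theta_psi q = (\<Sum>\<^sub>\<infinity>n\<in>(UNIV :: int set). q powi (2 * n\<^sup>2 - n))"

lemma theta_psi_altdef: "theta_psi q = (\<Sum>\<^sub>\<infinity>n\<in>(UNIV :: nat set). q ^ (n * (n + 1) div 2))"
proof -
  define h :: "nat \<Rightarrow> int" where "h m = (if even m then - int (m div 2) else int (m div 2) + 1)" for m
  have "bij h"
  proof (rule bijI)
    show "inj h"
      unfolding inj_def h_def by presburger
    have "\<exists>m. n = h m" for n
    proof (cases "n > 0")
      case True
      then obtain k where "n = int k + 1"
        by (metis add.commute zero_less_imp_eq_int of_nat_Suc Suc_pred)
      hence "n = h (2 * k + 1)" by (simp add: h_def)
      thus ?thesis ..
    next
      case False
      hence "n = h (2 * nat (-n))" by (simp add: h_def)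
      thus ?thesis ..
    qed
    thus "surj h" by (simp add: surj_def)
  qed
  hence "theta_psi q = (\<Sum>\<^sub>\<infinity>m\<in>UNIV. q powi (2 * (h m)\<^sup>2 - h m))"
    unfolding theta_psi_def by (rule infsum_reindex_bij_betw[symmetric])
  moreover have "q powi (2 * (h m)\<^sup>2 - h m) = q ^ (m * (m + 1) div 2)" for m
  proof -
    have "2 * (h m)\<^sup>2 - h m = int (m * (m + 1) div 2)"
    proof (cases "even m")
      case True
      then obtain k where m: "m = 2 * k" by (auto elim: evenE)
      have "m * (m + 1) div 2 = k * (2 * k + 1)" unfolding m by simp
      thus ?thesis by (simp add: h_def m power2_eq_square algebra_simps)
    next
      case False
      then obtain k where m: "m = 2 * k + 1" by (auto elim: oddE)
      have "m * (m + 1) = 2 * ((2 * k + 1) * (k + 1))" unfolding m by (simp add: algebra_simps)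
      hence "m * (m + 1) div 2 = (2 * k + 1) * (k + 1)" by simp
      thus ?thesis by (simp add: h_def m power2_eq_square algebra_simps)
    qed
    thus ?thesis by (simp only: power_int_of_nat)
  qed
  ultimately show ?thesis by simp
qed

(* F(q) = c0 + sum_{n >= 1} a(n) q^n in the unit disc; the value a 0 is irrelevant. *)
definition has_q_expansion ::
    "(complex \<Rightarrow> complex) \<Rightarrow> complex \<Rightarrow> (nat \<Rightarrow> complex) \<Rightarrow> bool" where
  "has_q_expansion F c0 a \<longleftrightarrow>
     (\<forall>q. norm q < 1 \<longrightarrow> (\<lambda>n. a (Suc n) * q ^ Suc n) sums (F q - c0))"

definition pm1_mod5 :: "nat \<Rightarrow> bool" where
  "pm1_mod5 p \<longleftrightarrow> [int p = 1] (mod 5) \<or> [int p = -1] (mod 5)"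

definition pm2_mod5 :: "nat \<Rightarrow> bool" where
  "pm2_mod5 p \<longleftrightarrow> [int p = 2] (mod 5) \<or> [int p = -2] (mod 5)"

end

theory Submission
  imports Defs
begin

text \<open>
  Write \<open>T(x) = \<Sum>\<^sub>n (-1)\<^sup>n q\<^bsup>n(n-1)/2\<^esup> x\<^sup>n\<close>.  Splitting \<open>T(xy) T(x/y)\<close> by the parity of
  \<open>m + n\<close> gives the Weierstrass relation
  \<open>(\<wp>(x) - \<wp>(y)) T(x)\<^sup>2 T(y)\<^sup>2 = - E\<^sup>6 y T(xy) T(x/y)\<close>, where \<open>-\<wp>\<close> is the second logarithmic
  derivative of \<open>T\<close> and is read off the triple product.  With \<open>(x, y) = (q, q\<^sup>2)\<close> in base
  \<open>q\<^sup>5\<close> and with \<open>(x, y) = (\<zeta>, \<zeta>\<^sup>2)\<close>, \<open>\<zeta>\<^sup>5 = 1\<close>, in base \<open>q\<close>, the right-hand side is an eta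
  quotient and the left-hand side a Lambert series: this yields the expansions of
  \<open>q E\<^sup>5(q\<^sup>5) / E(q)\<close> and \<open>E\<^sup>5(q) / E(q\<^sup>5)\<close>, whose coefficients are multiplicative.

  The four theta products are expressed in these eta quotients by means of two relations,
  \<open>\<psi>\<^sup>2(q) - q \<psi>\<^sup>2(q\<^sup>5) = E(q\<^sup>2) E\<^sup>3(q\<^sup>5) / (E(q) E(q\<^sup>1\<^sup>0))\<close> and
  \<open>\<phi>\<^sup>2(-q\<^sup>5) - \<phi>\<^sup>2(-q) = 4q E(q) E\<^sup>3(q\<^sup>1\<^sup>0) / (E(q\<^sup>2) E(q\<^sup>5))\<close>, both of which follow from
  splitting \<open>\<int>\<^sup>2\<close> into the five classes modulo a sublattice of index 5.
\<close>

subsection \<open>Infinite products and sums over the integers\<close>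

text \<open>The obstacle is analytic: \<wp> is a second logarithmic derivative, whereas T is a
  bilateral series in x. Only finite products and finite sums are therefore differentiated; the
  weighted series \<open>theta_sum k\<close> enter as limits, by dominated convergence. The
  Weierstrass relation itself is then linear algebra, since all its ingredients are 2x2 determinants
  of vectors (\<open>theta_even\<close>, \<open>theta_odd\<close>). Both choices of (x, y) are
  points of order 5 on the multiplicative group modulo powers of the base. Up to inversion and
  periods there are only two classes of such points, so xy and x/y fall back on y and x, and T(xy)
  T(x/y) is T(x) T(y) times a monomial. One factor T(x) T(y) cancels; the remaining one runs over
  all four nontrivial points of the subgroup, which is why it is an eta product. The two classes are
  the nonzero squares and the nonsquares modulo 5, hence the Legendre symbol in the divisor
  sums.\<close>

lemma convergent_prod_qpoch:
  fixes q x :: complex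
  assumes "norm q < 1"
  shows "convergent_prod (\<lambda>n. 1 - x * q ^ n)"
proof -
  have "summable (\<lambda>n. norm x * norm q ^ n)"
    using assms by (intro summable_mult summable_geometric) auto
  then have "summable (\<lambda>n. norm ((1 - x * q ^ n) - 1))"
    by (simp add: norm_mult norm_power)
  then show ?thesis
    by (intro abs_convergent_prod_imp_convergent_prod summable_imp_abs_convergent_prod)
qed

definition qpoch :: "complex \<Rightarrow> complex \<Rightarrow> complex" where
  "qpoch x q = (\<Prod>n. 1 - x * q ^ n)"

lemma qpoch_LIMSEQ:
  assumes "norm q < 1"
  shows "(\<lambda>N. \<Prod>n<N. 1 - x * q ^ n) \<longlonglongrightarrow> qpoch x q"
proof -
  have "(\<lambda>N. \<Prod>n\<le>N. 1 - x * q ^ n) \<longlonglongrightarrow> qpoch x q"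
    unfolding qpoch_def by (intro convergent_prod_LIMSEQ convergent_prod_qpoch assms)
  then have "(\<lambda>N. \<Prod>n<Suc N. 1 - x * q ^ n) \<longlonglongrightarrow> qpoch x q"
    by (simp add: lessThan_Suc_atMost)
  then show ?thesis by (subst (asm) filterlim_sequentially_Suc)
qed

lemma qpoch_eq_0_iff:
  assumes "norm q < 1"
  shows "qpoch x q = 0 \<longleftrightarrow> (\<exists>n. x * q ^ n = 1)"
proof -
  have "(\<lambda>n. 1 - x * q ^ n) has_prod qpoch x q"
    unfolding qpoch_def by (intro convergent_prod_has_prod convergent_prod_qpoch assms)
  from has_prod_eq_0_iff[OF this] show ?thesis by (auto simp: algebra_simps image_iff)
qed

lemma qpoch_nonzero:
  assumes "norm q < 1" "norm x < 1"
  shows "qpoch x q \<noteq> 0"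
proof -
  have *: "norm (x * q ^ n) < 1" for n
  proof -
    have "norm (x * q ^ n) \<le> norm x"
      using mult_left_mono[of "norm q ^ n" 1 "norm x"] power_le_one[of "norm q" n] assms
      by (simp add: norm_mult norm_power)
    then show ?thesis using assms by linarith
  qed
  have "x * q ^ n \<noteq> 1" for n
  proof
    assume "x * q ^ n = 1"
    with *[of n] show False by simp
  qed
  then show ?thesis using qpoch_eq_0_iff[OF assms(1), of x] by simp
qed

lemma euler_E_qpoch: "euler_E q = qpoch q q"
  by (simp add: euler_E_def qpoch_def)

lemma euler_E_nonzero: "norm q < 1 \<Longrightarrow> euler_E q \<noteq> 0"
  by (simp add: euler_E_qpoch qpoch_nonzero)

lemma norm_power_less_1:
  fixes q :: complex
  assumes "norm q < 1" "0 < k"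
  shows "norm (q ^ k) < 1"
  using assms by (simp add: norm_power power_less_one_iff)

text \<open>The exponents are sorted by their residue modulo \<open>k\<close>. The comparison is
  made on finite products of length \<open>N * k\<close>, so that no infinite product has to be
  rearranged.\<close>

lemma qpoch_dissect:
  assumes "norm q < 1" "0 < k"
  shows "qpoch x q = (\<Prod>j<k. qpoch (x * q ^ j) (q ^ k))"
proof (rule LIMSEQ_unique)
  have "(\<lambda>N. \<Prod>j<k. \<Prod>n<N. 1 - x * q ^ j * (q ^ k) ^ n) \<longlonglongrightarrow> (\<Prod>j<k. qpoch (x * q ^ j) (q ^ k))"
    using norm_power_less_1[OF assms] by (intro tendsto_prod qpoch_LIMSEQ)
  moreover have "(\<Prod>j<k. \<Prod>n<N. 1 - x * q ^ j * (q ^ k) ^ n) = (\<Prod>n<N * k. 1 - x * q ^ n)" for N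
  proof -
    have "(\<Prod>n<N * k. 1 - x * q ^ n) = (\<Prod>n<N. \<Prod>j\<in>{n*k..<n*k+k}. 1 - x * q ^ j)"
      by (rule prod.nat_group[symmetric])
    also have "\<dots> = (\<Prod>n<N. \<Prod>j<k. 1 - x * q ^ (n * k + j))"
    proof (rule prod.cong[OF refl])
      show "(\<Prod>j\<in>{n*k..<n*k+k}. 1 - x * q ^ j) = (\<Prod>j<k. 1 - x * q ^ (n * k + j))" for n
        by (rule prod.reindex_bij_witness[of _ "\<lambda>j. n * k + j" "\<lambda>j. j - n * k"]) auto
    qed
    also have "\<dots> = (\<Prod>j<k. \<Prod>n<N. 1 - x * q ^ (n * k + j))"
      by (rule prod.swap)
    moreover have "x * q ^ (n * k + j) = x * q ^ j * (q ^ k) ^ n" for n j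
      by (simp add: power_add mult.commute[of n k] power_mult)
    ultimately show ?thesis by simp
  qed
  ultimately show "(\<lambda>N. \<Prod>n<N * k. 1 - x * q ^ n) \<longlonglongrightarrow> (\<Prod>j<k. qpoch (x * q ^ j) (q ^ k))"
    by simp
  have "filterlim (\<lambda>N. N * k) at_top sequentially"
    using assms by (intro mult_nat_right_at_top) auto
  from filterlim_compose[OF qpoch_LIMSEQ[OF assms(1)] this]
  show "(\<lambda>N. \<Prod>n<N * k. 1 - x * q ^ n) \<longlonglongrightarrow> qpoch x q" .
qed

lemma qpoch_mult_minus:
  assumes "norm q < 1"
  shows "qpoch x q * qpoch (-x) q = qpoch (x\<^sup>2) (q\<^sup>2)"
proof (rule LIMSEQ_unique)
  show "(\<lambda>N. (\<Prod>n<N. 1 - x * q ^ n) * (\<Prod>n<N. 1 - (-x) * q ^ n)) \<longlonglongrightarrow> qpoch x q * qpoch (-x) q"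
    by (intro tendsto_mult qpoch_LIMSEQ assms)
  have "(1 - x * q ^ n) * (1 - (-x) * q ^ n) = 1 - x\<^sup>2 * (q\<^sup>2) ^ n" for n
    by (simp add: power2_eq_square algebra_simps power_mult_distrib)
  moreover have "(\<lambda>N. \<Prod>n<N. 1 - x\<^sup>2 * (q\<^sup>2) ^ n) \<longlonglongrightarrow> qpoch (x\<^sup>2) (q\<^sup>2)"
    by (intro qpoch_LIMSEQ norm_power_less_1 assms) auto
  ultimately show "(\<lambda>N. (\<Prod>n<N. 1 - x * q ^ n) * (\<Prod>n<N. 1 - (-x) * q ^ n)) \<longlonglongrightarrow> qpoch (x\<^sup>2) (q\<^sup>2)"
    by (simp flip: prod.distrib)
qed

lemma qpoch_Suc:
  assumes "norm q < 1"
  shows "qpoch x q = (1 - x) * qpoch (x * q) q"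
proof -
  have "(\<lambda>N. \<Prod>n<Suc N. 1 - x * q ^ n) \<longlonglongrightarrow> qpoch x q"
    by (subst filterlim_sequentially_Suc) (rule qpoch_LIMSEQ[OF assms])
  moreover have "(\<lambda>N. (1 - x) * (\<Prod>n<N. 1 - x * q * q ^ n)) \<longlonglongrightarrow> (1 - x) * qpoch (x * q) q"
    by (intro tendsto_mult tendsto_const qpoch_LIMSEQ assms)
  moreover have "(\<lambda>N. \<Prod>n<Suc N. 1 - x * q ^ n) = (\<lambda>N. (1 - x) * (\<Prod>n<N. 1 - x * q * q ^ n))"
    by (simp only: prod.lessThan_Suc_shift) (simp add: mult_ac)
  ultimately show ?thesis using LIMSEQ_unique by simp
qed

section \<open>Summation over the integers and majorants for theta series\<close>

lemma infsum_int_eq_suminf: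
  fixes f :: "int \<Rightarrow> complex"
  assumes "(\<lambda>n. norm (f n)) summable_on UNIV"
  shows "summable (\<lambda>n. norm (f (int_decode n)))" "infsum f UNIV = (\<Sum>n. f (int_decode n))"
proof -
  have *: "(\<lambda>n. norm (f (int_decode n))) summable_on UNIV"
    using assms summable_on_reindex_bij_betw[OF bij_int_decode, of "\<lambda>n. norm (f n)"] by simp
  then show "summable (\<lambda>n. norm (f (int_decode n)))"
    using summable_on_imp_summable by blast
  have "((\<lambda>n. f (int_decode n)) has_sum infsum (\<lambda>n. f (int_decode n)) UNIV) UNIV"
    by (rule has_sum_infsum[OF abs_summable_summable[OF *]])
  then have "infsum (\<lambda>n. f (int_decode n)) UNIV = (\<Sum>n. f (int_decode n))"
    using has_sum_imp_sums sums_unique by blast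
  then show "infsum f UNIV = (\<Sum>n. f (int_decode n))"
    using infsum_reindex_bij_betw[OF bij_int_decode, of f] by simp
qed

text \<open>Dominated convergence over the integers: absolute convergence permits the enumeration
  \<open>int_decode\<close>, which reduces the claim to Tannery's theorem for sequences.\<close>

lemma tannery_int:
  fixes f :: "nat \<Rightarrow> int \<Rightarrow> complex"
  assumes lim: "\<And>n. (\<lambda>N. f N n) \<longlonglongrightarrow> g n"
    and bound: "\<And>N n. norm (f N n) \<le> M n"
    and M: "M summable_on UNIV"
  shows "(\<lambda>N. infsum (f N) UNIV) \<longlonglongrightarrow> infsum g UNIV"
proof -
  have "norm (g n) \<le> M n" for n
    using tendsto_norm[OF lim[of n]] bound by (intro tendsto_upperbound[where F = sequentially]) auto
  then have g: "(\<lambda>n. norm (g n)) summable_on UNIV"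
    using M by (intro Infinite_Sum.abs_summable_on_comparison_test'[of M]) auto
  have f: "(\<lambda>n. norm (f N n)) summable_on UNIV" for N
    using M bound by (intro Infinite_Sum.abs_summable_on_comparison_test'[of M]) auto
  have "(\<lambda>n. M (int_decode n)) summable_on UNIV"
    using M summable_on_reindex_bij_betw[OF bij_int_decode, of M] by simp
  then have "summable (\<lambda>n. M (int_decode n))" by (rule summable_on_imp_summable)
  moreover have "eventually (\<lambda>(k, N). norm (f N (int_decode k)) \<le> M (int_decode k)) (at_top \<times>\<^sub>F sequentially)"
    by (rule always_eventually) (use bound in auto)
  ultimately have "(\<lambda>N. \<Sum>n. f N (int_decode n)) \<longlonglongrightarrow> (\<Sum>n. g (int_decode n))"
    using tannerys_theorem[of "\<lambda>n N. f N (int_decode n)" "\<lambda>n. g (int_decode n)" sequentially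
        "\<lambda>n. M (int_decode n)"] lim by simp
  then show ?thesis using infsum_int_eq_suminf[OF f] infsum_int_eq_suminf[OF g] by simp
qed

lemma summable_on_int_nat:
  fixes f :: "int \<Rightarrow> real"
  assumes "summable (\<lambda>n::nat. f (int n))" "summable (\<lambda>n::nat. f (- int n))" "\<And>n. f n \<ge> 0"
  shows "f summable_on UNIV"
proof -
  have "(\<lambda>n::nat. f (int n)) summable_on UNIV" "(\<lambda>n::nat. f (- int n)) summable_on UNIV"
    using assms by (auto simp: summable_on_UNIV_nonneg_real_iff)
  then have "f summable_on range int" "f summable_on range (\<lambda>n. - int n)"
    using summable_on_reindex[of int UNIV f] summable_on_reindex[of "\<lambda>n. - int n" UNIV f]
    by (auto simp: o_def inj_def)
  moreover have "(UNIV :: int set) = range int \<union> (range (\<lambda>n. - int n) - range int)"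
    by (auto simp: image_iff) (metis int_cases2)
  ultimately show ?thesis
    by (metis summable_on_Un_disjoint summable_on_subset_banach Diff_disjoint Diff_subset)
qed

text \<open>Consecutive terms have the quotient \<open>R * r ^ n\<close>, which tends to 0: the
  quadratic exponent beats any geometric growth.\<close>

lemma summable_partial_theta:
  fixes R r :: real
  assumes "R \<ge> 0" "0 \<le> r" "r < 1"
  shows "summable (\<lambda>n. R ^ n * r ^ (n * (n - 1) div 2))"
proof -
  have "(\<lambda>n. R * r ^ n) \<longlonglongrightarrow> R * 0"
    using assms by (intro tendsto_mult tendsto_const LIMSEQ_power_zero) auto
  then have "eventually (\<lambda>n. R * r ^ n < 1/2) sequentially"
    by (intro order_tendstoD(2)[where y = "R * 0"]) auto
  then obtain N where N: "\<And>n. n \<ge> N \<Longrightarrow> R * r ^ n < 1/2"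
    by (auto simp: eventually_sequentially)
  show ?thesis
  proof (rule summable_ratio_test[of "1/2" N])
    fix n assume n: "n \<ge> N"
    have "Suc n * (Suc n - 1) div 2 = n * (n - 1) div 2 + n"
      by (cases n) (auto simp: algebra_simps)
    then have "norm (R ^ Suc n * r ^ (Suc n * (Suc n - 1) div 2)) = (R * r ^ n) * norm (R ^ n * r ^ (n * (n - 1) div 2))"
      using assms by (simp add: power_add algebra_simps)
    also have "\<dots> \<le> 1/2 * norm (R ^ n * r ^ (n * (n - 1) div 2))"
      using N[OF n] by (intro mult_right_mono) auto
    finally show "norm (R ^ Suc n * r ^ (Suc n * (Suc n - 1) div 2)) \<le> 1/2 * norm (R ^ n * r ^ (n * (n - 1) div 2))" .
  qed auto
qed

text \<open>The condition on \<open>e\<close> asks for the smaller of the triangular numbers that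
  belong to n and -n. One condition thus covers the exponents n(n-1)/2, n^2, n^2 - n and n^2 + n on
  both half-lines.\<close>

lemma theta_majorant_summable:
  fixes R r :: real
  assumes "R \<ge> 0" "0 \<le> r" "r < 1" "\<And>n. \<bar>n\<bar> * (\<bar>n\<bar> - 1) \<le> 2 * e n"
  shows "(\<lambda>n::int. R ^ nat \<bar>n\<bar> * r ^ nat (e n)) summable_on UNIV"
proof -
  have le: "R ^ m * r ^ nat (e n) \<le> R ^ m * r ^ (m * (m - 1) div 2)" if "nat \<bar>n\<bar> = m" for m n
  proof (intro mult_left_mono power_decreasing)
    have "int m * (int m - 1) \<le> 2 * e n" using assms(4)[of n] that by auto
    moreover have "int (m * (m - 1)) = int m * (int m - 1)" by (cases m) (simp_all add: ring_distribs)
    ultimately show "m * (m - 1) div 2 \<le> nat (e n)" by linarith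
  qed (use assms in auto)
  have 1: "summable (\<lambda>n::nat. R ^ n * r ^ nat (e (int n)))"
    by (rule summable_comparison_test'[OF summable_partial_theta[OF assms(1-3)], of 0]) (use assms le[of "int n" n for n] in auto)
  have 2: "summable (\<lambda>n::nat. R ^ n * r ^ nat (e (- int n)))"
    by (rule summable_comparison_test'[OF summable_partial_theta[OF assms(1-3)], of 0]) (use assms le[of "- int n" n for n] in auto)
  show ?thesis
    by (rule summable_on_int_nat) (use 1 2 assms in auto)
qed

lemma theta_abs_summable:
  fixes q :: complex and f :: "int \<Rightarrow> complex"
  assumes "norm q < 1" "R \<ge> 0" "\<And>n. norm (f n) \<le> C * (R ^ nat \<bar>n\<bar> * norm q ^ nat (e n))"
    "\<And>n. \<bar>n\<bar> * (\<bar>n\<bar> - 1) \<le> 2 * e n"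
  shows "(\<lambda>n. norm (f n)) summable_on UNIV"
  by (rule Infinite_Sum.abs_summable_on_comparison_test'[where g = "\<lambda>n. C * (R ^ nat \<bar>n\<bar> * norm q ^ nat (e n))"])
    (use assms in \<open>auto intro!: summable_on_cmult_right theta_majorant_summable\<close>)

lemma infsum_mult:
  fixes f :: "'a \<Rightarrow> complex" and g :: "'b \<Rightarrow> complex"
  assumes "(\<lambda>n. norm (f n)) summable_on UNIV" "(\<lambda>n. norm (g n)) summable_on UNIV"
  shows "(\<lambda>p. norm (case p of (m,n) \<Rightarrow> f m * g n)) summable_on UNIV"
    and "infsum (\<lambda>(m,n). f m * g n) UNIV = infsum f UNIV * infsum g UNIV"
proof -
  have "(\<lambda>p. norm (case p of (m,n) \<Rightarrow> f m * g n)) summable_on (UNIV \<times> UNIV)"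
    unfolding Infinite_Sum.abs_summable_on_Sigma_iff using assms
    by (auto simp: norm_mult infsum_cmult_right' abs_mult
        intro!: summable_on_cmult_right summable_on_cmult_left infsum_nonneg)
  then show *: "(\<lambda>p. norm (case p of (m,n) \<Rightarrow> f m * g n)) summable_on UNIV" by simp
  then have "(\<lambda>(m,n). f m * g n) summable_on (UNIV \<times> UNIV)"
    using abs_summable_summable by auto
  from infsum_Sigma_banach[OF this]
  show "infsum (\<lambda>(m,n). f m * g n) UNIV = infsum f UNIV * infsum g UNIV"
    by (simp add: infsum_cmult_right' infsum_cmult_left')
qed

subsection \<open>The Jacobi triple product\<close>

text \<open>Of the two q-Pascal rules this is the one that fits a product extended by its last
  factor. For k > n the truncated \<open>n - k\<close> is harmless, because
  \<open>qbinom q n k\<close> is then 0.\<close>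

fun qbinom :: "complex \<Rightarrow> nat \<Rightarrow> nat \<Rightarrow> complex" where
  "qbinom q n 0 = 1"
| "qbinom q 0 (Suc k) = 0"
| "qbinom q (Suc n) (Suc k) = q ^ (n - k) * qbinom q n k + qbinom q n (Suc k)"

lemma qbinom_eq_0: "n < k \<Longrightarrow> qbinom q n k = 0"
  by (induction q n k rule: qbinom.induct) auto

definition qfact :: "complex \<Rightarrow> nat \<Rightarrow> complex" where
  "qfact q n = (\<Prod>k<n. 1 - q * q ^ k)"

lemma qfact_0 [simp]: "qfact q 0 = 1" and qfact_Suc: "qfact q (Suc n) = qfact q n * (1 - q ^ Suc n)"
  by (simp_all add: qfact_def)

text \<open>Multiplied out, so that it holds for every q. In the main case the two summands of the
  Pascal rule combine by q^(d+1) (1 - q^(k+1)) + (1 - q^(d+1)) = 1 - q^(d+k+2).\<close>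

lemma qbinom_qfact: "k \<le> n \<Longrightarrow> qbinom q n k * (qfact q k * qfact q (n - k)) = qfact q n"
proof (induction q n k rule: qbinom.induct)
  case (3 q n k)
  have 1: "qbinom q n k * (qfact q k * qfact q (n - k)) = qfact q n"
    using 3 by auto
  show ?case
  proof (cases "k = n")
    case True
    have "qbinom q (Suc n) (Suc n) * (qfact q (Suc n) * qfact q 0) =
        (qbinom q n n * (qfact q n * qfact q 0)) * (1 - q ^ Suc n)"
      by (simp add: qbinom_eq_0 qfact_Suc del: power_Suc)
    then show ?thesis using 1 True by (simp only: qfact_Suc diff_self_eq_0)
  next
    case False
    then have "Suc k \<le> n" using 3 by simp
    then obtain d where d: "n = Suc k + d" using le_Suc_ex by blast
    have 2: "qbinom q n (Suc k) * (qfact q (Suc k) * qfact q (n - Suc k)) = qfact q n"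
      using 3 \<open>Suc k \<le> n\<close> by auto
    have "n - k = Suc d" "n - Suc k = d" "Suc n - Suc k = Suc d" using d by auto
    have "qbinom q (Suc n) (Suc k) * (qfact q (Suc k) * qfact q (Suc n - Suc k)) =
       q ^ Suc d * (1 - q ^ Suc k) * (qbinom q n k * (qfact q k * qfact q (n - k))) +
       (1 - q ^ Suc d) * (qbinom q n (Suc k) * (qfact q (Suc k) * qfact q (n - Suc k)))"
      unfolding qbinom.simps \<open>n - k = Suc d\<close> \<open>n - Suc k = d\<close> \<open>Suc n - Suc k = Suc d\<close>
      by (simp add: qfact_Suc algebra_simps)
    also have "\<dots> = qfact q n * (1 - q ^ (Suc d + Suc k))"
      unfolding 1 2 by (simp add: algebra_simps power_add)
    also have "\<dots> = qfact q (Suc n)"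
      unfolding qfact_Suc d by (simp add: algebra_simps)
    finally show ?thesis .
  qed
qed auto

lemma triangle_Suc: "Suc j * (Suc j - 1) div 2 = j * (j - 1) div 2 + j"
  by (cases j) (auto simp: algebra_simps)

text \<open>The new factor 1 + z q^M shifts the index by one. Since the monomials satisfy t(j+1) = z
  q^j t(j), the weight q^(M-j) of the Pascal rule completes q^j to q^M.\<close>

theorem q_binomial_theorem:
  "(\<Prod>k<M. 1 + z * q ^ k) = (\<Sum>j\<le>M. qbinom q M j * q ^ (j * (j - 1) div 2) * z ^ j)"
proof (induction M)
  case 0
  then show ?case by simp
next
  case (Suc M)
  define t where "t j = q ^ (j * (j - 1) div 2) * z ^ j" for j
  have t_Suc: "t (Suc j) = z * q ^ j * t j" for j
    unfolding t_def triangle_Suc by (simp add: power_add)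
  have "(\<Sum>j\<le>Suc M. qbinom q (Suc M) j * t j) =
      t 0 + (\<Sum>j\<le>M. qbinom q (Suc M) (Suc j) * t (Suc j))"
    by (subst sum.atMost_Suc_shift) simp
  also have "(\<Sum>j\<le>M. qbinom q (Suc M) (Suc j) * t (Suc j)) =
      (\<Sum>j\<le>M. z * q ^ M * (qbinom q M j * t j)) + (\<Sum>j\<le>M. qbinom q M (Suc j) * t (Suc j))"
    unfolding sum.distrib[symmetric]
  proof (rule sum.cong[OF refl])
    fix j assume "j \<in> {..M}"
    then have "q ^ M = q ^ (M - j) * q ^ j" by (simp flip: power_add)
    then show "qbinom q (Suc M) (Suc j) * t (Suc j) =
        z * q ^ M * (qbinom q M j * t j) + qbinom q M (Suc j) * t (Suc j)"
      unfolding t_Suc by (simp add: algebra_simps)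
  qed
  also have "t 0 + ((\<Sum>j\<le>M. z * q ^ M * (qbinom q M j * t j)) + (\<Sum>j\<le>M. qbinom q M (Suc j) * t (Suc j)))
     = (\<Sum>j\<le>M. z * q ^ M * (qbinom q M j * t j)) + (\<Sum>j\<le>Suc M. qbinom q M j * t j)"
    using sum.atMost_Suc_shift[of "\<lambda>j. qbinom q M j * t j" M] by simp
  also have "\<dots> = (1 + z * q ^ M) * (\<Sum>j\<le>M. qbinom q M j * t j)"
    by (simp add: qbinom_eq_0 sum_distrib_left distrib_right mult.assoc sum.distrib)
  finally show ?case using Suc.IH by (simp add: t_def mult_ac)
qed

section \<open>Cauchy's finite form of the triple product and its limit\<close>

definition theta_term :: "complex \<Rightarrow> complex \<Rightarrow> int \<Rightarrow> complex" where
  "theta_term q x n = (-x) powi n * q powi (n * (n - 1) div 2)"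

text \<open>Extended by 0, so that the finite sums are sums over all integers whose coefficients
  converge for each fixed index; this is the shape that dominated convergence needs.\<close>

definition theta_coeff :: "complex \<Rightarrow> nat \<Rightarrow> int \<Rightarrow> complex" where
  "theta_coeff q N n = (if \<bar>n\<bar> \<le> int N then qbinom q (2 * N) (nat (int N + n)) else 0)"

lemma int_triangle: "int (j * (j - 1) div 2) = int j * (int j - 1) div 2"
  by (cases j) (auto simp: zdiv_int algebra_simps)

text \<open>The q-binomial theorem with \<open>2 * N\<close> factors, recentred at j = N + n. For z
  = - x / q^N the last N factors are 1 - x q^k; the first N, read backwards, are 1 - (q/x) q^k up to
  the monomials collected in \<open>K\<close>.\<close>

lemma finite_triple_product:
  assumes "q \<noteq> 0" "x \<noteq> 0"
  shows "(\<Prod>k<N. 1 - x * q ^ k) * (\<Prod>k<N. 1 - q / x * q ^ k) =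
    (\<Sum>n\<in>{- int N..int N}. theta_coeff q N n * theta_term q x n)"
proof -
  define z where "z = - x / q ^ N"
  define K where "K = (\<Prod>k<N. - x / q ^ Suc k)"
  have K: "K \<noteq> 0" using assms by (simp add: K_def)
  have K_eq: "K = (-x) powi (int N) * q powi (- (int N * (int N + 1) div 2))"
  proof -
    have "(\<Prod>k<N. - x / q ^ Suc k) = (-x) ^ N / q ^ (N * (N + 1) div 2)"
    proof (induction N)
      case (Suc N)
      have "Suc N * (Suc N + 1) div 2 = N * (N + 1) div 2 + Suc N"
        using triangle_Suc[of "Suc N"] by (simp add: algebra_simps)
      then show ?case using Suc assms by (simp add: power_add divide_simps)
    qed auto
    moreover have "int N * (int N + 1) div 2 = int (N * (N + 1) div 2)"
      by (simp add: zdiv_int algebra_simps)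
    ultimately show ?thesis
      unfolding K_def by (simp add: power_int_minus divide_inverse)
  qed
  have "(\<Prod>k<2 * N. 1 + z * q ^ k) = (\<Prod>k<N. 1 + z * q ^ k) * (\<Prod>k<N. 1 + z * q ^ (N + k))"
  proof -
    have "{..<2 * N} = {..<N} \<union> {N..<N + N}" by auto
    moreover have "(\<Prod>k\<in>{N..<N + N}. 1 + z * q ^ k) = (\<Prod>k<N. 1 + z * q ^ (N + k))"
      by (rule prod.reindex_bij_witness[of _ "\<lambda>j. N + j" "\<lambda>j. j - N"]) auto
    ultimately show ?thesis by (simp add: prod.union_disjoint ivl_disj_int_one(2))
  qed
  moreover have "(\<Prod>k<N. 1 + z * q ^ k) = K * (\<Prod>k<N. 1 - q / x * q ^ k)"
  proof -
    have "(\<Prod>k<N. 1 + z * q ^ k) = (\<Prod>k<N. 1 + z * q ^ (N - Suc k))"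
      by (rule prod.nat_diff_reindex[symmetric])
    also have "\<dots> = (\<Prod>k<N. (- x / q ^ Suc k) * (1 - q / x * q ^ k))"
    proof (rule prod.cong[OF refl])
      fix k assume "k \<in> {..<N}"
      then have "q ^ N = q ^ Suc k * q ^ (N - Suc k)"
        unfolding power_add[symmetric] by simp
      then show "1 + z * q ^ (N - Suc k) = (- x / q ^ Suc k) * (1 - q / x * q ^ k)"
        using assms by (simp add: z_def field_simps)
    qed
    finally show ?thesis unfolding prod.distrib K_def .
  qed
  moreover have "1 + z * q ^ (N + k) = 1 - x * q ^ k" for k
    using assms by (simp add: z_def power_add)
  ultimately have "(\<Prod>k<2 * N. 1 + z * q ^ k) =
      K * ((\<Prod>k<N. 1 - x * q ^ k) * (\<Prod>k<N. 1 - q / x * q ^ k))"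
    by (simp only: mult_ac)
  moreover have "(\<Sum>j\<le>2 * N. qbinom q (2 * N) j * q ^ (j * (j - 1) div 2) * z ^ j) =
      (\<Sum>n\<in>{- int N..int N}. K * (theta_coeff q N n * theta_term q x n))"
  proof (rule sum.reindex_bij_witness[of _ "\<lambda>n. nat (int N + n)" "\<lambda>j. int j - int N"])
    fix j assume j: "j \<in> {..2 * N}"
    define n where "n = int j - int N"
    have j_eq: "int j = int N + n" by (simp add: n_def)
    have "2 * (int j * (int j - 1) div 2) = int j * (int j - 1)" 
         "2 * (n * (n - 1) div 2) = n * (n - 1)" "2 * (int N * (int N + 1) div 2) = int N * (int N + 1)"
      by simp_all
    \<comment> \<open>Recentring turns the triangular exponent of j, corrected by the N j coming
      from z^j, into that of n; what is left over depends on N alone and is the exponent of q in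
      \<open>K\<close>.\<close>
    then have e: "int j * (int j - 1) div 2 - int N * int j = n * (n - 1) div 2 - int N * (int N + 1) div 2"
      unfolding j_eq by (simp add: algebra_simps)
    have "q ^ (j * (j - 1) div 2) * z ^ j = (-x) powi int j * (q powi (int j * (int j - 1) div 2) * q powi (- (int N * int j)))"
      unfolding z_def power_divide
      by (simp add: int_triangle[symmetric] power_int_minus divide_inverse flip: power_mult of_nat_mult)
    also have "\<dots> = (-x) powi (int N + n) * q powi (n * (n - 1) div 2 - int N * (int N + 1) div 2)"
      using assms by (simp add: e[symmetric] j_eq flip: power_int_add)
    also have "\<dots> = K * theta_term q x n"
      using assms by (simp add: K_eq theta_term_def power_int_add power_int_diff power_int_minus field_simps)
    finally have "q ^ (j * (j - 1) div 2) * z ^ j = K * theta_term q x n" .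
    moreover have "theta_coeff q N n = qbinom q (2 * N) j"
      using j by (auto simp: theta_coeff_def n_def)
    ultimately show "K * (theta_coeff q N (int j - int N) * theta_term q x (int j - int N)) =
        qbinom q (2 * N) j * q ^ (j * (j - 1) div 2) * z ^ j"
      by (simp add: n_def mult_ac)
  qed auto
  ultimately have "K * ((\<Prod>k<N. 1 - x * q ^ k) * (\<Prod>k<N. 1 - q / x * q ^ k)) =
      K * (\<Sum>n\<in>{- int N..int N}. theta_coeff q N n * theta_term q x n)"
    using q_binomial_theorem[of z q "2 * N"] by (simp add: sum_distrib_left)
  then show ?thesis using K by simp
qed

lemma norm_powi_le:
  fixes x :: complex
  assumes "x \<noteq> 0"
  shows "norm (x powi n) \<le> (max (norm x) (inverse (norm x))) ^ nat \<bar>n\<bar>"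
proof (cases "n \<ge> 0")
  case True
  then show ?thesis by (simp add: power_int_nonneg_exp norm_power power_mono)
next
  case False
  then have "x powi n = inverse x ^ nat \<bar>n\<bar>" by (simp add: power_int_def)
  then show ?thesis by (simp add: norm_power norm_inverse power_mono)
qed

text \<open>Crude on purpose: the polynomial weights produced by differentiation become geometric
  factors, which the theta majorants absorb.\<close>

lemma weight_le: "\<bar>real_of_int n\<bar> ^ k \<le> (2 ^ k) ^ nat \<bar>n\<bar>"
proof -
  have "real m \<le> 2 ^ m" for m :: nat
    using of_nat_less_two_power[of m, where 'a = real] by simp
  then have "\<bar>real_of_int n\<bar> \<le> 2 ^ nat \<bar>n\<bar>"
    by (metis of_int_abs of_int_of_nat_eq abs_ge_zero nat_0_le of_nat_nat)
  then have "\<bar>real_of_int n\<bar> ^ k \<le> (2 ^ nat \<bar>n\<bar>) ^ k" by (intro power_mono) auto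
  then show ?thesis by (simp add: mult.commute flip: power_mult)
qed

lemma triangle_nonneg: "n * (n - 1) div 2 \<ge> (0 :: int)"
proof -
  have "n * (n - 1) \<ge> 0" by (cases "n \<ge> 1") (auto simp: mult_nonpos_nonpos)
  then show ?thesis by simp
qed

lemma abs_triangle_le: "\<bar>n\<bar> * (\<bar>n\<bar> - 1) \<le> 2 * (n * (n - 1) div 2)" for n :: int
proof -
  have "2 * (n * (n - 1) div 2) = n * (n - 1)" by simp
  then show ?thesis by (auto simp: abs_if algebra_simps)
qed

text \<open>The maximum controls positive and negative powers of x at once, and \<open>2 ^ k\<close>
  pays for the weight n^k.\<close>

definition theta_majorant :: "nat \<Rightarrow> complex \<Rightarrow> complex \<Rightarrow> int \<Rightarrow> real" where
  "theta_majorant k q x n =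
    (2 ^ k * max (norm x) (inverse (norm x))) ^ nat \<bar>n\<bar> * norm q ^ nat (n * (n - 1) div 2)"

lemma theta_majorant_summable_on:
  assumes "norm q < 1"
  shows "theta_majorant k q x summable_on UNIV"
  unfolding theta_majorant_def
  by (intro theta_majorant_summable) (use assms abs_triangle_le in \<open>auto simp: le_max_iff_disj\<close>)

lemma theta_majorant_ge:
  assumes "x \<noteq> 0"
  shows "norm (of_int n ^ k * theta_term q x n) \<le> theta_majorant k q x n"
proof -
  have "norm (of_int n ^ k * theta_term q x n) =
      \<bar>real_of_int n\<bar> ^ k * (norm ((-x) powi n) * norm q ^ nat (n * (n - 1) div 2))"
    by (simp add: theta_term_def norm_mult norm_power power_int_nonneg_exp[OF triangle_nonneg])
  also have "\<dots> \<le> (2 ^ k) ^ nat \<bar>n\<bar> *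
      ((max (norm x) (inverse (norm x))) ^ nat \<bar>n\<bar> * norm q ^ nat (n * (n - 1) div 2))"
    using norm_powi_le[of "-x" n] assms
    by (intro mult_mono weight_le) (auto simp: le_max_iff_disj intro!: zero_le_power)
  finally show ?thesis by (simp add: theta_majorant_def power_mult_distrib)
qed

text \<open>The series of D^k T with D = x d/dx, written down termwise.\<close>

definition theta_sum :: "nat \<Rightarrow> complex \<Rightarrow> complex \<Rightarrow> complex" where
  "theta_sum k q x = (\<Sum>\<^sub>\<infinity>n\<in>UNIV. of_int n ^ k * theta_term q x n)"

lemma theta_weighted_summable:
  assumes "norm q < 1" "x \<noteq> 0"
  shows "(\<lambda>n. norm (of_int n ^ k * theta_term q x n)) summable_on UNIV"
  using theta_majorant_ge[OF assms(2)] theta_majorant_summable_on[OF assms(1)]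
  by (intro Infinite_Sum.abs_summable_on_comparison_test'[of "theta_majorant k q x"]) auto

lemma qfact_LIMSEQ: "norm q < 1 \<Longrightarrow> qfact q \<longlonglongrightarrow> euler_E q"
  unfolding qfact_def euler_E_qpoch by (rule qpoch_LIMSEQ)

lemma qfact_nonzero:
  assumes "norm q < 1" 
  shows "qfact q n \<noteq> 0"
proof -
  have "q * q ^ k \<noteq> 1" for k
    using norm_power_less_1[OF assms, of "Suc k"] by (metis norm_one power_Suc zero_less_Suc less_irrefl)
  then show ?thesis by (simp add: qfact_def)
qed

lemma qbinom_eq:
  assumes "norm q < 1" "k \<le> n"
  shows "qbinom q n k = qfact q n / (qfact q k * qfact q (n - k))"
  using qbinom_qfact[OF assms(2), of q] qfact_nonzero[OF assms(1)] by (simp add: field_simps)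

text \<open>\<open>qfact q\<close> and its inverse both converge, the limit \<open>euler_E q\<close>
  being nonzero, and are therefore bounded; this gives one bound for all N and n.\<close>

lemma theta_coeff_bounded:
  assumes "norm q < 1"
  shows "\<exists>C. \<forall>N n. norm (theta_coeff q N n) \<le> C"
proof -
  have "Bseq (qfact q)" using qfact_LIMSEQ[OF assms] convergentI convergent_imp_Bseq by blast
  then obtain A where A: "\<And>n. norm (qfact q n) \<le> A" by (auto simp: Bseq_def)
  have "(\<lambda>n. inverse (qfact q n)) \<longlonglongrightarrow> inverse (euler_E q)"
    using qfact_LIMSEQ euler_E_nonzero assms by (intro tendsto_inverse) auto
  then have "Bseq (\<lambda>n. inverse (qfact q n))" using convergentI convergent_imp_Bseq by blast
  then obtain B where B: "\<And>n. norm (inverse (qfact q n)) \<le> B" by (auto simp: Bseq_def)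
  have "A \<ge> 0" "B \<ge> 0" using A B norm_ge_zero order_trans by blast+
  have "norm (theta_coeff q N n) \<le> A * (B * B)" for N n
  proof (cases "\<bar>n\<bar> \<le> int N")
    case True
    then have "nat (int N + n) \<le> 2 * N" by auto
    from qbinom_eq[OF assms this] True have "theta_coeff q N n = qfact q (2 * N) *
        (inverse (qfact q (nat (int N + n))) * inverse (qfact q (2 * N - nat (int N + n))))"
      by (simp add: theta_coeff_def divide_inverse)
    also have "norm \<dots> \<le> A * (B * B)"
      unfolding norm_mult using A B \<open>A \<ge> 0\<close> \<open>B \<ge> 0\<close> by (intro mult_mono) auto
    finally show ?thesis .
  qed (use \<open>A \<ge> 0\<close> \<open>B \<ge> 0\<close> in \<open>auto simp: theta_coeff_def\<close>)
  then show ?thesis by blast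
qed

lemma theta_coeff_LIMSEQ:
  assumes "norm q < 1"
  shows "(\<lambda>N. theta_coeff q N n) \<longlonglongrightarrow> 1 / euler_E q"
proof -
  have *: "filterlim (\<lambda>N. nat (int N + m)) sequentially sequentially" for m
  proof (rule filterlim_at_top_mono[OF filterlim_minus_const_nat_at_top[of "nat \<bar>m\<bar>"]])
    show "eventually (\<lambda>N. N - nat \<bar>m\<bar> \<le> nat (int N + m)) sequentially"
      by (rule always_eventually) auto
  qed
  have "filterlim (\<lambda>N. 2 * N) sequentially sequentially"
    by (rule filterlim_at_top_mono[OF filterlim_ident]) auto
  then have "(\<lambda>N. qfact q (2 * N) / (qfact q (nat (int N + n)) * qfact q (nat (int N + - n)))) \<longlonglongrightarrow>
      euler_E q / (euler_E q * euler_E q)"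
    using assms euler_E_nonzero[OF assms]
    by (intro tendsto_divide tendsto_mult filterlim_compose[OF qfact_LIMSEQ] *) auto
  moreover have "eventually (\<lambda>N. qfact q (2 * N) / (qfact q (nat (int N + n)) * qfact q (nat (int N + - n)))
      = theta_coeff q N n) sequentially"
    using eventually_ge_at_top[of "nat \<bar>n\<bar>"]
  proof eventually_elim
    case (elim N)
    then have "nat (int N + n) \<le> 2 * N" "nat (int N + - n) = 2 * N - nat (int N + n)" by auto
    with qbinom_eq[OF assms this(1)] elim show ?case by (simp add: theta_coeff_def)
  qed
  ultimately show ?thesis using euler_E_nonzero[OF assms] Lim_transform_eventually by fastforce
qed

text \<open>This replaces the differentiation of a bilateral series: k = 0 yields the triple
  product, k = 1 and k = 2 the limits of its first two derivatives.\<close>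

lemma theta_sum_LIMSEQ:
  assumes "norm q < 1" "x \<noteq> 0"
  shows "(\<lambda>N. \<Sum>n\<in>{- int N..int N}. of_int n ^ k * (theta_coeff q N n * theta_term q x n))
    \<longlonglongrightarrow> theta_sum k q x / euler_E q"
proof -
  obtain C where C: "\<And>N n. norm (theta_coeff q N n) \<le> C" using theta_coeff_bounded[OF assms(1)] by blast
  have "C \<ge> 0" using C norm_ge_zero order_trans by blast
  have "(\<lambda>N. infsum (\<lambda>n. theta_coeff q N n * (of_int n ^ k * theta_term q x n)) UNIV)
      \<longlonglongrightarrow> infsum (\<lambda>n. 1 / euler_E q * (of_int n ^ k * theta_term q x n)) UNIV"
  proof (rule tannery_int)
    show "(\<lambda>N. theta_coeff q N n * (of_int n ^ k * theta_term q x n))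
        \<longlonglongrightarrow> 1 / euler_E q * (of_int n ^ k * theta_term q x n)" for n
      by (intro tendsto_mult tendsto_const theta_coeff_LIMSEQ assms)
    show "norm (theta_coeff q N n * (of_int n ^ k * theta_term q x n)) \<le> C * theta_majorant k q x n" for N n
      unfolding norm_mult[of "theta_coeff q N n"] using C \<open>C \<ge> 0\<close> theta_majorant_ge[OF assms(2)]
      by (intro mult_mono) auto
    show "(\<lambda>n. C * theta_majorant k q x n) summable_on UNIV"
      by (intro summable_on_cmult_right theta_majorant_summable_on assms)
  qed
  moreover have "infsum (\<lambda>n. theta_coeff q N n * (of_int n ^ k * theta_term q x n)) UNIV =
     (\<Sum>n\<in>{- int N..int N}. of_int n ^ k * (theta_coeff q N n * theta_term q x n))" for N
  proof -
    have "infsum (\<lambda>n. theta_coeff q N n * (of_int n ^ k * theta_term q x n)) UNIV =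
      infsum (\<lambda>n. theta_coeff q N n * (of_int n ^ k * theta_term q x n)) {- int N..int N}"
      by (rule infsum_cong_neutral) (auto simp: theta_coeff_def)
    then show ?thesis by (simp add: mult_ac)
  qed
  moreover have "infsum (\<lambda>n. 1 / euler_E q * (of_int n ^ k * theta_term q x n)) UNIV =
      theta_sum k q x / euler_E q"
    by (simp only: infsum_cmult_right' theta_sum_def) simp
  ultimately show ?thesis by simp
qed

theorem triple_product:
  assumes "norm q < 1" "q \<noteq> 0" "x \<noteq> 0"
  shows "theta_sum 0 q x = euler_E q * qpoch x q * qpoch (q / x) q"
proof -
  have "(\<lambda>N. (\<Prod>k<N. 1 - x * q ^ k) * (\<Prod>k<N. 1 - q / x * q ^ k)) \<longlonglongrightarrow> qpoch x q * qpoch (q / x) q"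
    by (intro tendsto_mult qpoch_LIMSEQ assms)
  moreover have "(\<lambda>N. (\<Prod>k<N. 1 - x * q ^ k) * (\<Prod>k<N. 1 - q / x * q ^ k)) \<longlonglongrightarrow>
      theta_sum 0 q x / euler_E q"
    using theta_sum_LIMSEQ[of q x 0] finite_triple_product[of q x] assms by simp
  ultimately have "qpoch x q * qpoch (q / x) q = theta_sum 0 q x / euler_E q"
    by (rule LIMSEQ_unique)
  then show ?thesis using euler_E_nonzero[OF assms(1)] by (simp add: field_simps)
qed

text \<open>\<open>jet q x N\<close> is \<open>(F, D F, D\<^sup>2 F)\<close> for the \<open>N\<close>-th partial product \<open>F\<close> of
  the triple product and \<open>D = x d/dx\<close>.\<close>

fun jet :: "complex \<Rightarrow> complex \<Rightarrow> nat \<Rightarrow> complex \<times> complex \<times> complex" where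
  "jet q x 0 = (1, 0, 0)"
| "jet q x (Suc N) = (let (f, g, h) = jet q x N;
      a = (1 - x * q ^ N) * (1 - q / x * q ^ N);
      b = q ^ Suc N / x - x * q ^ N;
      c = - (q ^ Suc N / x + x * q ^ N) in (f * a, g * a + f * b, h * a + 2 * g * b + f * c))"

abbreviation "jet0 q x N \<equiv> fst (jet q x N)"
abbreviation "jet1 q x N \<equiv> fst (snd (jet q x N))"
abbreviation "jet2 q x N \<equiv> snd (snd (jet q x N))"

section \<open>The first two derivatives of the partial products\<close>

lemma jet0_eq: "jet0 q x N = (\<Prod>k<N. 1 - x * q ^ k) * (\<Prod>k<N. 1 - q / x * q ^ k)"
  by (induction N) (auto simp: Let_def case_prod_beta)

text \<open>Leibniz's rule, one factor at a time: for the new factor a the recursion uses b = D a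
  and c = D b, and d/dx is D divided by x.\<close>

lemma jet_deriv:
  assumes "x \<noteq> 0"
  shows "((\<lambda>x. jet0 q x N) has_field_derivative jet1 q x N / x) (at x) \<and>
         ((\<lambda>x. jet1 q x N) has_field_derivative jet2 q x N / x) (at x)"
proof (induction N)
  case 0
  then show ?case by simp
next
  case (Suc N)
  define a where "a x = (1 - x * q ^ N) * (1 - q / x * q ^ N)" for x
  define b where "b x = q ^ Suc N / x - x * q ^ N" for x
  define c where "c x = - (q ^ Suc N / x + x * q ^ N)" for x
  have a: "(a has_field_derivative b x / x) (at x)"
    unfolding a_def b_def using assms
    by (auto intro!: derivative_eq_intros simp del: if_split) (simp add: field_simps power2_eq_square)
  have b: "(b has_field_derivative c x / x) (at x)"
    unfolding b_def c_def using assms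
    by (auto intro!: derivative_eq_intros) (simp add: field_simps power2_eq_square)
  have "((\<lambda>x. jet0 q x N * a x) has_field_derivative
      (jet1 q x N * a x + jet0 q x N * b x) / x) (at x)"
    by (rule DERIV_cong[OF DERIV_mult[OF conjunct1[OF Suc] a]]) (simp add: add_divide_distrib)
  moreover have "((\<lambda>x. jet1 q x N * a x + jet0 q x N * b x) has_field_derivative
      (jet2 q x N * a x + 2 * jet1 q x N * b x + jet0 q x N * c x) / x) (at x)"
    by (rule DERIV_cong[OF DERIV_add[OF DERIV_mult[OF conjunct2[OF Suc] a] DERIV_mult[OF conjunct1[OF Suc] b]]])
      (simp add: add_divide_distrib mult_ac)
  moreover have "jet q y (Suc N) = (jet0 q y N * a y, jet1 q y N * a y + jet0 q y N * b y,
      jet2 q y N * a y + 2 * jet1 q y N * b y + jet0 q y N * c y)" for y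
    by (simp add: a_def b_def c_def Let_def case_prod_beta)
  ultimately show ?case by (simp only: fst_conv snd_conv)
qed

text \<open>Product and finite sum are the same function of x, and on the sum D multiplies the n-th
  term by n. Equality has to be known on an open set before it can be differentiated, so each stage
  is stated for every nonzero x.\<close>

lemma jet_sum:
  assumes "q \<noteq> 0" "x \<noteq> 0"
  defines "S \<equiv> \<lambda>k N x. \<Sum>n\<in>{- int N..int N}. of_int n ^ k * (theta_coeff q N n * theta_term q x n)"
  shows "jet0 q x N = S 0 N x" "jet1 q x N = S 1 N x" "jet2 q x N = S 2 N x"
proof -
  have S: "((\<lambda>x. S k N x) has_field_derivative S (Suc k) N x / x) (at x)" if "x \<noteq> 0" for k x
    unfolding S_def theta_term_def using that
    by (auto intro!: derivative_eq_intros sum.cong simp: sum_divide_distrib power_int_diff field_simps)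
  have 0: "jet0 q x N = S 0 N x" if "x \<noteq> 0" for x
    unfolding jet0_eq S_def using finite_triple_product[OF assms(1) that] by simp
  have 1: "jet1 q x N = S 1 N x" if "x \<noteq> 0" for x
  proof -
    have "((\<lambda>x. jet0 q x N) has_field_derivative S 1 N x / x) (at x)"
      using S[OF that, of 0, unfolded One_nat_def[symmetric]]
      by (rule has_field_derivative_transform_within_open[where S = "-{0}" and f = "S 0 N"]) (use that 0 in auto)
    with jet_deriv[OF that] DERIV_unique have "jet1 q x N / x = S 1 N x / x" by blast
    then show ?thesis using that by simp
  qed
  have 2: "jet2 q x N = S 2 N x" if "x \<noteq> 0" for x
  proof -
    have "((\<lambda>x. jet1 q x N) has_field_derivative S 2 N x / x) (at x)"
      using S[OF that, of 1, unfolded Suc_1]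
      by (rule has_field_derivative_transform_within_open[where S = "-{0}" and f = "S 1 N"])
        (use that 1 in auto)
    with jet_deriv[OF that] DERIV_unique have "jet2 q x N / x = S 2 N x / x" by blast
    then show ?thesis using that by simp
  qed
  show "jet0 q x N = S 0 N x" "jet1 q x N = S 1 N x" "jet2 q x N = S 2 N x"
    using 0 1 2 assms by auto
qed

subsection \<open>The Weierstrass relation\<close>

lemma jet_LIMSEQ:
  assumes "norm q < 1" "q \<noteq> 0" "x \<noteq> 0"
  shows "jet0 q x \<longlonglongrightarrow> theta_sum 0 q x / euler_E q"
    "jet1 q x \<longlonglongrightarrow> theta_sum 1 q x / euler_E q"
    "jet2 q x \<longlonglongrightarrow> theta_sum 2 q x / euler_E q"
  using theta_sum_LIMSEQ[OF assms(1,3)] by (simp_all only: jet_sum[OF assms(2,3)])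

text \<open>In multiplicative notation, the terms of the Weierstrass function (up to a constant)
  that belong to the periods \<open>q\<^sup>k\<close> and \<open>q\<^bsup>-(k+1)\<^esup>\<close>.\<close>

definition wp_term :: "complex \<Rightarrow> complex \<Rightarrow> nat \<Rightarrow> complex" where
  "wp_term q x k = x * q ^ k / (1 - x * q ^ k)\<^sup>2 + q / x * q ^ k / (1 - q / x * q ^ k)\<^sup>2"

text \<open>The left side is F^2 D^2 log F, and D^2 log is additive over factors. Each factor 1 - u
  contributes - u / (1 - u)^2, both for u = x q^k, where D u = u, and for u = (q/x) q^k, where D u =
  - u. Avoiding the logarithm makes this an algebraic induction.\<close>

lemma jet_wp:
  assumes "x \<noteq> 0" "\<And>k. x * q ^ k \<noteq> 1" "\<And>k. q / x * q ^ k \<noteq> 1"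
  shows "jet0 q x N * jet2 q x N - (jet1 q x N)\<^sup>2 = - (jet0 q x N)\<^sup>2 * (\<Sum>k<N. wp_term q x k)"
proof (induction N)
  case 0
  then show ?case by simp
next
  case (Suc N)
  define f g h where "f = jet0 q x N" "g = jet1 q x N" "h = jet2 q x N"
  define u w where "u = x * q ^ N" "w = q / x * q ^ N"
  have nz: "1 - u \<noteq> 0" "1 - w \<noteq> 0" using assms(2)[of N] assms(3)[of N] by (auto simp: u_w_def)
  have jet: "jet q x (Suc N) = (f * ((1 - u) * (1 - w)), g * ((1 - u) * (1 - w)) + f * (w - u),
      h * ((1 - u) * (1 - w)) + 2 * g * (w - u) + f * - (w + u))"
    by (simp add: f_g_h_def u_w_def Let_def case_prod_beta mult_ac)
  have "wp_term q x N = u / (1 - u)\<^sup>2 + w / (1 - w)\<^sup>2"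
    by (simp add: wp_term_def u_w_def)
  then have wp: "((1 - u) * (1 - w))\<^sup>2 * wp_term q x N = u * (1 - w)\<^sup>2 + w * (1 - u)\<^sup>2"
    using nz by (simp add: power_mult_distrib divide_simps) algebra
  have "jet0 q x (Suc N) * jet2 q x (Suc N) - (jet1 q x (Suc N))\<^sup>2 =
      ((1 - u) * (1 - w))\<^sup>2 * (f * h - g\<^sup>2) - f\<^sup>2 * (u * (1 - w)\<^sup>2 + w * (1 - u)\<^sup>2)"
    unfolding jet fst_conv snd_conv by algebra
  also have "f * h - g\<^sup>2 = - f\<^sup>2 * (\<Sum>k<N. wp_term q x k)"
    using Suc.IH by (simp add: f_g_h_def)
  also have "((1 - u) * (1 - w))\<^sup>2 * (- f\<^sup>2 * (\<Sum>k<N. wp_term q x k)) - f\<^sup>2 * (u * (1 - w)\<^sup>2 + w * (1 - u)\<^sup>2) =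
      - (f * ((1 - u) * (1 - w)))\<^sup>2 * ((\<Sum>k<N. wp_term q x k) + wp_term q x N)"
    unfolding wp[symmetric] by algebra
  finally show ?case by (simp only: jet fst_conv sum.lessThan_Suc)
qed

lemma theta_sum_nonzero:
  assumes "norm q < 1" "q \<noteq> 0" "x \<noteq> 0" "\<And>k. x * q ^ k \<noteq> 1" "\<And>k. q / x * q ^ k \<noteq> 1"
  shows "theta_sum 0 q x \<noteq> 0"
  using assms by (simp add: triple_product qpoch_eq_0_iff euler_E_nonzero)

text \<open>The limit of \<open>jet_wp\<close>. The quotient is homogeneous of degree 0 in T and its
  derivatives, so the normalising factor \<open>euler_E q\<close> cancels.\<close>

lemma wp_sums:
  assumes "norm q < 1" "q \<noteq> 0" "x \<noteq> 0" "\<And>k. x * q ^ k \<noteq> 1" "\<And>k. q / x * q ^ k \<noteq> 1"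
  shows "wp_term q x sums
    (((theta_sum 1 q x)\<^sup>2 - theta_sum 0 q x * theta_sum 2 q x) / (theta_sum 0 q x)\<^sup>2)"
proof -
  have nz: "jet0 q x N \<noteq> 0" for N
    using assms(4,5) unfolding jet0_eq by auto
  have "(\<Sum>k<N. wp_term q x k) = ((jet1 q x N)\<^sup>2 - jet0 q x N * jet2 q x N) / (jet0 q x N)\<^sup>2" for N
    using jet_wp[OF assms(3-5), of N] nz[of N] by (simp add: field_simps)
  moreover have "(\<lambda>N. ((jet1 q x N)\<^sup>2 - jet0 q x N * jet2 q x N) / (jet0 q x N)\<^sup>2) \<longlonglongrightarrow>
      ((theta_sum 1 q x / euler_E q)\<^sup>2 - theta_sum 0 q x / euler_E q * (theta_sum 2 q x / euler_E q)) /
      (theta_sum 0 q x / euler_E q)\<^sup>2"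
    using theta_sum_nonzero[OF assms] euler_E_nonzero[OF assms(1)]
    by (intro tendsto_intros jet_LIMSEQ assms) auto
  moreover have "((theta_sum 1 q x / euler_E q)\<^sup>2 - theta_sum 0 q x / euler_E q * (theta_sum 2 q x / euler_E q)) /
      (theta_sum 0 q x / euler_E q)\<^sup>2 = ((theta_sum 1 q x)\<^sup>2 - theta_sum 0 q x * theta_sum 2 q x) / (theta_sum 0 q x)\<^sup>2"
    using theta_sum_nonzero[OF assms] euler_E_nonzero[OF assms(1)] by (simp add: field_simps power2_eq_square)
  ultimately show ?thesis by (simp add: sums_def)
qed

lemma theta_sum_0_1:
  assumes "norm q < 1" "q \<noteq> 0"
  shows "theta_sum 0 q 1 = 0"
proof -
  have "qpoch 1 q = 0" unfolding qpoch_eq_0_iff[OF assms(1)] by (rule exI[of _ 0]) simp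
  then show ?thesis using assms by (simp add: triple_product)
qed

text \<open>The factor 1 - x vanishes at x = 1, so only the summand in which it is differentiated
  survives, and D (1 - x) = -1 there.\<close>

lemma jet_1:
  "jet0 q 1 (Suc N) = 0" "jet1 q 1 (Suc N) = - (qfact q N * qfact q (Suc N))"
proof -
  have "jet0 q 1 (Suc N) = 0 \<and> jet1 q 1 (Suc N) = - (qfact q N * qfact q (Suc N))"
  proof (induction N)
    case 0
    then show ?case by (simp add: qfact_def)
  next
    case (Suc N)
    then show ?case
      by (simp add: jet.simps(2)[of q 1 "Suc N"] Let_def case_prod_beta qfact_Suc del: jet.simps)
  qed
  then show "jet0 q 1 (Suc N) = 0" "jet1 q 1 (Suc N) = - (qfact q N * qfact q (Suc N))" by auto
qed

text \<open>Jacobi's identity for E^3: two factors E come from \<open>jet_1\<close>, the third from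
  the normalisation in \<open>jet_LIMSEQ\<close>.\<close>

lemma theta_sum_1_1:
  assumes "norm q < 1" "q \<noteq> 0"
  shows "theta_sum 1 q 1 = - (euler_E q ^ 3)"
proof -
  have "(\<lambda>N. - (qfact q N * qfact q (Suc N))) \<longlonglongrightarrow> - (euler_E q * euler_E q)"
    using qfact_LIMSEQ[OF assms(1)]
    by (intro tendsto_intros) (simp_all add: filterlim_sequentially_Suc)
  moreover have "(\<lambda>N. jet1 q 1 (Suc N)) \<longlonglongrightarrow> theta_sum 1 q 1 / euler_E q"
    using jet_LIMSEQ(2)[OF assms, of 1] by (subst filterlim_sequentially_Suc) auto
  ultimately have "- (euler_E q * euler_E q) = theta_sum 1 q 1 / euler_E q"
    unfolding jet_1 by (rule LIMSEQ_unique)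
  then show ?thesis using euler_E_nonzero[OF assms(1)] by (simp add: field_simps power3_eq_cube)
qed

section \<open>Products of two theta series as determinants\<close>

lemma theta_term_mult: "x \<noteq> 0 \<Longrightarrow> theta_term q x n = x powi n * theta_term q 1 n"
  by (simp add: theta_term_def power_int_mult_distrib[symmetric] flip: mult.assoc)

lemma two_times_triangle: "2 * (n * (n - 1) div 2) = n * (n - 1)" for n :: int
  by simp

text \<open>The change of variables \<open>s = m + n\<close>, \<open>d = m - n\<close> diagonalises the product of two theta
  series; \<open>s\<close> and \<open>d\<close> have the same parity, which produces the two terms.\<close>

lemma theta_bilinear:
  assumes q: "norm q < 1" "q \<noteq> 0" and R: "R \<ge> 1"
    and v: "\<And>n. norm (v n) \<le> R ^ nat \<bar>n\<bar>" and w: "\<And>n. norm (w n) \<le> R ^ nat \<bar>n\<bar>"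
  shows "(\<Sum>\<^sub>\<infinity>(m, n)\<in>UNIV. v (m + n) * w (m - n) * (theta_term q 1 m * theta_term q 1 n)) =
      (\<Sum>\<^sub>\<infinity>a\<in>UNIV. v (2 * a) * q powi (a * a - a)) * (\<Sum>\<^sub>\<infinity>b\<in>UNIV. w (2 * b) * q powi (b * b)) -
      (\<Sum>\<^sub>\<infinity>a\<in>UNIV. v (2 * a + 1) * q powi (a * a)) * (\<Sum>\<^sub>\<infinity>b\<in>UNIV. w (2 * b + 1) * q powi (b * b + b))"
proof -
  have pow: "R ^ nat a \<le> R ^ nat b" if "a \<le> b" for a b
    using that R by (intro power_increasing) auto
  define t where "t = theta_term q 1"
  define F where "F = (\<lambda>(m, n). v (m + n) * w (m - n) * (t m * t n))"
  \<comment> \<open>Both \<bar>m + n\<bar> and \<bar>m - n\<bar> are at most \<bar>m\<bar> +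
    \<bar>n\<bar>, so the two weights together cost at most R^(2 \<bar>m\<bar>) R^(2 \<bar>n\<bar>),
    a bound in which m and n separate.\<close>
  define u where "u n = complex_of_real (R ^ nat (2 * \<bar>n\<bar>)) * t n" for n
  have norm_t: "norm (t n) = norm q ^ nat (n * (n - 1) div 2)" for n
    by (simp add: t_def theta_term_def norm_mult norm_power_int norm_power power_int_nonneg_exp[OF triangle_nonneg])
  have pow2: "R ^ nat (2 * \<bar>n\<bar>) = (R\<^sup>2) ^ nat \<bar>n\<bar>" for n
    by (simp add: nat_mult_distrib flip: power_mult)
  have u: "(\<lambda>n. norm (u n)) summable_on UNIV"
    by (rule theta_abs_summable[where C = 1 and R = "R\<^sup>2" and e = "\<lambda>n. n * (n - 1) div 2", OF q(1)])
      (use R abs_triangle_le in \<open>auto simp: u_def norm_mult norm_t pow2 norm_power\<close>)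
  have single: "(\<lambda>a. norm (f (2 * a + c) * q powi (g a))) summable_on UNIV"
    if f: "\<And>n. norm (f n) \<le> R ^ nat \<bar>n\<bar>" and g: "\<And>a. \<bar>a\<bar> * (\<bar>a\<bar> - 1) \<le> g a" and c: "c \<in> {0, 1}"
    for f :: "int \<Rightarrow> complex" and g and c
  proof (rule theta_abs_summable[OF q(1), of "R\<^sup>2"])
    fix n :: int
    have "0 \<le> \<bar>n\<bar> * (\<bar>n\<bar> - 1)" by (cases "n = 0") auto
    then have g0: "0 \<le> g n" using g[of n] by linarith
    then show "\<bar>n\<bar> * (\<bar>n\<bar> - 1) \<le> 2 * g n" using g[of n] by linarith
    have "norm (f (2 * n + c)) \<le> R ^ nat (2 * \<bar>n\<bar> + 1)"
      using c by (intro order_trans[OF f pow]) auto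
    also have "\<dots> = R * (R\<^sup>2) ^ nat \<bar>n\<bar>" unfolding pow2[symmetric] by (simp add: nat_add_distrib)
    finally have "norm (f (2 * n + c)) * norm q ^ nat (g n) \<le> R * (R\<^sup>2) ^ nat \<bar>n\<bar> * norm q ^ nat (g n)"
      by (intro mult_right_mono) auto
    then show "norm (f (2 * n + c) * q powi g n) \<le> R * ((R\<^sup>2) ^ nat \<bar>n\<bar> * norm q ^ nat (g n))"
      by (simp add: norm_mult norm_power_int norm_power power_int_nonneg_exp[OF g0] mult_ac)
  qed auto
  have g: "\<bar>a\<bar> * (\<bar>a\<bar> - 1) \<le> a * a - a" "\<bar>a\<bar> * (\<bar>a\<bar> - 1) \<le> a * a" "\<bar>a\<bar> * (\<bar>a\<bar> - 1) \<le> a * a + a" for a :: int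
    by (auto simp: abs_if algebra_simps)
  note singles = single[of v "\<lambda>a. a * a - a" 0, OF v g(1)] single[of w "\<lambda>a. a * a" 0, OF w g(2)]
    single[of v "\<lambda>a. a * a" 1, OF v g(2)] single[of w "\<lambda>a. a * a + a" 1, OF w g(3)]
  have F_le: "norm (F (m, n)) \<le> norm (u m * u n)" for m n
  proof -
    have "norm (v (m + n)) * norm (w (m - n)) \<le> R ^ nat (\<bar>m\<bar> + \<bar>n\<bar>) * R ^ nat (\<bar>m\<bar> + \<bar>n\<bar>)"
      using R by (intro mult_mono order_trans[OF v pow] order_trans[OF w pow]) auto
    also have "\<dots> = R ^ nat (2 * \<bar>m\<bar>) * R ^ nat (2 * \<bar>n\<bar>)"
    proof -
      have "nat (\<bar>m\<bar> + \<bar>n\<bar>) + nat (\<bar>m\<bar> + \<bar>n\<bar>) = nat (2 * \<bar>m\<bar>) + nat (2 * \<bar>n\<bar>)" by linarith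
      then show ?thesis by (simp only: power_add[symmetric])
    qed
    finally have "norm (v (m + n)) * norm (w (m - n)) * (norm (t m) * norm (t n)) \<le>
        R ^ nat (2 * \<bar>m\<bar>) * R ^ nat (2 * \<bar>n\<bar>) * (norm (t m) * norm (t n))"
      by (intro mult_right_mono) auto
    then show ?thesis using R by (simp add: F_def u_def norm_mult norm_power mult_ac)
  qed
  have F: "(\<lambda>p. norm (F p)) summable_on UNIV"
    by (rule Infinite_Sum.abs_summable_on_comparison_test'[OF infsum_mult(1)[OF u u]]) (use F_le in auto)
  have F_sum: "F summable_on A" for A
    using abs_summable_summable[OF F] summable_on_subset_banach by blast
  define e where "e = (\<lambda>(a::int, b::int). (a + b, a - b))"
  define od where "od = (\<lambda>(a::int, b::int). (a + b + 1, a - b))"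
  have inj: "inj e" "inj od" by (auto simp: inj_def e_def od_def)
  have disj: "range e \<inter> range od = {}" by (auto simp: e_def od_def) presburger
  have un: "range e \<union> range od = UNIV"
  proof (intro equalityI subsetI)
    fix p :: "int \<times> int"
    obtain m n where p: "p = (m, n)" by (cases p)
    show "p \<in> range e \<union> range od"
    proof (cases "even (m + n)")
      case True
      then obtain k where "m + n = 2 * k" by (elim evenE)
      then have "p = e (k, k - n)" unfolding p e_def by auto
      then show ?thesis by blast
    next
      case False
      then obtain k where "m + n = 2 * k + 1" by (elim oddE)
      then have "p = od (k, k - n)" unfolding p od_def by auto
      then show ?thesis by blast
    qed
  qed auto
  have tt: "t m * t n = ((-1) powi m * (-1) powi n) * (q powi (m * (m - 1) div 2) * q powi (n * (n - 1) div 2))" for m n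
    by (simp only: t_def theta_term_def mult_ac)
  \<comment> \<open>For m = a + b + c and n = a - b the cross terms of the triangular exponents
    cancel. The total sign (-1)^(2a+c) is 1 for c = 0 and -1 for c = 1, whence the difference in the
    conclusion.\<close>
  have Fe: "F (e (a, b)) = (v (2 * a) * q powi (a * a - a)) * (w (2 * b) * q powi (b * b))" for a b
  proof -
    have "(a + b) * (a + b - 1) div 2 + (a - b) * (a - b - 1) div 2 = (a * a - a) + b * b"
      using two_times_triangle[of "a + b"] two_times_triangle[of "a - b"] by (simp add: algebra_simps)
    then have "q powi ((a + b) * (a + b - 1) div 2) * q powi ((a - b) * (a - b - 1) div 2) =
        q powi (a * a - a) * q powi (b * b)" using q by (simp flip: power_int_add)
    moreover have "(-1 :: complex) powi (a + b) * (-1) powi (a - b) = 1"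
      by (simp add: power_int_add[symmetric] power_int_mult)
    ultimately have "t (a + b) * t (a - b) = q powi (a * a - a) * q powi (b * b)"
      by (simp only: tt mult_1_left)
    moreover have "F (e (a, b)) = v (2 * a) * w (2 * b) * (t (a + b) * t (a - b))"
      by (simp add: F_def e_def algebra_simps)
    ultimately show ?thesis by (simp only: mult_ac)
  qed
  have Fo: "F (od (a, b)) = - ((v (2 * a + 1) * q powi (a * a)) * (w (2 * b + 1) * q powi (b * b + b)))" for a b
  proof -
    have "(a + b + 1) * (a + b + 1 - 1) div 2 + (a - b) * (a - b - 1) div 2 = a * a + (b * b + b)"
      using two_times_triangle[of "a + b + 1"] two_times_triangle[of "a - b"] by (simp add: algebra_simps)
    then have "q powi ((a + b + 1) * (a + b + 1 - 1) div 2) * q powi ((a - b) * (a - b - 1) div 2) =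
        q powi (a * a) * q powi (b * b + b)" using q by (simp flip: power_int_add)
    moreover have "(-1 :: complex) powi (a + b + 1) * (-1) powi (a - b) = -1"
      by (simp add: power_int_add[symmetric] power_int_mult)
    ultimately have "t (a + b + 1) * t (a - b) = - (q powi (a * a) * q powi (b * b + b))"
      by (simp only: tt mult_minus1)
    moreover have "F (od (a, b)) = v (2 * a + 1) * w (2 * b + 1) * (t (a + b + 1) * t (a - b))"
      by (simp add: F_def od_def algebra_simps)
    ultimately show ?thesis by (simp only: mult_minus_right mult_ac)
  qed
  have "infsum F (range e \<union> range od) = infsum F (range e) + infsum F (range od)"
    by (rule infsum_Un_disjoint[OF F_sum F_sum disj])
  then have "infsum F UNIV = infsum F (range e) + infsum F (range od)"
    unfolding un .
  also have "infsum F (range e) = (\<Sum>\<^sub>\<infinity>(a,b)\<in>UNIV. (v (2 * a) * q powi (a * a - a)) * (w (2 * b) * q powi (b * b)))"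
    unfolding infsum_reindex[OF inj(1)] by (rule infsum_cong) (auto simp: Fe)
  also have "\<dots> = (\<Sum>\<^sub>\<infinity>a\<in>UNIV. v (2 * a) * q powi (a * a - a)) * (\<Sum>\<^sub>\<infinity>b\<in>UNIV. w (2 * b) * q powi (b * b))"
    using infsum_mult(2)[OF singles(1,2)] by simp
  also have "infsum F (range od) = - (\<Sum>\<^sub>\<infinity>(a,b)\<in>UNIV. (v (2 * a + 1) * q powi (a * a)) * (w (2 * b + 1) * q powi (b * b + b)))"
    unfolding infsum_reindex[OF inj(2)] infsum_uminus[symmetric] by (rule infsum_cong) (auto simp: Fo)
  also have "(\<Sum>\<^sub>\<infinity>(a,b)\<in>UNIV. (v (2 * a + 1) * q powi (a * a)) * (w (2 * b + 1) * q powi (b * b + b))) =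
      (\<Sum>\<^sub>\<infinity>a\<in>UNIV. v (2 * a + 1) * q powi (a * a)) * (\<Sum>\<^sub>\<infinity>b\<in>UNIV. w (2 * b + 1) * q powi (b * b + b))"
    using infsum_mult(2)[OF singles(3,4)] by simp
  finally show ?thesis unfolding F_def t_def by simp
qed

text \<open>The sum of y^n q^(n^2/4) over even n; \<open>theta_odd\<close> is its counterpart for
  odd n, with q^(1/4) removed to keep the exponents integral. \<open>theta_even2\<close> and
  \<open>theta_odd2\<close> belong to the second derivatives D^2 at y = 1.\<close>

definition theta_even :: "complex \<Rightarrow> complex \<Rightarrow> complex" where
  "theta_even q y = (\<Sum>\<^sub>\<infinity>b\<in>UNIV. y powi (2 * b) * q powi (b * b))"

definition theta_odd :: "complex \<Rightarrow> complex \<Rightarrow> complex" where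
  "theta_odd q y = (\<Sum>\<^sub>\<infinity>b\<in>UNIV. y powi (2 * b + 1) * q powi (b * b + b))"

definition theta_even2 :: "complex \<Rightarrow> complex" where
  "theta_even2 q = (\<Sum>\<^sub>\<infinity>b\<in>UNIV. of_int (2 * b) ^ 2 * q powi (b * b))"

definition theta_odd2 :: "complex \<Rightarrow> complex" where
  "theta_odd2 q = (\<Sum>\<^sub>\<infinity>b\<in>UNIV. of_int (2 * b + 1) ^ 2 * q powi (b * b + b))"

lemma infsum_int_shift: "(\<Sum>\<^sub>\<infinity>a\<in>UNIV. f (a + c)) = (\<Sum>\<^sub>\<infinity>a\<in>UNIV. f a)"
  for f :: "int \<Rightarrow> complex" and c :: int
proof (rule infsum_reindex_bij_betw)
  show "bij (\<lambda>a. a + c)"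
    by (rule bij_betw_byWitness[where f' = "\<lambda>a. a - c"]) auto
qed

lemma infsum_int_shift_minus_one:
  fixes f :: "int \<Rightarrow> complex"
  shows "(\<Sum>\<^sub>\<infinity>a\<in>UNIV. f (2 * a) * q powi (a * a - a)) =
    (\<Sum>\<^sub>\<infinity>a\<in>UNIV. f (2 * a + 2) * q powi (a * a + a))"
  using infsum_int_shift[of "\<lambda>a. f (2 * a) * q powi (a * a - a)" 1]
  by (simp add: algebra_simps)

text \<open>In \<open>theta_bilinear\<close> the coordinate m + n carries the exponents a^2 - a and
  a^2, so the parities trade places. A shift of a in the first sum and a factor x in both restore
  the standard series.\<close>

lemma theta_even_odd_sums:
  assumes "x \<noteq> 0"
  shows "(\<Sum>\<^sub>\<infinity>a\<in>UNIV. x powi (2 * a) * q powi (a * a - a)) = x * theta_odd q x"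
    "(\<Sum>\<^sub>\<infinity>a\<in>UNIV. x powi (2 * a + 1) * q powi (a * a)) = x * theta_even q x"
proof -
  have "x powi (2 * a + 2) = x * x powi (2 * a + 1)" for a
    using assms by (simp add: power_int_add power2_eq_square mult_ac)
  then show "(\<Sum>\<^sub>\<infinity>a\<in>UNIV. x powi (2 * a) * q powi (a * a - a)) = x * theta_odd q x"
    unfolding infsum_int_shift_minus_one theta_odd_def infsum_cmult_right'[symmetric]
    by (simp add: mult.assoc)
  have "x powi (2 * a + 1) = x * x powi (2 * a)" for a
    using assms by (simp add: power_int_add mult_ac)
  then show "(\<Sum>\<^sub>\<infinity>a\<in>UNIV. x powi (2 * a + 1) * q powi (a * a)) = x * theta_even q x"
    unfolding theta_even_def infsum_cmult_right'[symmetric] by (simp add: mult.assoc)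
qed

lemma theta_pair_has_sum:
  assumes "norm q < 1" "x \<noteq> 0" "y \<noteq> 0"
  shows "((\<lambda>(m, n). (of_int m ^ k * theta_term q x m) * (of_int n ^ l * theta_term q y n)) has_sum
    theta_sum k q x * theta_sum l q y) UNIV"
proof -
  note * = theta_weighted_summable[OF assms(1,2), of k] theta_weighted_summable[OF assms(1,3), of l]
  show ?thesis
    using has_sum_infsum[OF abs_summable_summable[OF infsum_mult(1)[OF *]]]
    unfolding infsum_mult(2)[OF *] theta_sum_def .
qed

lemma norm_powi_le':
  fixes x :: complex
  assumes "x \<noteq> 0" "max (norm x) (inverse (norm x)) \<le> R"
  shows "norm (x powi n) \<le> R ^ nat \<bar>n\<bar>"
proof -
  have "max (norm x) (inverse (norm x)) ^ nat \<bar>n\<bar> \<le> R ^ nat \<bar>n\<bar>"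
    using assms by (intro power_mono) (auto simp: le_max_iff_disj)
  then show ?thesis using norm_powi_le[OF assms(1), of n] by linarith
qed

lemma max_inverse_ge_1: "x \<noteq> 0 \<Longrightarrow> max (norm x) (inverse (norm x)) \<ge> 1" for x :: complex
  by (cases "norm x \<ge> 1") (auto simp: le_max_iff_disj one_le_inverse_iff)

text \<open>Since (xy)^m (x/y)^n = x^(m+n) y^(m-n), each variable sees only one of the two diagonal
  coordinates.\<close>

lemma theta_addition:
  assumes "norm q < 1" "q \<noteq> 0" "x \<noteq> 0" "y \<noteq> 0"
  shows "theta_sum 0 q (x * y) * theta_sum 0 q (x / y) =
    x * (theta_odd q x * theta_even q y - theta_even q x * theta_odd q y)"
proof -
  define R where "R = max (max (norm x) (inverse (norm x))) (max (norm y) (inverse (norm y)))"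
  have R: "R \<ge> 1" "max (norm x) (inverse (norm x)) \<le> R" "max (norm y) (inverse (norm y)) \<le> R"
    using max_inverse_ge_1[OF assms(3)] by (auto simp: R_def)
  have "theta_term q (x * y) m * theta_term q (x / y) n =
      x powi (m + n) * y powi (m - n) * (theta_term q 1 m * theta_term q 1 n)" for m n
    using assms theta_term_mult[of "x * y" q m] theta_term_mult[of "x / y" q n]
    by (simp add: power_int_mult_distrib power_int_divide_distrib power_int_add power_int_diff field_simps)
  then have "theta_sum 0 q (x * y) * theta_sum 0 q (x / y) =
      (\<Sum>\<^sub>\<infinity>(m, n)\<in>UNIV. x powi (m + n) * y powi (m - n) * (theta_term q 1 m * theta_term q 1 n))"
    using infsumI[OF theta_pair_has_sum[OF assms(1), of "x * y" "x / y" 0 0]] assms by simp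
  also have "\<dots> = x * theta_odd q x * theta_even q y - x * theta_even q x * theta_odd q y"
    unfolding theta_bilinear[OF assms(1,2) R(1) norm_powi_le'[OF assms(3) R(2)] norm_powi_le'[OF assms(4) R(3)]]
    by (simp only: theta_even_odd_sums[OF assms(3)] theta_even_def[symmetric] theta_odd_def[symmetric])
  finally show ?thesis by (simp add: algebra_simps)
qed

lemma Suc_abs_le_power: "\<bar>real_of_int n\<bar> + 1 \<le> 2 ^ nat \<bar>n\<bar>"
proof -
  have "real m + 1 \<le> 2 ^ m" for m :: nat
    using less_exp[of m] by (metis Suc_leI of_nat_Suc of_nat_le_iff of_nat_numeral of_nat_power add.commute)
  from this[of "nat \<bar>n\<bar>"] show ?thesis by simp
qed

text \<open>At equal arguments the weight (m - n)^2 = m^2 - 2 m n + n^2 produces 2 (T D^2 T - (D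
  T)^2), and it involves the second diagonal coordinate only.\<close>

lemma theta_wronskian:
  assumes "norm q < 1" "q \<noteq> 0" "x \<noteq> 0"
  shows "2 * (theta_sum 0 q x * theta_sum 2 q x - (theta_sum 1 q x)\<^sup>2) =
    x * (theta_odd q x * theta_even2 q - theta_even q x * theta_odd2 q)"
proof -
  define R where "R = max 4 (max (norm x) (inverse (norm x)))"
  have R: "R \<ge> 1" "max (norm x) (inverse (norm x)) \<le> R" "R \<ge> 4" by (auto simp: R_def)
  have w: "norm ((of_int n :: complex)\<^sup>2) \<le> R ^ nat \<bar>n\<bar>" for n
  proof -
    have "norm ((of_int n :: complex)\<^sup>2) \<le> 4 ^ nat \<bar>n\<bar>"
      using weight_le[of n 2] by (simp add: norm_power)
    also have "\<dots> \<le> R ^ nat \<bar>n\<bar>" using R by (intro power_mono) auto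
    finally show ?thesis .
  qed
  have "((\<lambda>p. (case p of (m, n) \<Rightarrow> (of_int m ^ 2 * theta_term q x m) * (of_int n ^ 0 * theta_term q x n)) +
      -2 * (case p of (m, n) \<Rightarrow> (of_int m ^ 1 * theta_term q x m) * (of_int n ^ 1 * theta_term q x n)) +
      (case p of (m, n) \<Rightarrow> (of_int m ^ 0 * theta_term q x m) * (of_int n ^ 2 * theta_term q x n))) has_sum
      (theta_sum 2 q x * theta_sum 0 q x + -2 * (theta_sum 1 q x * theta_sum 1 q x) +
       theta_sum 0 q x * theta_sum 2 q x)) UNIV"
    by (intro has_sum_add has_sum_cmult_right theta_pair_has_sum assms)
  also have "(\<lambda>p. (case p of (m, n) \<Rightarrow> (of_int m ^ 2 * theta_term q x m) * (of_int n ^ 0 * theta_term q x n)) +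
      -2 * (case p of (m, n) \<Rightarrow> (of_int m ^ 1 * theta_term q x m) * (of_int n ^ 1 * theta_term q x n)) +
      (case p of (m, n) \<Rightarrow> (of_int m ^ 0 * theta_term q x m) * (of_int n ^ 2 * theta_term q x n))) =
    (\<lambda>(m, n). x powi (m + n) * (of_int (m - n))\<^sup>2 * (theta_term q 1 m * theta_term q 1 n))"
    using assms by (auto simp: theta_term_mult[of x] power_int_add power2_eq_square algebra_simps fun_eq_iff)
  finally have "theta_sum 2 q x * theta_sum 0 q x + -2 * (theta_sum 1 q x * theta_sum 1 q x) +
       theta_sum 0 q x * theta_sum 2 q x = 
     (\<Sum>\<^sub>\<infinity>(m, n)\<in>UNIV. x powi (m + n) * (of_int (m - n))\<^sup>2 * (theta_term q 1 m * theta_term q 1 n))"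
    by (rule infsumI[symmetric])
  also have "\<dots> = x * theta_odd q x * theta_even2 q - x * theta_even q x * theta_odd2 q"
    using theta_bilinear[OF assms(1,2) R(1) norm_powi_le'[OF assms(3) R(2)], of "\<lambda>n. (of_int n)\<^sup>2", OF w]
    by (simp only: theta_even_odd_sums[OF assms(3)] theta_even2_def[symmetric] theta_odd2_def[symmetric])
  finally show ?thesis by (simp add: algebra_simps power2_eq_square)
qed

text \<open>The weight \<open>(m + n - 1)\<^sup>2\<close> at \<open>x = y = 1\<close> produces \<open>2 (D T)\<^sup>2\<close>, as \<open>T(1) = 0\<close>.\<close>

lemma theta_null_wronskian:
  assumes "norm q < 1" "q \<noteq> 0"
  shows "theta_odd2 q * theta_even q 1 - theta_even2 q * theta_odd q 1 = 2 * euler_E q ^ 6"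
proof -
  define T where "T k = theta_sum k q 1" for k
  define t where "t = theta_term q 1"
  define f where "f k l = (\<lambda>(m, n). (of_int m ^ k * t m) * (of_int n ^ l * t n))" for k l
  have f: "(f k l has_sum T k * T l) UNIV" for k l
    unfolding f_def T_def t_def using assms by (intro theta_pair_has_sum) auto
  \<comment> \<open>The shift by 1 adds only summands with a factor \<open>T 0\<close>, which is 0.
    It makes the weights (2a - 1)^2 and (2a)^2, so that the sums over a become
    \<open>theta_odd2\<close>, after moving a by one, and \<open>theta_even2\<close>.\<close>
  have "((\<lambda>p. f 2 0 p + f 0 2 p + 2 * f 1 1 p + -2 * f 1 0 p + -2 * f 0 1 p + f 0 0 p) has_sum
      (T 2 * T 0 + T 0 * T 2 + 2 * (T 1 * T 1) + -2 * (T 1 * T 0) + -2 * (T 0 * T 1) + T 0 * T 0)) UNIV"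
    by (intro has_sum_add has_sum_cmult_right f)
  also have "(\<lambda>p. f 2 0 p + f 0 2 p + 2 * f 1 1 p + -2 * f 1 0 p + -2 * f 0 1 p + f 0 0 p) =
      (\<lambda>(m, n). (of_int (m + n - 1))\<^sup>2 * 1 * (t m * t n))"
    by (auto simp: f_def power2_eq_square algebra_simps fun_eq_iff)
  also have "T 2 * T 0 + T 0 * T 2 + 2 * (T 1 * T 1) + -2 * (T 1 * T 0) + -2 * (T 0 * T 1) + T 0 * T 0 =
      2 * euler_E q ^ 6"
    using theta_sum_0_1[OF assms] theta_sum_1_1[OF assms] by (simp add: T_def flip: power_add)
  finally have "2 * euler_E q ^ 6 = (\<Sum>\<^sub>\<infinity>(m, n)\<in>UNIV. (of_int (m + n - 1))\<^sup>2 * 1 * (t m * t n))"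
    by (rule infsumI[symmetric])
  also have "\<dots> = (\<Sum>\<^sub>\<infinity>a\<in>UNIV. (of_int (2 * a - 1))\<^sup>2 * q powi (a * a - a)) * (\<Sum>\<^sub>\<infinity>b\<in>UNIV. 1 * q powi (b * b)) -
      (\<Sum>\<^sub>\<infinity>a\<in>UNIV. (of_int (2 * a + 1 - 1))\<^sup>2 * q powi (a * a)) * (\<Sum>\<^sub>\<infinity>b\<in>UNIV. 1 * q powi (b * b + b))"
    unfolding t_def
  proof (rule theta_bilinear[OF assms, where R = 4 and v = "\<lambda>s. (of_int (s - 1))\<^sup>2" and w = "\<lambda>_. 1"])
    fix n :: int
    have "norm (of_int (n - 1) :: complex) \<le> \<bar>real_of_int n\<bar> + 1"
      unfolding norm_of_int by simp
    then have "norm (of_int (n - 1) :: complex) \<le> 2 ^ nat \<bar>n\<bar>" using Suc_abs_le_power[of n] by linarith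
    then have "norm (of_int (n - 1) :: complex) ^ 2 \<le> (2 ^ nat \<bar>n\<bar>)\<^sup>2" by (intro power_mono) auto
    also have "\<dots> = (2\<^sup>2) ^ nat \<bar>n\<bar>" by (simp only: power_mult[symmetric] mult.commute)
    finally show "norm ((of_int (n - 1) :: complex)\<^sup>2) \<le> 4 ^ nat \<bar>n\<bar>" by (simp add: norm_power)
  qed auto
  also have "(\<Sum>\<^sub>\<infinity>a\<in>UNIV. (of_int (2 * a - 1))\<^sup>2 * q powi (a * a - a)) = theta_odd2 q"
    unfolding theta_odd2_def infsum_int_shift_minus_one[of "\<lambda>n. (of_int (n - 1))\<^sup>2"] by (simp add: algebra_simps)
  also have "(\<Sum>\<^sub>\<infinity>a\<in>UNIV. (of_int (2 * a + 1 - 1))\<^sup>2 * q powi (a * a)) = theta_even2 q"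
    unfolding theta_even2_def by simp
  finally show ?thesis by (simp add: theta_even_def theta_odd_def)
qed

definition wp :: "complex \<Rightarrow> complex \<Rightarrow> complex" where
  "wp q x = (\<Sum>k. wp_term q x k)"

text \<open>Let [u, v] be the determinant of two vectors (\<open>theta_even\<close>,
  \<open>theta_odd\<close>), where 0 marks the value at 1 and 2 the second derivative at 1. Up to
  explicit factors T(x)^2 is [x, 0], \<wp>(x) T(x)^2 is [x, 2], T(xy) T(x/y) is [x, y], and [2, 0]
  is E^6. The claim is the Pluecker relation [x, 2] [y, 0] - [y, 2] [x, 0] = [x, y] [2, 0].\<close>

theorem wp_difference:
  assumes "norm q < 1" "q \<noteq> 0"
    and x: "x \<noteq> 0" "\<And>k. x * q ^ k \<noteq> 1" "\<And>k. q / x * q ^ k \<noteq> 1"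
    and y: "y \<noteq> 0" "\<And>k. y * q ^ k \<noteq> 1" "\<And>k. q / y * q ^ k \<noteq> 1"
  shows "(wp q x - wp q y) * (theta_sum 0 q x * theta_sum 0 q y)\<^sup>2 =
    - (euler_E q ^ 6 * y * (theta_sum 0 q (x * y) * theta_sum 0 q (x / y)))"
proof -
  define b0 d0 b2 d2 where "b0 = theta_even q 1" "d0 = theta_odd q 1" "b2 = theta_even2 q" "d2 = theta_odd2 q"
  have sq: "(theta_sum 0 q z)\<^sup>2 = z * (theta_odd q z * b0 - theta_even q z * d0)" if "z \<noteq> 0" for z
    using theta_addition[OF assms(1,2) that, of 1] by (simp add: b0_d0_b2_d2_def power2_eq_square)
  have wp: "2 * (wp q z * (theta_sum 0 q z)\<^sup>2) = - (z * (theta_odd q z * b2 - theta_even q z * d2))"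
    if z: "z \<noteq> 0" "\<And>k. z * q ^ k \<noteq> 1" "\<And>k. q / z * q ^ k \<noteq> 1" for z
  proof -
    have "wp q z = ((theta_sum 1 q z)\<^sup>2 - theta_sum 0 q z * theta_sum 2 q z) / (theta_sum 0 q z)\<^sup>2"
      unfolding wp_def using wp_sums[OF assms(1,2) z] by (rule sums_unique[symmetric])
    then have "wp q z * (theta_sum 0 q z)\<^sup>2 = (theta_sum 1 q z)\<^sup>2 - theta_sum 0 q z * theta_sum 2 q z"
      using theta_sum_nonzero[OF assms(1,2) z] by simp
    then show ?thesis using theta_wronskian[OF assms(1,2) z(1)] unfolding b0_d0_b2_d2_def by algebra
  qed
  have K: "d2 * b0 - b2 * d0 = 2 * euler_E q ^ 6"
    using theta_null_wronskian[OF assms(1,2)] by (simp add: b0_d0_b2_d2_def)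
  have "2 * ((wp q x - wp q y) * (theta_sum 0 q x * theta_sum 0 q y)\<^sup>2) =
      2 * (wp q x * (theta_sum 0 q x)\<^sup>2) * (theta_sum 0 q y)\<^sup>2 -
      2 * (wp q y * (theta_sum 0 q y)\<^sup>2) * (theta_sum 0 q x)\<^sup>2"
    by algebra
  also have "\<dots> = - ((d2 * b0 - b2 * d0) * y * (x * (theta_odd q x * theta_even q y - theta_even q x * theta_odd q y)))"
    unfolding wp[OF x] wp[OF y] unfolding sq[OF x(1)] sq[OF y(1)] by algebra
  also have "\<dots> = - (2 * euler_E q ^ 6 * y * (theta_sum 0 q (x * y) * theta_sum 0 q (x / y)))"
    unfolding K theta_addition[OF assms(1,2) x(1) y(1)] ..
  finally show ?thesis by (simp add: mult.assoc)
qed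

subsection \<open>Theta function identities of level 10\<close>

text \<open>A negative argument cancels the alternating sign of T, which leaves the pure powers of p
  needed for \<phi> and \<psi>.\<close>

lemma theta_term_powi:
  assumes "p \<noteq> 0"
  shows "theta_term (p ^ k) (- (p ^ j)) n = p powi (int j * n + int k * (n * (n - 1) div 2))"
  using assms by (simp add: theta_term_def power_int_power power_int_add)

lemma theta_sum_powi:
  assumes "p \<noteq> 0"
  shows "theta_sum 0 (p ^ k) (- (p ^ j)) = (\<Sum>\<^sub>\<infinity>n\<in>UNIV. p powi (int j * n + int k * (n * (n - 1) div 2)))"
  unfolding theta_sum_def using theta_term_powi[OF assms] by simp

text \<open>The product form shows the symmetry between j and k - j, by which series from different
  lattice classes are identified.\<close>

lemma triple_product_powi:
  assumes "norm p < 1" "p \<noteq> 0" "0 < k" "j \<le> k"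
  shows "theta_sum 0 (p ^ k) (- (p ^ j)) = euler_E (p ^ k) * qpoch (- (p ^ j)) (p ^ k) * qpoch (- (p ^ (k - j))) (p ^ k)"
  using triple_product[OF norm_power_less_1[OF assms(1,3)], of "- (p ^ j)"] assms
  by (simp add: power_diff)

lemma theta_pair_infsum:
  assumes "norm p < 1" "p \<noteq> 0" "0 < k"
  shows "(\<lambda>(m, n). theta_term (p ^ k) (- (p ^ i)) m * theta_term (p ^ k) (- (p ^ j)) n) summable_on UNIV"
    "(\<Sum>\<^sub>\<infinity>(m, n)\<in>UNIV. theta_term (p ^ k) (- (p ^ i)) m * theta_term (p ^ k) (- (p ^ j)) n) =
      theta_sum 0 (p ^ k) (- (p ^ i)) * theta_sum 0 (p ^ k) (- (p ^ j))"
proof -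
  have "((\<lambda>(m, n). theta_term (p ^ k) (- (p ^ i)) m * theta_term (p ^ k) (- (p ^ j)) n) has_sum
    theta_sum 0 (p ^ k) (- (p ^ i)) * theta_sum 0 (p ^ k) (- (p ^ j))) UNIV"
    using theta_pair_has_sum[OF norm_power_less_1[OF assms(1,3)], of "- (p ^ i)" "- (p ^ j)" 0 0] assms by simp
  then show "(\<lambda>(m, n). theta_term (p ^ k) (- (p ^ i)) m * theta_term (p ^ k) (- (p ^ j)) n) summable_on UNIV"
    "(\<Sum>\<^sub>\<infinity>(m, n)\<in>UNIV. theta_term (p ^ k) (- (p ^ i)) m * theta_term (p ^ k) (- (p ^ j)) n) =
      theta_sum 0 (p ^ k) (- (p ^ i)) * theta_sum 0 (p ^ k) (- (p ^ j))"
    by (auto intro: has_sum_imp_summable infsumI)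
qed

text \<open>The sublattice \<open>{(2a + b, a - 2b)}\<close> of index 5 (multiplication by \<open>2 + i\<close> up to a
  reflection) scales \<open>m\<^sup>2 + n\<^sup>2\<close> by 5.\<close>

lemma infsum_index_5_sublattice:
  fixes f :: "int \<times> int \<Rightarrow> complex" and k l :: "int \<Rightarrow> int"
  assumes f: "f summable_on UNIV" and kl: "\<And>c. c \<in> {0..<5} \<Longrightarrow> (2 * k c + l c) mod 5 = c"
  shows "infsum f UNIV = (\<Sum>c\<in>{0..<5}. \<Sum>\<^sub>\<infinity>(a, b)\<in>UNIV. f (2 * a + b + k c, a - 2 * b + l c))"
proof -
  \<comment> \<open>On the sublattice 2m + n takes the value 5a, so its residue modulo 5 names the
    class. The representative (k c, l c) of class c stays free, to be chosen so that the shifted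
    sums are theta series in the wanted form.\<close>
  define g where "g = (\<lambda>(c, a, b). (2 * a + b + k c, a - 2 * b + l c))"
  have cls: "(2 * m + n) mod 5 = c" if "g (c, a, b) = (m, n)" "c \<in> {0..<5}" for c a b m n
  proof -
    have "2 * m + n = (2 * k c + l c) + 5 * a" using that by (auto simp: g_def)
    then show ?thesis using kl[OF that(2)] by simp
  qed
  have bij: "bij_betw g ({0..<5} \<times> UNIV) UNIV"
  proof (rule bij_betwI[where g = "\<lambda>(m, n). (let c = (2 * m + n) mod 5; a = (2 * m + n - 2 * k c - l c) div 5
      in (c, a, m - k c - 2 * a))"])
    show "g \<in> {0..<5} \<times> UNIV \<rightarrow> UNIV" by simp
    show "(\<lambda>(m, n). let c = (2 * m + n) mod 5; a = (2 * m + n - 2 * k c - l c) div 5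
       in (c, a, m - k c - 2 * a)) \<in> UNIV \<rightarrow> {0..<5} \<times> UNIV"
      by (auto simp: Let_def)
    fix x :: "int \<times> int \<times> int" assume x: "x \<in> {0..<5} \<times> UNIV"
    obtain c a b where x_eq: "x = (c, a, b)" by (cases x) auto
    obtain m n where mn: "g x = (m, n)" by (cases "g x") auto
    have c: "(2 * m + n) mod 5 = c" using cls[of c a b m n] x mn x_eq by auto
    have *: "m = 2 * a + b + k c" "n = a - 2 * b + l c" using mn x_eq by (auto simp: g_def)
    have "2 * m + n - 2 * k c - l c = 5 * a" using * by simp
    then have "(2 * m + n - 2 * k c - l c) div 5 = a" by simp
    then show "(case g x of (m, n) \<Rightarrow> let c = (2 * m + n) mod 5; a = (2 * m + n - 2 * k c - l c) div 5
      in (c, a, m - k c - 2 * a)) = x"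
      unfolding mn using c * x_eq by (simp add: Let_def)
  next
    fix y :: "int \<times> int"
    obtain m n where y: "y = (m, n)" by (cases y)
    define c where "c = (2 * m + n) mod 5"
    have "(2 * k c + l c) mod 5 = (2 * m + n) mod 5" using kl[of c] by (simp add: c_def)
    then have "5 dvd (2 * m + n) - (2 * k c + l c)" by (metis mod_eq_dvd_iff)
    then obtain a where a: "2 * m + n - 2 * k c - l c = 5 * a" by (auto simp: dvd_def algebra_simps)
    then have "(2 * m + n - 2 * k c - l c) div 5 = a" by simp
    then show "g (case y of (m, n) \<Rightarrow> let c = (2 * m + n) mod 5; a = (2 * m + n - 2 * k c - l c) div 5
      in (c, a, m - k c - 2 * a)) = y"
      using a unfolding y by (simp add: Let_def g_def flip: c_def)
  qed
  have "infsum f UNIV = infsum (\<lambda>x. f (g x)) ({0..<5} \<times> UNIV)"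
    by (rule infsum_reindex_bij_betw[OF bij, symmetric])
  also have "\<dots> = (\<Sum>\<^sub>\<infinity>c\<in>{0..<5}. \<Sum>\<^sub>\<infinity>ab\<in>UNIV. f (g (c, ab)))"
    by (rule infsum_Sigma_banach[symmetric]) (use summable_on_reindex_bij_betw[OF bij, of f] f in simp)
  also have "\<dots> = (\<Sum>c\<in>{0..<5}. \<Sum>\<^sub>\<infinity>ab\<in>UNIV. f (g (c, ab)))" by simp
  also have "\<dots> = (\<Sum>c\<in>{0..<5}. \<Sum>\<^sub>\<infinity>(a, b)\<in>UNIV. f (2 * a + b + k c, a - 2 * b + l c))"
    by (intro sum.cong refl infsum_cong) (auto simp: g_def)
  finally show ?thesis .
qed

lemma infsum_cmult_pair:
  "(\<Sum>\<^sub>\<infinity>(a, b)\<in>UNIV. c * F a b) = (c :: complex) * (\<Sum>\<^sub>\<infinity>(a, b)\<in>UNIV. F a b)"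
  unfolding infsum_cmult_right'[symmetric] by (rule infsum_cong) auto

lemma upto_5: "{0..<5::int} = {0, 1, 2, 3, 4}" by auto

section \<open>Quadratic relations between the theta functions at q and at q^5\<close>

lemma theta_phi_eq: "p \<noteq> 0 \<Longrightarrow> theta_phi p = theta_sum 0 (p ^ 2) (- (p ^ 1))"
  unfolding theta_phi_def theta_sum_powi by (rule infsum_cong) (simp add: two_times_triangle power2_eq_square algebra_simps)

text \<open>Class 0, the sublattice, returns the square at p^5. The quarter turn (m, n) -> (-n, m)
  multiplies 2m + n by 3 modulo 5 and so permutes the other four classes cyclically: they contribute
  equally, which explains the coefficient 4.\<close>

lemma theta_phi_sq:
  assumes "norm p < 1" "p \<noteq> 0"
  shows "theta_phi p ^ 2 = theta_phi (p ^ 5) ^ 2 +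
    4 * p * (theta_sum 0 (p ^ 10) (- (p ^ 1)) * theta_sum 0 (p ^ 10) (- (p ^ 3)))"
proof -
  define f where "f = (\<lambda>(m, n). theta_term (p ^ 2) (- (p ^ 1)) m * theta_term (p ^ 2) (- (p ^ 1)) n)"
  define J where "J j = theta_sum 0 (p ^ 10) (- (p ^ j))" for j
  \<comment> \<open>the shifts represent the five classes in such a way that all sums are of the form \<open>J\<close>\<close>
  define k :: "int \<Rightarrow> int" where "k c = (if c = 2 then 1 else if c = 3 then -1 else 0)" for c
  define l :: "int \<Rightarrow> int" where "l c = (if c = 1 then 1 else if c = 4 then -1 else 0)" for c
  have f_eq: "f (m, n) = p powi (m * m + n * n)" for m n
  proof -
    have "m + 2 * (m * (m - 1) div 2) = m * m" for m :: int by (simp add: two_times_triangle algebra_simps)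
    then show ?thesis unfolding f_def prod.case theta_term_powi[OF assms(2)]
      using assms by (simp add: power_int_add)
  qed
  have f: "f summable_on UNIV" unfolding f_def using assms by (intro theta_pair_infsum) auto
  have "infsum f UNIV = (\<Sum>c\<in>{0..<5}. \<Sum>\<^sub>\<infinity>(a, b)\<in>UNIV. f (2 * a + b + k c, a - 2 * b + l c))"
    by (rule infsum_index_5_sublattice[OF f]) (auto simp: upto_5 k_def l_def)
  moreover have cls: "(\<Sum>\<^sub>\<infinity>(a, b)\<in>UNIV. f (2 * a + b + k c, a - 2 * b + l c)) = p * (J i * J j)"
    if "\<And>a b. (2 * a + b + k c) * (2 * a + b + k c) + (a - 2 * b + l c) * (a - 2 * b + l c) =
      1 + (int i * a + 5 * (a * a - a)) + (int j * b + 5 * (b * b - b))" for c i j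
  proof -
    have T: "10 * (n * (n - 1) div 2) = 5 * (n * n - n)" for n :: int
    proof -
      have "10 * (n * (n - 1) div 2) = 5 * (2 * (n * (n - 1) div 2))" by simp
      then show ?thesis unfolding two_times_triangle by (simp add: right_diff_distrib)
    qed
    have "f (2 * a + b + k c, a - 2 * b + l c) =
        p * (theta_term (p ^ 10) (- (p ^ i)) a * theta_term (p ^ 10) (- (p ^ j)) b)" for a b
      unfolding f_eq that theta_term_powi[OF assms(2)] using assms T by (simp add: power_int_add)
    then show ?thesis
      using theta_pair_infsum(2)[OF assms, of 10 i j] unfolding J_def
      by (simp add: infsum_cmult_pair)
  qed
  moreover have "(\<Sum>\<^sub>\<infinity>(a, b)\<in>UNIV. f (2 * a + b + k 0, a - 2 * b + l 0)) = theta_phi (p ^ 5) ^ 2"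
  proof -
    have "f (2 * a + b + k 0, a - 2 * b + l 0) =
        theta_term ((p ^ 5) ^ 2) (- ((p ^ 5) ^ 1)) a * theta_term ((p ^ 5) ^ 2) (- ((p ^ 5) ^ 1)) b" for a b
    proof -
      have "m + 2 * (m * (m - 1) div 2) = m * m" for m :: int by (simp add: two_times_triangle algebra_simps)
      moreover have "(2 * a + b + k 0) * (2 * a + b + k 0) + (a - 2 * b + l 0) * (a - 2 * b + l 0) = 5 * (a * a) + 5 * (b * b)"
        by (simp add: k_def l_def algebra_simps)
      ultimately show ?thesis unfolding f_eq using assms
        by (subst (1 2) theta_term_powi) (simp_all add: power_int_add power_int_power)
    qed
    then show ?thesis
      using theta_pair_infsum(2)[of "p ^ 5" 2 1 1] assms norm_power_less_1[of p 5]
      by (simp add: theta_phi_eq power2_eq_square)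
  qed
  moreover have "infsum f UNIV = theta_phi p ^ 2"
    unfolding f_def using theta_pair_infsum(2)[OF assms, of 2 1 1] assms by (simp add: theta_phi_eq power2_eq_square)
  moreover have "J 9 = J 1" "J 7 = J 3"
    unfolding J_def using triple_product_powi[OF assms, of 10 9] triple_product_powi[OF assms, of 10 1]
      triple_product_powi[OF assms, of 10 7] triple_product_powi[OF assms, of 10 3]
    by (simp_all add: mult_ac)
  ultimately show ?thesis
    using cls[of 1 7 1] cls[of 2 9 7] cls[of 3 1 3] cls[of 4 3 9]
    by (simp add: upto_5 k_def l_def algebra_simps J_def)
qed

text \<open>The exponent n(n-1)/2 is invariant under n -> 1 - n, which exchanges the parities; even
  and odd n thus give \<psi> once each.\<close>

lemma theta_psi_eq:
  assumes "norm p < 1" "p \<noteq> 0"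
  shows "2 * theta_psi p = theta_sum 0 (p ^ 1) (- (p ^ 0))"
proof -
  define f where "f n = p powi (n * (n - 1) div 2)" for n :: int
  have f_eq: "f = (\<lambda>n. of_int n ^ 0 * theta_term (p ^ 1) (- (p ^ 0)) n)"
    unfolding theta_term_powi[OF assms(2)] by (simp add: f_def fun_eq_iff)
  have "(\<lambda>n. norm (f n)) summable_on UNIV"
    unfolding f_eq using assms by (intro theta_weighted_summable) auto
  then have f: "f summable_on A" for A
    using abs_summable_summable summable_on_subset_banach by blast
  define e :: "int \<Rightarrow> int" where "e k = 2 * k" for k
  define od :: "int \<Rightarrow> int" where "od k = 1 - 2 * k" for k
  have inj: "inj e" "inj od" by (auto simp: inj_def e_def od_def)
  have disj: "range e \<inter> range od = {}" unfolding e_def od_def by auto presburger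
  have un: "range e \<union> range od = UNIV"
  proof (intro equalityI subsetI)
    fix n :: int
    show "n \<in> range e \<union> range od"
    proof (cases "even n")
      case True
      then obtain k where "n = 2 * k" by (elim evenE)
      then have "n = e k" by (simp add: e_def)
      then show ?thesis by blast
    next
      case False
      then obtain k where "n = 2 * k + 1" by (elim oddE)
      then have "n = od (- k)" by (simp add: od_def)
      then show ?thesis by blast
    qed
  qed auto
  have "e k * (e k - 1) = 2 * (2 * k\<^sup>2 - k)" "od k * (od k - 1) = 2 * (2 * k\<^sup>2 - k)" for k
    by (simp_all add: e_def od_def power2_eq_square algebra_simps)
  then have "f (e k) = p powi (2 * k\<^sup>2 - k)" "f (od k) = p powi (2 * k\<^sup>2 - k)" for k
    by (simp_all add: f_def)
  then have "infsum f (range e) = theta_psi p" "infsum f (range od) = theta_psi p"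
    by (simp_all add: infsum_reindex inj theta_psi_def o_def)
  moreover have "infsum f (range e \<union> range od) = infsum f (range e) + infsum f (range od)"
    by (rule infsum_Un_disjoint[OF f f disj])
  ultimately have "infsum f UNIV = 2 * theta_psi p" unfolding un by simp
  then show ?thesis unfolding theta_sum_def f_eq by simp
qed

text \<open>Summing over all integers counts \<psi> twice, so a factor 4 runs through the proof. The
  reflection (m, n) -> (1 - m, 1 - n) sends class c to 3 - c and fixes only class 4, which yields p
  J(0)^2 = 4 p \<psi>^2(p^5); each other class yields J(1) J(2).\<close>

lemma theta_psi_sq:
  assumes "norm p < 1" "p \<noteq> 0"
  shows "theta_psi p ^ 2 = p * theta_psi (p ^ 5) ^ 2 +
    theta_sum 0 (p ^ 5) (- (p ^ 1)) * theta_sum 0 (p ^ 5) (- (p ^ 2))"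
proof -
  define f where "f = (\<lambda>(m, n). theta_term (p ^ 1) (- (p ^ 0)) m * theta_term (p ^ 1) (- (p ^ 0)) n)"
  define J where "J j = theta_sum 0 (p ^ 5) (- (p ^ j))" for j
  define k :: "int \<Rightarrow> int" where "k c = (if c = 2 \<or> c = 3 then 1 else if c = 4 then -1 else 0)" for c
  define l :: "int \<Rightarrow> int" where "l c = (if c = 1 \<or> c = 3 \<or> c = 4 then 1 else 0)" for c
  have f_eq: "f (m, n) = p powi (m * (m - 1) div 2 + n * (n - 1) div 2)" for m n
    unfolding f_def prod.case theta_term_powi[OF assms(2)] using assms by (simp add: power_int_add)
  have f: "f summable_on UNIV" unfolding f_def using assms by (intro theta_pair_infsum) auto
  have "infsum f UNIV = (\<Sum>c\<in>{0..<5}. \<Sum>\<^sub>\<infinity>(a, b)\<in>UNIV. f (2 * a + b + k c, a - 2 * b + l c))"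
    by (rule infsum_index_5_sublattice[OF f]) (auto simp: upto_5 k_def l_def)
  moreover have cls: "(\<Sum>\<^sub>\<infinity>(a, b)\<in>UNIV. f (2 * a + b + k c, a - 2 * b + l c)) = p ^ e * (J i * J j)"
    if *: "\<And>a b. (2 * a + b + k c) * (2 * a + b + k c - 1) + (a - 2 * b + l c) * (a - 2 * b + l c - 1) =
      2 * int e + (2 * (int i * a) + 5 * (a * (a - 1))) + (2 * (int j * b) + 5 * (b * (b - 1)))" for c e i j
  proof -
    have "(2 * a + b + k c) * (2 * a + b + k c - 1) div 2 + (a - 2 * b + l c) * (a - 2 * b + l c - 1) div 2 =
        int e + (int i * a + 5 * (a * (a - 1) div 2)) + (int j * b + 5 * (b * (b - 1) div 2))" for a b
    proof -
      have "2 * X + 2 * Y = 2 * int e + (2 * (int i * a) + 5 * (2 * A)) + (2 * (int j * b) + 5 * (2 * B)) \<Longrightarrow>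
        X + Y = int e + (int i * a + 5 * A) + (int j * b + 5 * B)" for X Y A B by simp
      then show ?thesis by this (unfold two_times_triangle, rule *)
    qed
    then have "f (2 * a + b + k c, a - 2 * b + l c) =
        p ^ e * (theta_term (p ^ 5) (- (p ^ i)) a * theta_term (p ^ 5) (- (p ^ j)) b)" for a b
      unfolding f_eq theta_term_powi[OF assms(2)] using assms by (simp add: power_int_add)
    then show ?thesis
      using theta_pair_infsum(2)[OF assms, of 5 i j] unfolding J_def
      by (simp add: infsum_cmult_pair)
  qed
  moreover have "infsum f UNIV = (2 * theta_psi p) ^ 2"
    unfolding f_def using theta_pair_infsum(2)[OF assms, of 1 0 0] theta_psi_eq[OF assms] by (simp add: power2_eq_square)
  moreover have "J 0 = 2 * theta_psi (p ^ 5)"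
    using theta_psi_eq[of "p ^ 5"] assms norm_power_less_1[of p 5] by (simp add: J_def)
  moreover have "J 3 = J 2" "J 4 = J 1"
    unfolding J_def using triple_product_powi[OF assms, of 5 1] triple_product_powi[OF assms, of 5 2]
      triple_product_powi[OF assms, of 5 3] triple_product_powi[OF assms, of 5 4]
    by (simp_all add: mult_ac)
  moreover have "(\<Sum>\<^sub>\<infinity>(a, b)\<in>UNIV. f (2 * a + b + k 4, a - 2 * b + l 4)) = p ^ 1 * (J 0 * J 0)"
    by (rule cls) (simp add: k_def l_def algebra_simps)
  moreover have "(\<Sum>\<^sub>\<infinity>(a, b)\<in>UNIV. f (2 * a + b + k 1, a - 2 * b + l 1)) = p ^ 0 * (J 2 * J 1)"
    by (rule cls) (simp add: k_def l_def algebra_simps)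
  moreover have "(\<Sum>\<^sub>\<infinity>(a, b)\<in>UNIV. f (2 * a + b + k 0, a - 2 * b + l 0)) = p ^ 0 * (J 1 * J 3)"
    by (rule cls) (simp add: k_def l_def algebra_simps)
  moreover have "(\<Sum>\<^sub>\<infinity>(a, b)\<in>UNIV. f (2 * a + b + k 2, a - 2 * b + l 2)) = p ^ 0 * (J 3 * J 4)"
    by (rule cls) (simp add: k_def l_def algebra_simps)
  moreover have "(\<Sum>\<^sub>\<infinity>(a, b)\<in>UNIV. f (2 * a + b + k 3, a - 2 * b + l 3)) = p ^ 0 * (J 4 * J 2)"
    by (rule cls) (simp add: k_def l_def algebra_simps)
  ultimately have "4 * theta_psi p ^ 2 = 4 * (p * theta_psi (p ^ 5) ^ 2 + J 1 * J 2)"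
    by (simp add: upto_5 power2_eq_square)
  then show ?thesis by (simp add: J_def del: distrib_left_numeral)
qed

lemma qpoch_odd:
  assumes "norm q < 1"
  shows "qpoch q (q ^ 2) = euler_E q / euler_E (q ^ 2)"
proof -
  have "euler_E q = qpoch q (q ^ 2) * euler_E (q ^ 2)"
    using qpoch_dissect[OF assms, of 2 q] by (simp add: euler_E_qpoch lessThan_Suc numeral_2_eq_2 power2_eq_square)
  then show ?thesis using euler_E_nonzero[of "q ^ 2"] norm_power_less_1[OF assms, of 2] by simp
qed

lemma qpoch_neg:
  assumes "norm q < 1"
  shows "qpoch (-q) q = euler_E (q ^ 2) / euler_E q"
  using qpoch_mult_minus[OF assms, of q] euler_E_nonzero[OF assms]
  by (simp add: euler_E_qpoch field_simps)

lemma theta_phi_minus: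
  assumes "norm q < 1" "q \<noteq> 0"
  shows "theta_phi (-q) = euler_E q ^ 2 / euler_E (q ^ 2)"
proof -
  have "theta_phi (-q) = theta_sum 0 (q ^ 2) (- ((-q) ^ 1))"
    using theta_phi_eq[of "-q"] assms by simp
  also have "\<dots> = euler_E (q ^ 2) * qpoch q (q ^ 2) * qpoch q (q ^ 2)"
    using triple_product_powi[of "-q" 2 1] assms by simp
  finally show ?thesis
    using euler_E_nonzero[of "q ^ 2"] norm_power_less_1[OF assms(1), of 2]
    unfolding qpoch_odd[OF assms(1)] by (simp add: field_simps power2_eq_square[of "euler_E q"])
qed

text \<open>Gauss's product for \<psi>; the first factor 1 - (-1) = 2 of \<open>qpoch (-1) q\<close>
  cancels the double counting in \<open>theta_psi_eq\<close>.\<close>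

lemma theta_psi_product:
  assumes "norm q < 1" "q \<noteq> 0"
  shows "theta_psi q = euler_E (q ^ 2) ^ 2 / euler_E q"
proof -
  have "2 * theta_psi q = euler_E q * qpoch (-1) q * qpoch (-q) q"
    using theta_psi_eq[OF assms] triple_product_powi[OF assms, of 1 0] by simp
  also have "qpoch (-1) q = 2 * qpoch (-q) q" using qpoch_Suc[OF assms(1), of "-1"] by simp
  finally show ?thesis
    using euler_E_nonzero[OF assms(1)] unfolding qpoch_neg[OF assms(1)] by (simp add: field_simps power2_eq_square[of "euler_E (q ^ 2)"])
qed

lemma lessThan_5: "{..<5::nat} = {0, 1, 2, 3, 4}" by auto

lemma euler_E_nonzero_power: "norm q < 1 \<Longrightarrow> 0 < k \<Longrightarrow> euler_E (q ^ k) \<noteq> 0"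
  using euler_E_nonzero norm_power_less_1 by blast

text \<open>The four products in base q^5 are the factors of \<open>qpoch (-q) q\<close> with
  exponent prime to 5; dissection modulo 5 expresses them through E.\<close>

lemma psi_sq_eta:
  assumes "norm q < 1" "q \<noteq> 0"
  shows "theta_psi q ^ 2 - q * theta_psi (q ^ 5) ^ 2 =
    euler_E (q ^ 2) * euler_E (q ^ 5) ^ 3 / (euler_E q * euler_E (q ^ 10))"
proof -
  define A where "A = qpoch (-q) (q ^ 5) * qpoch (- (q ^ 2)) (q ^ 5) * qpoch (- (q ^ 3)) (q ^ 5) * qpoch (- (q ^ 4)) (q ^ 5)"
  have "qpoch (-q) q = A * qpoch (- (q ^ 5)) (q ^ 5)"
    unfolding qpoch_dissect[OF assms(1), of 5 "-q", simplified] lessThan_5 A_def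
    by (simp add: mult_ac power_numeral_reduce)
  then have "euler_E (q ^ 2) / euler_E q = A * (euler_E (q ^ 10) / euler_E (q ^ 5))"
    using qpoch_neg[OF assms(1)] qpoch_neg[of "q ^ 5"] norm_power_less_1[OF assms(1), of 5] by (simp flip: power_mult)
  then have A: "A = euler_E (q ^ 2) * euler_E (q ^ 5) / (euler_E q * euler_E (q ^ 10))"
    using euler_E_nonzero_power[OF assms(1)] euler_E_nonzero[OF assms(1)] by (simp add: field_simps)
  have "theta_sum 0 (q ^ 5) (- (q ^ 1)) * theta_sum 0 (q ^ 5) (- (q ^ 2)) = euler_E (q ^ 5) ^ 2 * A"
    unfolding A_def using triple_product_powi[OF assms, of 5 1] triple_product_powi[OF assms, of 5 2]
    by (simp add: power2_eq_square)
  then show ?thesis unfolding theta_psi_sq[OF assms] A by (simp add: power2_eq_square power3_eq_cube)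
qed

text \<open>Taken at p = -q, where - p^j = q^j for odd j. The products then collect the odd
  exponents prime to 5, that is, \<open>qpoch q (q ^ 2)\<close> without the odd multiples of
  5.\<close>

lemma phi_sq_eta:
  assumes "norm q < 1" "q \<noteq> 0"
  shows "theta_phi (-q) ^ 2 = theta_phi (- (q ^ 5)) ^ 2 -
    4 * q * (euler_E q * euler_E (q ^ 10) ^ 3 / (euler_E (q ^ 2) * euler_E (q ^ 5)))"
proof -
  define A where "A = qpoch q (q ^ 10) * qpoch (q ^ 3) (q ^ 10) * qpoch (q ^ 7) (q ^ 10) * qpoch (q ^ 9) (q ^ 10)"
  have "qpoch q (q ^ 2) = A * qpoch (q ^ 5) ((q ^ 5) ^ 2)"
    using norm_power_less_1[OF assms(1), of 2]
    unfolding qpoch_dissect[of "q ^ 2" 5 q, OF _ zero_less_numeral] lessThan_5 A_def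
    by (subst qpoch_dissect[of "q ^ 2" 5 q]) (simp_all add: lessThan_5 mult_ac power_numeral_reduce flip: power_mult)
  then have "euler_E q / euler_E (q ^ 2) = A * (euler_E (q ^ 5) / euler_E (q ^ 10))"
    using qpoch_odd[OF assms(1)] qpoch_odd[of "q ^ 5"] norm_power_less_1[OF assms(1), of 5] by (simp flip: power_mult)
  then have A: "A = euler_E q * euler_E (q ^ 10) / (euler_E (q ^ 2) * euler_E (q ^ 5))"
    using euler_E_nonzero_power[OF assms(1)] by (simp add: field_simps)
  have "theta_sum 0 ((-q) ^ 10) (- ((-q) ^ 1)) * theta_sum 0 ((-q) ^ 10) (- ((-q) ^ 3)) = euler_E (q ^ 10) ^ 2 * A"
    unfolding A_def using triple_product_powi[of "-q" 10 1] triple_product_powi[of "-q" 10 3] assms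
    by (simp add: power2_eq_square)
  then show ?thesis using theta_phi_sq[of "-q"] assms A by (simp add: power2_eq_square power3_eq_cube)
qed

lemma infsum_powi_quadratic_0:
  assumes "\<And>n::int. e n = (0 :: int) \<longleftrightarrow> n = 0"
  shows "(\<Sum>\<^sub>\<infinity>n\<in>UNIV. (0 :: complex) powi e n) = 1"
proof -
  have "(\<Sum>\<^sub>\<infinity>n\<in>UNIV. (0 :: complex) powi e n) = (\<Sum>\<^sub>\<infinity>n\<in>{0}. (0 :: complex) powi e n)"
    by (rule infsum_cong_neutral) (use assms in \<open>auto simp: power_int_0_left_if\<close>)
  then show ?thesis using assms[of 0] by simp
qed

lemma theta_phi_0: "theta_phi 0 = 1"
  unfolding theta_phi_def by (rule infsum_powi_quadratic_0) simp

lemma theta_psi_0: "theta_psi 0 = 1"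
  unfolding theta_psi_def
proof (rule infsum_powi_quadratic_0)
  fix n :: int
  have "2 * n\<^sup>2 - n = n * (2 * n - 1)" by (simp add: power2_eq_square algebra_simps)
  moreover have "2 * n - 1 \<noteq> 0" by presburger
  ultimately show "2 * n\<^sup>2 - n = 0 \<longleftrightarrow> n = 0" by (simp only: mult_eq_0_iff) simp
qed

lemma euler_E_0: "euler_E 0 = 1"
  by (simp add: euler_E_def)

section \<open>The four theta identities via a Hauptmodul\<close>

text \<open>\<open>eta_P\<close> and \<open>eta_Q\<close> are the two Eisenstein series of weight 2
  and level 5 attached to the Legendre symbol modulo 5.\<close>

definition eta_P :: "complex \<Rightarrow> complex" where
  "eta_P q = euler_E q ^ 5 / euler_E (q ^ 5)"

definition eta_Q :: "complex \<Rightarrow> complex" where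
  "eta_Q q = q * (euler_E (q ^ 5) ^ 5 / euler_E q)"

text \<open>With the Hauptmodul \<open>Y = \<psi>\<^sup>2(q) / (q \<psi>\<^sup>2(q\<^sup>5))\<close> all eta quotients involved are
  rational functions of \<open>Y\<close> times \<open>q\<^sup>2 E\<^sup>5(q\<^sup>1\<^sup>0) / E(q\<^sup>2)\<close>.\<close>

theorem level_10_identities:
  assumes "norm q < 1"
  shows "theta_phi (-q) * theta_phi (- (q ^ 5)) ^ 3 =
      1/5 * (eta_P q + 4 * eta_P (q ^ 2)) - (eta_Q q - 4 * eta_Q (q ^ 2))"
    "theta_phi (-q) ^ 3 * theta_phi (- (q ^ 5)) =
      1/5 * (eta_P q + 4 * eta_P (q ^ 2)) - 5 * (eta_Q q - 4 * eta_Q (q ^ 2))"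
    "4 * q * theta_psi q ^ 3 * theta_psi (q ^ 5) =
      1/5 * (eta_P q - eta_P (q ^ 2)) + 5 * (eta_Q q + eta_Q (q ^ 2))"
    "4 * q ^ 2 * theta_psi q * theta_psi (q ^ 5) ^ 3 =
      1/5 * (eta_P q - eta_P (q ^ 2)) + (eta_Q q + eta_Q (q ^ 2))"
proof -
  have "theta_phi (-q) * theta_phi (- (q ^ 5)) ^ 3 =
      1/5 * (eta_P q + 4 * eta_P (q ^ 2)) - (eta_Q q - 4 * eta_Q (q ^ 2)) \<and>
    theta_phi (-q) ^ 3 * theta_phi (- (q ^ 5)) =
      1/5 * (eta_P q + 4 * eta_P (q ^ 2)) - 5 * (eta_Q q - 4 * eta_Q (q ^ 2)) \<and>
    4 * q * theta_psi q ^ 3 * theta_psi (q ^ 5) =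
      1/5 * (eta_P q - eta_P (q ^ 2)) + 5 * (eta_Q q + eta_Q (q ^ 2)) \<and>
    4 * q ^ 2 * theta_psi q * theta_psi (q ^ 5) ^ 3 =
      1/5 * (eta_P q - eta_P (q ^ 2)) + (eta_Q q + eta_Q (q ^ 2))"
  proof (cases "q = 0")
    case True
    then show ?thesis by (simp add: eta_P_def eta_Q_def theta_phi_0 theta_psi_0 euler_E_0)
  next
    case False
    define a b c d where "a = euler_E q" "b = euler_E (q ^ 2)" "c = euler_E (q ^ 5)" "d = euler_E (q ^ 10)"
    have nz: "a \<noteq> 0" "b \<noteq> 0" "c \<noteq> 0" "d \<noteq> 0" "q \<noteq> 0"
      using euler_E_nonzero_power[OF assms] euler_E_nonzero[OF assms] False by (auto simp: a_b_c_d_def)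
    have q5: "norm (q ^ 5) < 1" "q ^ 5 \<noteq> 0" using norm_power_less_1[OF assms, of 5] False by auto
    have phi: "theta_phi (-q) = a\<^sup>2 / b" "theta_phi (- (q ^ 5)) = c\<^sup>2 / d"
      and psi: "theta_psi q = b\<^sup>2 / a" "theta_psi (q ^ 5) = d\<^sup>2 / c"
      using theta_phi_minus[OF assms False] theta_phi_minus[OF q5]
        theta_psi_product[OF assms False] theta_psi_product[OF q5]
      by (simp_all add: a_b_c_d_def flip: power_mult)
    have P: "eta_P q = a ^ 5 / c" "eta_P (q ^ 2) = b ^ 5 / d"
      and Q: "eta_Q q = q * (c ^ 5 / a)" "eta_Q (q ^ 2) = q ^ 2 * (d ^ 5 / b)"
      by (simp_all add: eta_P_def eta_Q_def a_b_c_d_def flip: power_mult)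
    define Y where "Y = b ^ 4 * c\<^sup>2 / (q * a\<^sup>2 * d ^ 4)"
    define S where "S = q ^ 2 * (d ^ 5 / b)"
    have Y: "Y * (q * a\<^sup>2 * d ^ 4) = b ^ 4 * c\<^sup>2" using nz by (simp add: Y_def)
    have 1: "Y - 1 = b * c ^ 5 / (q * a * d ^ 5)"
    proof -
      have "(b\<^sup>2 / a)\<^sup>2 - q * (d\<^sup>2 / c)\<^sup>2 = b * c ^ 3 / (a * d)"
        using psi_sq_eta[OF assms False] unfolding psi by (simp add: a_b_c_d_def)
      moreover have "Y - 1 = ((b\<^sup>2 / a)\<^sup>2 - q * (d\<^sup>2 / c)\<^sup>2) * (c\<^sup>2 / (q * d ^ 4))"
        using nz by (simp add: Y_def field_simps)
      ultimately show ?thesis using nz by (simp add: divide_simps) algebra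
    qed
    \<comment> \<open>Y - 5 is Y - 1 times \<phi>^2(-q) / \<phi>^2(-q^5): dividing the relation for
      \<phi>^2 by \<phi>^2(-q^5) and multiplying by Y - 1 turns its eta quotient into the constant
      4.\<close>
    have 2: "Y - 5 = a ^ 3 * c / (q * b * d ^ 3)"
    proof -
      have "(a\<^sup>2 / b)\<^sup>2 = (c\<^sup>2 / d)\<^sup>2 - 4 * q * (a * d ^ 3 / (b * c))"
        using phi_sq_eta[OF assms False] unfolding phi by (simp add: a_b_c_d_def)
      note phi_rel = this
      have X: "a ^ 3 * c / (q * b * d ^ 3) = (a\<^sup>2 / b)\<^sup>2 * (d\<^sup>2 / c ^ 4) * (b * c ^ 5 / (q * a * d ^ 5))"
        using nz by (simp add: field_simps) algebra
      have Z: "((c\<^sup>2 / d)\<^sup>2 - 4 * q * (a * d ^ 3 / (b * c))) * (d\<^sup>2 / c ^ 4) * (b * c ^ 5 / (q * a * d ^ 5)) =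
          b * c ^ 5 / (q * a * d ^ 5) - 4"
        using nz by (simp add: field_simps) algebra
      have "Y - 5 = b * c ^ 5 / (q * a * d ^ 5) - 4" unfolding 1[symmetric] by simp
      then show ?thesis unfolding X phi_rel Z .
    qed
    have Y1: "Y - 1 \<noteq> 0" using nz unfolding 1 by simp
    \<comment> \<open>After multiplication by Y - 1 every term is S times a polynomial in Y. The
      first identity, for instance, becomes (Y - 1)^2 (Y - 5) = Y (Y - 5) (Y - 1) - (Y - 1) (Y -
      5).\<close>
    have eqs: "q * (c ^ 5 / a) = S * (Y - 1)" "(b ^ 5 / d) * (Y - 1) = S * Y ^ 2 * (Y - 5)"
        "(a ^ 5 / c) * (Y - 1) = S * Y * (Y - 5) ^ 2"
        "a\<^sup>2 / b * (c\<^sup>2 / d) ^ 3 = S * (Y - 1) * (Y - 5)"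
        "(a\<^sup>2 / b) ^ 3 * (c\<^sup>2 / d) = S * (Y - 5) ^ 2"
        "4 * q * (b\<^sup>2 / a) ^ 3 * (d\<^sup>2 / c) * (Y - 1) = 4 * S * Y ^ 2"
        "4 * q ^ 2 * (b\<^sup>2 / a) * (d\<^sup>2 / c) ^ 3 * (Y - 1) = 4 * S * Y"
      unfolding 1 2 unfolding S_def Y_def using nz by (simp_all add: field_simps eval_nat_numeral)
    have mult: "u = v" if "u * (Y - 1) = v * (Y - 1)" for u v using that Y1 by simp
    have "a\<^sup>2 / b * (c\<^sup>2 / d) ^ 3 = 1/5 * (a ^ 5 / c + 4 * (b ^ 5 / d)) - (q * (c ^ 5 / a) - 4 * S)"
      by (rule mult) (use eqs in algebra)
    moreover have "(a\<^sup>2 / b) ^ 3 * (c\<^sup>2 / d) = 1/5 * (a ^ 5 / c + 4 * (b ^ 5 / d)) - 5 * (q * (c ^ 5 / a) - 4 * S)"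
      by (rule mult) (use eqs in algebra)
    moreover have "4 * q * (b\<^sup>2 / a) ^ 3 * (d\<^sup>2 / c) = 1/5 * (a ^ 5 / c - b ^ 5 / d) + 5 * (q * (c ^ 5 / a) + S)"
      by (rule mult) (use eqs in algebra)
    moreover have "4 * q ^ 2 * (b\<^sup>2 / a) * (d\<^sup>2 / c) ^ 3 = 1/5 * (a ^ 5 / c - b ^ 5 / d) + (q * (c ^ 5 / a) + S)"
      by (rule mult) (use eqs in algebra)
    ultimately show ?thesis unfolding phi psi P Q S_def[symmetric] by blast
  qed
  then show "theta_phi (-q) * theta_phi (- (q ^ 5)) ^ 3 =
      1/5 * (eta_P q + 4 * eta_P (q ^ 2)) - (eta_Q q - 4 * eta_Q (q ^ 2))"
    "theta_phi (-q) ^ 3 * theta_phi (- (q ^ 5)) =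
      1/5 * (eta_P q + 4 * eta_P (q ^ 2)) - 5 * (eta_Q q - 4 * eta_Q (q ^ 2))"
    "4 * q * theta_psi q ^ 3 * theta_psi (q ^ 5) =
      1/5 * (eta_P q - eta_P (q ^ 2)) + 5 * (eta_Q q + eta_Q (q ^ 2))"
    "4 * q ^ 2 * theta_psi q * theta_psi (q ^ 5) ^ 3 =
      1/5 * (eta_P q - eta_P (q ^ 2)) + (eta_Q q + eta_Q (q ^ 2))" by blast+
qed

subsection \<open>Lambert series of the eta quotients\<close>

text \<open>Fubini for the double series: its rows are the terms of a Lambert series, and grouping
  by the product of the indices gives divisor sums. As (n+1)(m+1) \<ge> n + m, a geometric series
  times a differentiated one is a majorant. Separate weights on divisor and codivisor make the lemma
  serve both eta quotients.\<close>

lemma lambert_rearrangement: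
  fixes q :: complex
  assumes q: "norm q < 1"
    and \<alpha>: "\<And>n. norm (\<alpha> n) \<le> 1" and \<beta>: "\<And>n. norm (\<beta> n) \<le> real n"
    and g: "\<And>n. (\<lambda>m. \<alpha> (Suc n) * \<beta> (Suc m) * q ^ (Suc n * Suc m)) sums g n"
  obtains S where "g sums S"
    "(\<lambda>N. (\<Sum>d | d dvd Suc N. \<alpha> (Suc N div d) * \<beta> d) * q ^ Suc N) sums S"
proof -
  define F where "F = (\<lambda>(n, m). \<alpha> (Suc n) * \<beta> (Suc m) * q ^ (Suc n * Suc m))"
  define u :: "nat \<Rightarrow> complex" where "u n = of_real (norm q ^ n)" for n
  define v :: "nat \<Rightarrow> complex" where "v m = of_real (real (Suc m) * norm q ^ m)" for m
  have u: "(\<lambda>n. norm (u n)) summable_on UNIV"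
    using q by (simp add: u_def summable_on_UNIV_nonneg_real_iff norm_power summable_geometric)
  have "(\<lambda>m. real (Suc m) * norm q ^ m) sums (1 / (1 - norm q)\<^sup>2)"
    using geometric_deriv_sums[of "norm q"] q by simp
  then have v: "(\<lambda>m. norm (v m)) summable_on UNIV"
    unfolding v_def norm_of_real by (simp add: summable_on_UNIV_nonneg_real_iff abs_mult sums_iff)
  have F_le: "norm (F (n, m)) \<le> norm (u n * v m)" for n m
  proof -
    have "norm q ^ (Suc n * Suc m) \<le> norm q ^ (n + m)"
      using q by (intro power_decreasing) auto
    then have "norm (\<alpha> (Suc n)) * norm (\<beta> (Suc m)) * norm q ^ (Suc n * Suc m) \<le>
        1 * real (Suc m) * norm q ^ (n + m)"
      by (intro mult_mono \<alpha> \<beta>) auto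
    moreover have "norm (F (n, m)) = norm (\<alpha> (Suc n)) * norm (\<beta> (Suc m)) * norm q ^ (Suc n * Suc m)"
      by (simp only: F_def prod.case norm_mult norm_power)
    moreover have "norm (u n * v m) = 1 * real (Suc m) * norm q ^ (n + m)"
      unfolding u_def v_def norm_mult norm_of_real by (simp add: power_add abs_mult)
    ultimately show ?thesis by simp
  qed
  have F: "(\<lambda>p. norm (F p)) summable_on UNIV"
    by (rule Infinite_Sum.abs_summable_on_comparison_test'[OF infsum_mult(1)[OF u v]]) (use F_le in auto)
  define S where "S = infsum F UNIV"
  have S: "(F has_sum S) UNIV"
    unfolding S_def by (rule has_sum_infsum[OF abs_summable_summable[OF F]])
  have inner: "((\<lambda>m. F (n, m)) has_sum g n) UNIV" for n
  proof -
    have "(\<lambda>m. norm (F (n, m))) summable_on UNIV"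
      using F Infinite_Sum.abs_summable_on_Sigma_iff[of F UNIV "\<lambda>_. UNIV"] by auto
    then have "summable (\<lambda>m. norm (F (n, m)))" by (rule summable_on_imp_summable)
    then show ?thesis using g[of n] by (intro norm_summable_imp_has_sum) (simp_all add: F_def)
  qed
  have "(g has_sum S) UNIV"
    by (rule has_sum_SigmaD[where B = "\<lambda>_. UNIV" and f = F]) (use S inner in auto)
  then have "g sums S" by (rule has_sum_imp_sums)
  moreover have "((\<lambda>N. (\<Sum>d | d dvd Suc N. \<alpha> (Suc N div d) * \<beta> d) * q ^ Suc N) has_sum S) UNIV"
  proof (rule has_sum_SigmaD)
    show "((\<lambda>(N, d). \<alpha> (Suc N div d) * \<beta> d * q ^ Suc N) has_sum S) (Sigma UNIV (\<lambda>N. {d. d dvd Suc N}))"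
    \<comment> \<open>The pair (n, m) stands for the factors n + 1 and m + 1, and N for their
      product N + 1; hence the predecessors in both maps.\<close>
    proof (rule has_sum_reindex_bij_witness[THEN iffD2, OF _ _ _ _ _ _ S])
      show "(\<lambda>(n, m). (Suc n * Suc m - 1, Suc m)) p \<in> Sigma UNIV (\<lambda>N. {d. d dvd Suc N})" for p
        by (cases p) (simp del: mult_Suc mult_Suc_right)
      show "(\<lambda>(N, d). (Suc N div d - 1, d - 1)) ((\<lambda>(n, m). (Suc n * Suc m - 1, Suc m)) p) = p" for p
        by (cases p) (simp del: mult_Suc mult_Suc_right)
      fix p :: "nat \<times> nat" assume p: "p \<in> Sigma UNIV (\<lambda>N. {d. d dvd Suc N})"
      obtain N d where Nd: "p = (N, d)" "d dvd Suc N" using p by (cases p) auto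
      then obtain e where e: "Suc N = d * e" by (auto simp: dvd_def)
      then have "d > 0" "e > 0" by (auto intro!: Nat.gr0I)
      then obtain d' e' where de: "d = Suc d'" "e = Suc e'" by (metis Suc_pred)
      have *: "Suc N div d = Suc e'" unfolding e de(2)[symmetric] using \<open>d > 0\<close> by simp
      have N: "Suc N = Suc e' * Suc d'" unfolding de[symmetric] e by (rule mult.commute)
      have p_eq: "(\<lambda>(N, d). (Suc N div d - 1, d - 1)) p = (e', d')"
        using * de(1) by (simp add: Nd(1))
      show "(\<lambda>(n, m). (Suc n * Suc m - 1, Suc m)) ((\<lambda>(N, d). (Suc N div d - 1, d - 1)) p) = p"
        unfolding p_eq unfolding prod.case Nd(1) N[symmetric] using de(1) by simp
      show "F ((\<lambda>(N, d). (Suc N div d - 1, d - 1)) p) = (case p of (N, d) \<Rightarrow> \<alpha> (Suc N div d) * \<beta> d * q ^ Suc N)"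
        unfolding p_eq unfolding F_def prod.case Nd(1) * unfolding N de(1) ..
    qed auto
    show "((\<lambda>d. case (N, d) of (N, d) \<Rightarrow> \<alpha> (Suc N div d) * \<beta> d * q ^ Suc N) has_sum
        (\<Sum>d | d dvd Suc N. \<alpha> (Suc N div d) * \<beta> d) * q ^ Suc N) {d. d dvd Suc N}" for N
      by (rule has_sum_finiteI) (auto simp: sum_distrib_right)
  qed
  then have "(\<lambda>N. (\<Sum>d | d dvd Suc N. \<alpha> (Suc N div d) * \<beta> d) * q ^ Suc N) sums S"
    by (rule has_sum_imp_sums)
  ultimately show thesis by (rule that)
qed

text \<open>The Legendre symbol modulo 5, whose nonzero squares are 1 and 4.\<close>

definition chi5 :: "nat \<Rightarrow> complex" where
  "chi5 n = (if n mod 5 \<in> {1, 4} then 1 else if n mod 5 \<in> {2, 3} then -1 else 0)"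

lemma norm_chi5_le: "norm (chi5 n) \<le> 1"
  by (simp add: chi5_def)

definition sigma_P :: "nat \<Rightarrow> complex" where
  "sigma_P n = (\<Sum>d | d dvd n. chi5 d * of_nat d)"

definition sigma_Q :: "nat \<Rightarrow> complex" where
  "sigma_Q n = (\<Sum>d | d dvd n. chi5 (n div d) * of_nat d)"

lemma theta_sum_shift:
  assumes "norm q < 1" "q \<noteq> 0" "x \<noteq> 0" "x \<noteq> 1"
  shows "theta_sum 0 q x = (1 - x) * (euler_E q * qpoch (x * q) q * qpoch (q / x) q)"
  unfolding triple_product[OF assms(1-3)] qpoch_Suc[OF assms(1), of x] by simp

text \<open>Inversion exchanges the two infinite products up to their first factors, and 1 - 1/x = -
  (1 - x)/x.\<close>

lemma theta_sum_inverse: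
  assumes "norm q < 1" "q \<noteq> 0" "x \<noteq> 0"
  shows "theta_sum 0 q (1 / x) = - theta_sum 0 q x / x"
proof -
  have 1: "qpoch (1 / x) q = (1 - 1 / x) * qpoch (q / x) q"
    using qpoch_Suc[OF assms(1), of "1 / x"] by simp
  have 2: "qpoch x q = (1 - x) * qpoch (q * x) q"
    using qpoch_Suc[OF assms(1), of x] by (simp only: mult.commute)
  have "theta_sum 0 q (1 / x) = euler_E q * qpoch (1 / x) q * qpoch (q * x) q"
    using triple_product[OF assms(1,2), of "1 / x"] assms by simp
  also have "\<dots> = - (euler_E q * qpoch x q * qpoch (q / x) q) / x"
    unfolding 1 2 using assms by (simp add: field_simps)
  finally show ?thesis unfolding triple_product[OF assms] .
qed

lemma deriv_geometric_sums:
  fixes z :: complex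
  assumes "norm z < 1"
  shows "(\<lambda>m. of_nat (Suc m) * z ^ Suc m) sums (z / (1 - z)\<^sup>2)"
  using sums_mult[OF geometric_deriv_sums[OF assms], of z] by (simp add: mult_ac)

text \<open>In base q^5 one has T(q^3) = T(q^2), from x -> q^5 / x, and T(1/q) = - T(q)/q. Hence one
  factor T(q) T(q^2) cancels; the other involves the residues 1 to 4 modulo 5 and equals E(q)
  E(q^5).\<close>

lemma eta_Q_wp:
  assumes "norm q < 1" "q \<noteq> 0"
  shows "(\<lambda>k. wp_term (q ^ 5) q k - wp_term (q ^ 5) (q ^ 2) k) sums eta_Q q"
proof -
  have q5: "norm (q ^ 5) < 1" "q ^ 5 \<noteq> 0" using norm_power_less_1[OF assms(1), of 5] assms(2) by auto
  have ne: "q ^ i * (q ^ 5) ^ k \<noteq> 1" if "0 < i" for i k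
  proof -
    have "norm (q ^ (i + 5 * k)) < 1" using that assms(1) by (intro norm_power_less_1) auto
    then have "q ^ (i + 5 * k) \<noteq> 1" by (metis norm_one order_less_irrefl)
    then show ?thesis by (simp add: power_add power_mult)
  qed
  have "q ^ 5 / q = q ^ 4" "q ^ 5 / q ^ 2 = q ^ 3" "q ^ 5 / q ^ 3 = q ^ 2" 
    using assms by (auto simp: eval_nat_numeral)
  note div = this
  have x: "q \<noteq> 0" "\<And>k. q * (q ^ 5) ^ k \<noteq> 1" "\<And>k. q ^ 5 / q * (q ^ 5) ^ k \<noteq> 1"
    using ne[of 1] ne[of 4] assms unfolding div by auto
  have y: "q ^ 2 \<noteq> 0" "\<And>k. q ^ 2 * (q ^ 5) ^ k \<noteq> 1" "\<And>k. q ^ 5 / q ^ 2 * (q ^ 5) ^ k \<noteq> 1"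
    using ne[of 2] ne[of 3] assms unfolding div by auto
  define T where "T x = theta_sum 0 (q ^ 5) x" for x
  define A where "A j = qpoch (q ^ j) (q ^ 5)" for j
  have T: "T q = euler_E (q ^ 5) * A 1 * A 4" "T (q ^ 2) = euler_E (q ^ 5) * A 2 * A 3" "T (q ^ 3) = T (q ^ 2)"
    using triple_product[OF q5] assms by (simp_all add: T_def A_def div)
  have "euler_E q = A 1 * A 2 * A 3 * A 4 * euler_E (q ^ 5)"
    unfolding euler_E_qpoch[of q] qpoch_dissect[OF assms(1), of 5 q, simplified] lessThan_5 A_def
    by (simp add: euler_E_qpoch mult_ac power_numeral_reduce)
  then have TT: "T q * T (q ^ 2) = euler_E q * euler_E (q ^ 5)" unfolding T by simp
  have "T (1 / q) = - T q / q" unfolding T_def by (rule theta_sum_inverse[OF q5 assms(2)])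
  moreover have "q / q ^ 2 = 1 / q" "q * q ^ 2 = q ^ 3" using assms by (auto simp: eval_nat_numeral)
  ultimately have "T (q * q ^ 2) * T (q / q ^ 2) = - (T q * T (q ^ 2)) / q"
    using T(3) by simp
  moreover have "(wp (q ^ 5) q - wp (q ^ 5) (q ^ 2)) * (T q * T (q ^ 2))\<^sup>2 =
      - (euler_E (q ^ 5) ^ 6 * q ^ 2 * (T (q * q ^ 2) * T (q / q ^ 2)))"
    unfolding T_def by (rule wp_difference[OF q5 x y])
  ultimately have main: "(wp (q ^ 5) q - wp (q ^ 5) (q ^ 2)) * (euler_E q * euler_E (q ^ 5))\<^sup>2 =
      euler_E (q ^ 5) ^ 6 * q * (euler_E q * euler_E (q ^ 5))"
    unfolding TT using assms by (simp add: power2_eq_square[of q])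
  then have "wp (q ^ 5) q - wp (q ^ 5) (q ^ 2) = eta_Q q"
  proof -
    have "w = x * (c ^ 5 / e)" if "w * (e * c)\<^sup>2 = c ^ 6 * x * (e * c)" "e \<noteq> 0" "c \<noteq> 0" for w x c e :: complex
    proof -
      have "(e * c\<^sup>2) * (w * e) = (e * c\<^sup>2) * (x * c ^ 5)" using that(1) by algebra
      then have "w * e = x * c ^ 5" using that by simp
      then show ?thesis using that by (simp add: field_simps)
    qed
    then show ?thesis
      using euler_E_nonzero[OF assms(1)] euler_E_nonzero[OF q5(1)] main
      unfolding eta_Q_def by blast
  qed
  moreover have "wp_term (q ^ 5) q sums wp (q ^ 5) q" "wp_term (q ^ 5) (q ^ 2) sums wp (q ^ 5) (q ^ 2)"
    unfolding wp_def using wp_sums[OF q5 x] wp_sums[OF q5 y] by (auto simp: sums_iff)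
  ultimately show ?thesis using sums_diff by metis
qed

text \<open>In each block of five consecutive n the residues 1 and 4 make up a
  \<open>wp_term\<close> at q, and the residues 2 and 3, with the opposite sign, one at q^2.\<close>

theorem eta_Q_sums:
  assumes "norm q < 1"
  shows "(\<lambda>n. sigma_Q (Suc n) * q ^ Suc n) sums eta_Q q"
proof (cases "q = 0")
  case True
  then show ?thesis by (simp add: eta_Q_def)
next
  case False
  define L where "L n = q ^ n / (1 - q ^ n)\<^sup>2" for n
  have *: "(\<lambda>m. chi5 (Suc n) * of_nat (Suc m) * q ^ (Suc n * Suc m)) sums (chi5 (Suc n) * L (Suc n))" for n
    using sums_mult[OF deriv_geometric_sums[OF norm_power_less_1[OF assms, of "Suc n"]], of "chi5 (Suc n)"]
    by (simp only: L_def power_mult[symmetric] mult.assoc)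
  obtain S where S: "(\<lambda>n. chi5 (Suc n) * L (Suc n)) sums S"
      "(\<lambda>N. (\<Sum>d | d dvd Suc N. chi5 (Suc N div d) * of_nat d) * q ^ Suc N) sums S"
    by (rule lambert_rearrangement[of q chi5 of_nat "\<lambda>n. chi5 (Suc n) * L (Suc n)"])
      (use assms norm_chi5_le * in auto)
  \<comment> \<open>\<open>chi5 0\<close> is 0, so a term n = 0 may be added; the blocks then start
    at multiples of 5.\<close>
  have "(\<lambda>n. chi5 n * L n) sums S"
    using S(1) by (subst (asm) sums_Suc_iff) (simp add: chi5_def)
  then have "(\<lambda>k. \<Sum>n\<in>{k * 5..<k * 5 + 5}. chi5 n * L n) sums S"
    by (rule sums_group) simp
  also have "(\<lambda>k. \<Sum>n\<in>{k * 5..<k * 5 + 5}. chi5 n * L n) =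
      (\<lambda>k. wp_term (q ^ 5) q k - wp_term (q ^ 5) (q ^ 2) k)"
  proof
    fix k :: nat
    have "{k * 5..<k * 5 + 5} = {5 * k, 5 * k + 1, 5 * k + 2, 5 * k + 3, 5 * k + 4}" by auto
    then have "(\<Sum>n\<in>{k * 5..<k * 5 + 5}. chi5 n * L n) =
        L (5 * k + 1) + L (5 * k + 4) - L (5 * k + 2) - L (5 * k + 3)"
    proof -
      have "(5 * k) mod 5 = 0" "(5 * k + 1) mod 5 = 1" "(5 * k + 2) mod 5 = 2" "(5 * k + 3) mod 5 = 3" "(5 * k + 4) mod 5 = 4"
        by presburger+
      then have chi: "chi5 (5 * k) = 0" "chi5 (5 * k + 1) = 1" "chi5 (5 * k + 2) = -1" "chi5 (5 * k + 3) = -1" "chi5 (5 * k + 4) = 1"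
        unfolding chi5_def by simp_all
      have "(\<Sum>n\<in>{5 * k, 5 * k + 1, 5 * k + 2, 5 * k + 3, 5 * k + 4}. f n) =
          f (5 * k) + f (5 * k + 1) + f (5 * k + 2) + f (5 * k + 3) + f (5 * k + 4)" for f :: "nat \<Rightarrow> complex"
        by simp
      then show ?thesis using \<open>{k * 5..<k * 5 + 5} = _\<close> by (simp only: chi) simp
    qed
    moreover have "q ^ 5 / q = q ^ 4" "q ^ 5 / q ^ 2 = q ^ 3" using False by (auto simp: eval_nat_numeral)
    moreover have "L (5 * k + j) = q ^ j * (q ^ 5) ^ k / (1 - q ^ j * (q ^ 5) ^ k)\<^sup>2" for j
    proof -
      have "q ^ (5 * k + j) = q ^ j * (q ^ 5) ^ k" by (simp only: power_add power_mult[of q 5 k]) (rule mult.commute)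
      then show ?thesis by (simp only: L_def)
    qed
    ultimately show "(\<Sum>n\<in>{k * 5..<k * 5 + 5}. chi5 n * L n) =
        wp_term (q ^ 5) q k - wp_term (q ^ 5) (q ^ 2) k"
      by (simp only: wp_term_def) simp
  qed
  finally have "S = eta_Q q" using eta_Q_wp[OF assms False] sums_unique2 by blast
  then show ?thesis using S(2) by (simp add: sigma_Q_def)
qed

section \<open>Fifth roots of unity and the quotient E^5(q) / E(q^5)\<close>

definition zeta5 :: complex where "zeta5 = cis (2 * pi / 5)"

lemma zeta5_pow_5: "zeta5 ^ 5 = 1"
  using Complex.DeMoivre[of "2 * pi / 5" 5] by (simp add: zeta5_def)

lemma zeta5_neq_1: "zeta5 \<noteq> 1"
proof
  assume "zeta5 = 1"
  then have "sin (2 * pi / 5) = 0" by (simp add: zeta5_def complex_eq_iff)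
  moreover have "sin (2 * pi / 5) > 0" by (rule sin_gt_zero) auto
  ultimately show False by simp
qed

lemma zeta5_nonzero: "zeta5 \<noteq> 0"
  by (simp add: zeta5_def)

lemma norm_zeta5: "norm zeta5 = 1"
  by (simp add: zeta5_def)

lemma zeta5_cyclotomic: "1 + zeta5 + zeta5 ^ 2 + zeta5 ^ 3 + zeta5 ^ 4 = 0"
proof -
  have "(zeta5 - 1) * (1 + zeta5 + zeta5 ^ 2 + zeta5 ^ 3 + zeta5 ^ 4) = zeta5 ^ 5 - 1" by algebra
  then show ?thesis using zeta5_pow_5 zeta5_neq_1 by simp
qed

lemma zeta5_pow_neq_1: "zeta5 ^ 2 \<noteq> 1" "zeta5 ^ 3 \<noteq> 1" "zeta5 ^ 4 \<noteq> 1"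
proof -
  have "zeta5 = (zeta5 ^ 2) ^ 3" "zeta5 = (zeta5 ^ 3) ^ 2" "zeta5 = (zeta5 ^ 4) ^ 4"
    using zeta5_pow_5 by algebra+
  then show "zeta5 ^ 2 \<noteq> 1" "zeta5 ^ 3 \<noteq> 1" "zeta5 ^ 4 \<noteq> 1"
    using zeta5_neq_1 by (metis power_one)+
qed

lemma zeta5_pow_mod: "zeta5 ^ n = zeta5 ^ (n mod 5)"
proof -
  have "zeta5 ^ n = zeta5 ^ (5 * (n div 5) + n mod 5)" by simp
  also have "\<dots> = zeta5 ^ (n mod 5)" unfolding power_add power_mult zeta5_pow_5 by simp
  finally show ?thesis .
qed

definition gauss5 :: complex where
  "gauss5 = zeta5 + zeta5 ^ 4 - zeta5 ^ 2 - zeta5 ^ 3"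

text \<open>The finite Fourier transform of the Legendre symbol is the quadratic Gauss sum times the
  symbol itself. This converts expansions in powers of \<open>zeta5\<close> into character
  sums.\<close>

lemma gauss_sum_5:
  "zeta5 ^ n + (zeta5 ^ 4) ^ n - (zeta5 ^ 2) ^ n - (zeta5 ^ 3) ^ n = gauss5 * chi5 n"
proof -
  define m where "m = n mod 5"
  have m: "m \<in> {0, 1, 2, 3, 4}" by (auto simp: m_def)
  have mult: "(zeta5 ^ k) ^ n = (zeta5 ^ k) ^ m" for k
    unfolding m_def by (metis zeta5_pow_mod power_mult mod_mult_right_eq)
  have "zeta5 ^ n + (zeta5 ^ 4) ^ n - (zeta5 ^ 2) ^ n - (zeta5 ^ 3) ^ n =
      zeta5 ^ m + (zeta5 ^ 4) ^ m - (zeta5 ^ 2) ^ m - (zeta5 ^ 3) ^ m"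
    using mult[of 1] mult[of 2] mult[of 3] mult[of 4] by simp
  moreover have "chi5 n = (if m \<in> {1, 4} then 1 else if m \<in> {2, 3} then -1 else 0)"
    by (simp add: chi5_def m_def)
  moreover have "zeta5 ^ 6 = zeta5" "zeta5 ^ 8 = zeta5 ^ 3" "zeta5 ^ 9 = zeta5 ^ 4" "zeta5 ^ 12 = zeta5 ^ 2" "zeta5 ^ 16 = zeta5"
    using zeta5_pow_mod[of 6] zeta5_pow_mod[of 8] zeta5_pow_mod[of 9] zeta5_pow_mod[of 12] zeta5_pow_mod[of 16] by simp_all
  ultimately show ?thesis
    using m by (auto simp: gauss5_def simp flip: power_mult)
qed

lemma prod_zeta5: "(1 - z) * (1 - zeta5 * z) * (1 - zeta5 ^ 2 * z) * (1 - zeta5 ^ 3 * z) * (1 - zeta5 ^ 4 * z) = 1 - z ^ 5"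
  using zeta5_cyclotomic zeta5_pow_5 by algebra

lemma qpoch_zeta5:
  assumes "norm q < 1"
  shows "euler_E q * qpoch (zeta5 * q) q * qpoch (zeta5 ^ 2 * q) q * qpoch (zeta5 ^ 3 * q) q * qpoch (zeta5 ^ 4 * q) q =
    euler_E (q ^ 5)"
proof (rule LIMSEQ_unique)
  show "(\<lambda>N. (\<Prod>n<N. 1 - q * q ^ n) * (\<Prod>n<N. 1 - zeta5 * q * q ^ n) * (\<Prod>n<N. 1 - zeta5 ^ 2 * q * q ^ n) *
      (\<Prod>n<N. 1 - zeta5 ^ 3 * q * q ^ n) * (\<Prod>n<N. 1 - zeta5 ^ 4 * q * q ^ n)) \<longlonglongrightarrow>
      euler_E q * qpoch (zeta5 * q) q * qpoch (zeta5 ^ 2 * q) q * qpoch (zeta5 ^ 3 * q) q * qpoch (zeta5 ^ 4 * q) q"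
    unfolding euler_E_qpoch by (intro tendsto_mult qpoch_LIMSEQ assms)
  have "(\<lambda>N. \<Prod>n<N. 1 - q ^ 5 * (q ^ 5) ^ n) \<longlonglongrightarrow> euler_E (q ^ 5)"
    unfolding euler_E_qpoch by (intro qpoch_LIMSEQ norm_power_less_1 assms) simp
  moreover have "1 - q ^ 5 * (q ^ 5) ^ n = (1 - q * q ^ n) * (1 - zeta5 * q * q ^ n) * (1 - zeta5 ^ 2 * q * q ^ n) *
      (1 - zeta5 ^ 3 * q * q ^ n) * (1 - zeta5 ^ 4 * q * q ^ n)" for n
    using prod_zeta5[of "q * q ^ n"] by (simp add: power_mult_distrib mult.assoc flip: power_mult) (simp add: mult.commute)
  ultimately show "(\<lambda>N. (\<Prod>n<N. 1 - q * q ^ n) * (\<Prod>n<N. 1 - zeta5 * q * q ^ n) * (\<Prod>n<N. 1 - zeta5 ^ 2 * q * q ^ n) *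
      (\<Prod>n<N. 1 - zeta5 ^ 3 * q * q ^ n) * (\<Prod>n<N. 1 - zeta5 ^ 4 * q * q ^ n)) \<longlonglongrightarrow> euler_E (q ^ 5)"
    by (simp add: prod.distrib)
qed

text \<open>The cancellation of \<open>eta_Q_wp\<close> at points of the unit circle: xy = zeta5^3
  and x/y = zeta5^4 are the inverses of zeta5^2 and zeta5, so T changes only by a sign and a root of
  unity.\<close>

lemma eta_P_wp:
  assumes "norm q < 1" "q \<noteq> 0"
  shows "(\<lambda>k. wp_term q zeta5 k - wp_term q (zeta5 ^ 2) k) sums (- (gauss5 / 5) * eta_P q)"
proof -
  note z0 = zeta5_nonzero
  have ne: "x * q ^ k \<noteq> 1" "q / x * q ^ k \<noteq> 1" if "norm x = 1" "x \<noteq> 1" for x k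
  proof -
    show "x * q ^ k \<noteq> 1"
    proof (cases k)
      case (Suc l)
      then have "norm (x * q ^ k) < 1" using that norm_power_less_1[OF assms(1), of k] by (simp add: norm_mult)
      then show ?thesis by (metis norm_one order_less_irrefl)
    qed (use that in auto)
    have "norm (q / x * q ^ k) < 1"
      using that norm_power_less_1[OF assms(1), of "Suc k"] by (simp add: norm_mult norm_divide)
    then show "q / x * q ^ k \<noteq> 1" by (metis norm_one order_less_irrefl)
  qed
  have norm2: "norm (zeta5 ^ 2) = 1" by (simp add: norm_power norm_zeta5)
  note x = z0 ne[OF norm_zeta5 zeta5_neq_1]
  have y0: "zeta5 ^ 2 \<noteq> 0" using z0 by simp
  note y = y0 ne[OF norm2 zeta5_pow_neq_1(1)]
  define T where "T x = theta_sum 0 q x" for x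
  define B where "B j = qpoch (zeta5 ^ j * q) q" for j
  have div: "q / zeta5 = zeta5 ^ 4 * q" "q / zeta5 ^ 2 = zeta5 ^ 3 * q" "q / zeta5 ^ 3 = zeta5 ^ 2 * q" "q / zeta5 ^ 4 = zeta5 ^ 1 * q"
    using z0 zeta5_pow_5 by (simp_all add: field_simps eval_nat_numeral)
  have T: "T zeta5 = (1 - zeta5) * (euler_E q * B 1 * B 4)" "T (zeta5 ^ 2) = (1 - zeta5 ^ 2) * (euler_E q * B 2 * B 3)"
    "T (zeta5 ^ 3) = (1 - zeta5 ^ 3) * (euler_E q * B 3 * B 2)" "T (zeta5 ^ 4) = (1 - zeta5 ^ 4) * (euler_E q * B 4 * B 1)"
    using theta_sum_shift[OF assms] z0 zeta5_neq_1 zeta5_pow_neq_1 by (simp_all add: T_def B_def div)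
  have BB: "euler_E q * (B 1 * B 2 * B 3 * B 4) = euler_E (q ^ 5)"
    using qpoch_zeta5[OF assms(1)] by (simp add: B_def mult_ac)
  have "zeta5 * zeta5 ^ 2 = zeta5 ^ 3" "zeta5 / zeta5 ^ 2 = zeta5 ^ 4"
    using z0 zeta5_pow_5 by (simp_all add: field_simps eval_nat_numeral)
  then have main: "(wp q zeta5 - wp q (zeta5 ^ 2)) * (T zeta5 * T (zeta5 ^ 2))\<^sup>2 =
      - (euler_E q ^ 6 * zeta5 ^ 2 * (T (zeta5 ^ 3) * T (zeta5 ^ 4)))"
    using wp_difference[OF assms x y] by (simp only: T_def)
  define e c z where "e = euler_E q" "c = euler_E (q ^ 5)" "z = zeta5"
  have nz: "e \<noteq> 0" "c \<noteq> 0" using euler_E_nonzero[OF assms(1)] euler_E_nonzero_power[OF assms(1)] by (auto simp: e_c_z_def)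
  have zz: "1 - z \<noteq> 0" "1 - z ^ 2 \<noteq> 0" using zeta5_neq_1 zeta5_pow_neq_1 by (auto simp: e_c_z_def)
  have z: "1 + z + z ^ 2 + z ^ 3 + z ^ 4 = 0" "z ^ 5 = 1" using zeta5_cyclotomic zeta5_pow_5 by (auto simp: e_c_z_def)
  have "T zeta5 * T (zeta5 ^ 2) = (1 - z) * (1 - z ^ 2) * e * (e * (B 1 * B 2 * B 3 * B 4))"
    unfolding T e_c_z_def by (simp only: mult_ac)
  then have 1: "T zeta5 * T (zeta5 ^ 2) = (1 - z) * (1 - z ^ 2) * e * c" using BB by (simp add: e_c_z_def)
  have "T (zeta5 ^ 3) * T (zeta5 ^ 4) = (1 - z ^ 3) * (1 - z ^ 4) * e * (e * (B 1 * B 2 * B 3 * B 4))"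
    unfolding T e_c_z_def by (simp only: mult_ac)
  then have 2: "T (zeta5 ^ 3) * T (zeta5 ^ 4) = (1 - z ^ 3) * (1 - z ^ 4) * e * c" using BB by (simp add: e_c_z_def)
  define w where "w = wp q zeta5 - wp q (zeta5 ^ 2)"
  have M: "w * ((1 - z) * (1 - z ^ 2) * e * c)\<^sup>2 = - (e ^ 6 * z ^ 2 * ((1 - z ^ 3) * (1 - z ^ 4) * e * c))"
    using main unfolding 1 2 w_def by (simp add: e_c_z_def)
  \<comment> \<open>As z^5 = 1, 1 - z^3 = - z^3 (1 - z^2) and 1 - z^4 = - z^4 (1 - z).\<close>
  have N: "z ^ 2 * ((1 - z ^ 3) * (1 - z ^ 4) * e * c) = z ^ 4 * ((1 - z) * (1 - z ^ 2) * e * c)"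
    using z(2) by algebra
  have "((1 - z) * (1 - z ^ 2) * e\<^sup>2 * c) * (w * ((1 - z) * (1 - z ^ 2)) * c) = ((1 - z) * (1 - z ^ 2) * e\<^sup>2 * c) * (- (z ^ 4 * e ^ 5))"
    using M N by algebra
  then have "w * ((1 - z) * (1 - z ^ 2)) * c = - (z ^ 4 * e ^ 5)"
    by (subst (asm) mult_left_cancel) (use nz zz in auto)
  \<comment> \<open>Trades the cyclotomic factor left over from T for the Gauss sum; the 5 is the
    norm of 1 - z, the product of all 1 - z^j with 0 < j < 5.\<close>
  moreover have "gauss5 * ((1 - z) * (1 - z ^ 2)) = 5 * z ^ 4"
    using z unfolding gauss5_def e_c_z_def[symmetric] by algebra
  ultimately have "((1 - z) * (1 - z ^ 2)) * (5 * w * c) = ((1 - z) * (1 - z ^ 2)) * (- (gauss5 * e ^ 5))"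
    by algebra
  then have "5 * w * c = - (gauss5 * e ^ 5)"
    by (subst (asm) mult_left_cancel) (use zz in auto)
  then have "w = - (gauss5 / 5) * eta_P q"
    using nz by (simp add: eta_P_def e_c_z_def field_simps)
  moreover have "wp_term q zeta5 sums wp q zeta5" "wp_term q (zeta5 ^ 2) sums wp q (zeta5 ^ 2)"
    unfolding wp_def using wp_sums[OF assms x] wp_sums[OF assms y] by (auto simp: sums_iff)
  ultimately show ?thesis unfolding w_def using sums_diff by metis
qed

lemma gauss5_nonzero: "gauss5 \<noteq> 0"
proof -
  have "gauss5 * ((1 - zeta5) * (1 - zeta5 ^ 2)) = 5 * zeta5 ^ 4"
    using zeta5_cyclotomic zeta5_pow_5 unfolding gauss5_def by algebra
  then show ?thesis using zeta5_nonzero by auto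
qed

text \<open>For n \<ge> 1 the terms expand in zeta5^(j m) q^(n m), and the signed sum over j is the
  Gauss sum times \<open>chi5 m\<close>: the character now sits on the divisor with the weight m.
  The term n = 0 is free of q and accounts for the constant 1 of \<open>eta_P\<close>.\<close>

theorem eta_P_sums:
  assumes "norm q < 1"
  shows "(\<lambda>n. sigma_P (Suc n) * q ^ Suc n) sums ((1 - eta_P q) / 5)"
proof (cases "q = 0")
  case True
  then show ?thesis by (simp add: eta_P_def euler_E_0)
next
  case False
  define h where "h j n = zeta5 ^ j * q ^ n / (1 - zeta5 ^ j * q ^ n)\<^sup>2" for j n
  define G where "G n = h 1 n - h 2 n" for n
  define G' where "G' n = h 4 n - h 3 n" for n
  have h: "(\<lambda>m. of_nat (Suc m) * ((zeta5 ^ j) ^ Suc m * q ^ (Suc n * Suc m))) sums h j (Suc n)" for j n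
  proof -
    have "norm (zeta5 ^ j * q ^ Suc n) < 1"
      using norm_power_less_1[OF assms, of "Suc n"] by (simp add: norm_mult norm_power norm_zeta5)
    from deriv_geometric_sums[OF this] show ?thesis
      unfolding h_def by (simp only: power_mult power_mult_distrib)
  qed
  have *: "(\<lambda>m. 1 * (chi5 (Suc m) * of_nat (Suc m)) * q ^ (Suc n * Suc m)) sums ((G (Suc n) + G' (Suc n)) / gauss5)" for n
  proof -
    let ?f = "\<lambda>j m. of_nat (Suc m) * ((zeta5 ^ j) ^ Suc m * q ^ (Suc n * Suc m))"
    have "(\<lambda>m. (?f 1 m - ?f 2 m + (?f 4 m - ?f 3 m)) / gauss5) sums ((G (Suc n) + G' (Suc n)) / gauss5)"
      unfolding G_def G'_def by (intro sums_divide sums_add sums_diff h)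
    moreover have "(?f 1 m - ?f 2 m + (?f 4 m - ?f 3 m)) / gauss5 =
        1 * (chi5 (Suc m) * of_nat (Suc m)) * q ^ (Suc n * Suc m)" for m
    proof -
      have "?f 1 m - ?f 2 m + (?f 4 m - ?f 3 m) = of_nat (Suc m) * q ^ (Suc n * Suc m) *
          (zeta5 ^ Suc m + (zeta5 ^ 4) ^ Suc m - (zeta5 ^ 2) ^ Suc m - (zeta5 ^ 3) ^ Suc m)"
        unfolding power_one_right by (simp only: algebra_simps)
      then show ?thesis unfolding gauss_sum_5 using gauss5_nonzero by (simp del: mult_Suc mult_Suc_right)
    qed
    ultimately show ?thesis by (simp only:)
  qed
  obtain S where S: "(\<lambda>n. (G (Suc n) + G' (Suc n)) / gauss5) sums S"
      "(\<lambda>N. (\<Sum>d | d dvd Suc N. 1 * (chi5 d * of_nat d)) * q ^ Suc N) sums S"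
  proof (rule lambert_rearrangement[of q "\<lambda>_. 1" "\<lambda>n. chi5 n * of_nat n" "\<lambda>n. (G (Suc n) + G' (Suc n)) / gauss5"])
    show "norm (chi5 n * of_nat n) \<le> real n" for n
      using mult_right_mono[OF norm_chi5_le[of n], of "real n"] by (simp add: norm_mult)
  qed (use assms * in auto)
  \<comment> \<open>\<open>wp_term\<close> combines the exponents \<open>k\<close> and \<open>-(k+1)\<close>; a telescoping sum aligns the two halves\<close>
  have "h j \<longlonglongrightarrow> zeta5 ^ j * 0 / (1 - zeta5 ^ j * 0)\<^sup>2" for j
    unfolding h_def using assms by (intro tendsto_intros LIMSEQ_power_zero) auto
  then have "G \<longlonglongrightarrow> 0 - 0" unfolding G_def by (intro tendsto_diff) simp_all
  then have "(\<lambda>k. G k - G (Suc k)) sums (G 0 - 0)" by (intro telescope_sums') simp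
  then have "(\<lambda>k. (G k - G (Suc k)) + gauss5 * ((G (Suc k) + G' (Suc k)) / gauss5)) sums (G 0 - 0 + gauss5 * S)"
    by (intro sums_add sums_mult S)
  moreover have "(G k - G (Suc k)) + gauss5 * ((G (Suc k) + G' (Suc k)) / gauss5) =
      wp_term q zeta5 k - wp_term q (zeta5 ^ 2) k" for k
  proof -
    have div: "q / zeta5 = zeta5 ^ 4 * q" "q / zeta5 ^ 2 = zeta5 ^ 3 * q"
      using zeta5_nonzero zeta5_pow_5 by (simp_all add: field_simps eval_nat_numeral)
    have "wp_term q zeta5 k = h 1 k + h 4 (Suc k)" "wp_term q (zeta5 ^ 2) k = h 2 k + h 3 (Suc k)"
      unfolding wp_term_def div h_def by (simp_all add: mult.assoc)
    then show ?thesis using gauss5_nonzero by (simp add: G_def G'_def)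
  qed
  ultimately have "(\<lambda>k. wp_term q zeta5 k - wp_term q (zeta5 ^ 2) k) sums (G 0 + gauss5 * S)"
    by simp
  then have sum: "- (gauss5 / 5) * eta_P q = G 0 + gauss5 * S"
    using eta_P_wp[OF assms False] sums_unique2 by blast
  have "G 0 = - (gauss5 / 5)"
  proof -
    define z where "z = zeta5"
    have zz: "1 - z \<noteq> 0" "1 - z ^ 2 \<noteq> 0" using zeta5_neq_1 zeta5_pow_neq_1 by (auto simp: z_def)
    have "z * (1 - z ^ 2)\<^sup>2 - z ^ 2 * (1 - z)\<^sup>2 = - (gauss5 / 5) * ((1 - z)\<^sup>2 * (1 - z ^ 2)\<^sup>2)"
      using zeta5_cyclotomic zeta5_pow_5 unfolding gauss5_def z_def[symmetric] by algebra
    moreover have "G 0 * ((1 - z)\<^sup>2 * (1 - z ^ 2)\<^sup>2) = z * (1 - z ^ 2)\<^sup>2 - z ^ 2 * (1 - z)\<^sup>2"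
      unfolding G_def h_def z_def[symmetric] using zz by (simp add: field_simps)
    ultimately have "G 0 * ((1 - z)\<^sup>2 * (1 - z ^ 2)\<^sup>2) = - (gauss5 / 5) * ((1 - z)\<^sup>2 * (1 - z ^ 2)\<^sup>2)" by simp
    then show ?thesis by (subst (asm) mult_right_cancel) (use zz in auto)
  qed
  with sum have "gauss5 * S = gauss5 * ((1 - eta_P q) / 5)" by (simp add: field_simps)
  then have S_eq: "S = (1 - eta_P q) / 5"
    by (subst (asm) mult_left_cancel) (use gauss5_nonzero in auto)
  show ?thesis using S(2) unfolding sigma_P_def S_eq[symmetric] by simp
qed

subsection \<open>Multiplicativity and coefficients\<close>

definition dirichlet :: "(nat \<Rightarrow> complex) \<Rightarrow> (nat \<Rightarrow> complex) \<Rightarrow> nat \<Rightarrow> complex" where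
  "dirichlet u v n = (\<Sum>d | d dvd n. u d * v (n div d))"

locale completely_multiplicative =
  fixes u :: "nat \<Rightarrow> complex"
  assumes one: "u 1 = 1" and mult: "u (m * n) = u m * u n"
begin

lemma power: "u (m ^ k) = u m ^ k"
  by (induction k) (use one mult in auto)

end

text \<open>A divisor of m n is uniquely a b with a dvd m and b dvd n; the factors are recovered as
  gcds with m and n.\<close>

lemma dirichlet_mult:
  assumes "completely_multiplicative u" "completely_multiplicative v" and co: "coprime m n"
  shows "dirichlet u v (m * n) = dirichlet u v m * dirichlet u v n"
proof -
  interpret u: completely_multiplicative u by fact
  interpret v: completely_multiplicative v by fact
  have "bij_betw (\<lambda>(a, b). a * b) ({a. a dvd m} \<times> {b. b dvd n}) {d. d dvd m * n}"
  proof (rule bij_betw_imageI)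
    have gcd: "gcd (a * b) m = a \<and> gcd (a * b) n = b" if "a dvd m" "b dvd n" for a b
    proof -
      have "coprime b m" "coprime a n"
        using co that by (meson coprime_commute coprime_divisors dvd_refl)+
      then have "gcd (a * b) m = gcd a m" "gcd (a * b) n = gcd b n"
        by (simp_all add: gcd_mult_left_right_cancel gcd_mult_left_left_cancel coprime_commute)
      then show ?thesis using that by (simp add: gcd_proj1_iff)
    qed
    show "inj_on (\<lambda>(a, b). a * b) ({a. a dvd m} \<times> {b. b dvd n})"
      by (rule inj_on_inverseI[where g = "\<lambda>d. (gcd d m, gcd d n)"]) (use gcd in auto)
    show "(\<lambda>(a, b). a * b) ` ({a. a dvd m} \<times> {b. b dvd n}) = {d. d dvd m * n}"
    proof (intro equalityI subsetI)
      fix d assume "d \<in> {d. d dvd m * n}"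
      then obtain a b where "d = a * b" "a dvd m" "b dvd n" using division_decomp by blast
      then show "d \<in> (\<lambda>(a, b). a * b) ` ({a. a dvd m} \<times> {b. b dvd n})" by force
    qed (auto intro: mult_dvd_mono)
  qed
  then have "dirichlet u v (m * n) =
      (\<Sum>x\<in>{a. a dvd m} \<times> {b. b dvd n}. u (case x of (a, b) \<Rightarrow> a * b) * v (m * n div (case x of (a, b) \<Rightarrow> a * b)))"
    unfolding dirichlet_def by (rule sum.reindex_bij_betw[symmetric])
  also have "\<dots> = (\<Sum>(a, b)\<in>{a. a dvd m} \<times> {b. b dvd n}. (u a * v (m div a)) * (u b * v (n div b)))"
    by (intro sum.cong) (auto simp: u.mult v.mult div_mult_div_if_dvd[symmetric])
  also have "\<dots> = dirichlet u v m * dirichlet u v n"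
    unfolding dirichlet_def sum_product sum.cartesian_product ..
  finally show ?thesis .
qed

lemma dirichlet_1: "completely_multiplicative u \<Longrightarrow> completely_multiplicative v \<Longrightarrow> dirichlet u v 1 = 1"
  by (simp add: dirichlet_def completely_multiplicative_def)

lemma dirichlet_prime_power:
  assumes "completely_multiplicative u" "completely_multiplicative v" "prime p"
  shows "dirichlet u v (p ^ k) = (\<Sum>i\<le>k. u p ^ i * v p ^ (k - i))"
proof -
  interpret u: completely_multiplicative u by fact
  interpret v: completely_multiplicative v by fact
  have "p > 1" using assms(3) by (rule prime_gt_1_nat)
  have "{d. d dvd p ^ k} = (\<lambda>i. p ^ i) ` {..k}"
    using divides_primepow_nat[OF assms(3)] by auto
  moreover have "inj_on (\<lambda>i. p ^ i) {..k}"
    using \<open>p > 1\<close> by (auto intro!: inj_onI)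
  ultimately have "dirichlet u v (p ^ k) = (\<Sum>i\<le>k. u (p ^ i) * v (p ^ k div p ^ i))"
    by (simp add: dirichlet_def sum.reindex)
  also have "\<dots> = (\<Sum>i\<le>k. u p ^ i * v p ^ (k - i))"
    using \<open>p > 1\<close> by (intro sum.cong) (auto simp: u.power v.power simp flip: power_diff)
  finally show ?thesis .
qed

lemma dirichlet_prod_primes:
  assumes "completely_multiplicative u" "completely_multiplicative v" "finite S" "\<And>p. p \<in> S \<Longrightarrow> prime p"
  shows "dirichlet u v (\<Prod>p\<in>S. p ^ e p) = (\<Prod>p\<in>S. dirichlet u v (p ^ e p))"
  using assms(3,4)
proof (induction S rule: finite_induct)
  case empty
  then show ?case using dirichlet_1[OF assms(1,2)] by simp
next
  case (insert p S)
  have "coprime (p ^ e p) (\<Prod>p\<in>S. p ^ e p)"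
    using insert by (intro prod_coprime_right) (auto intro!: primes_coprime)
  then show ?case using insert dirichlet_mult[OF assms(1,2)] by simp
qed

lemma chi5_mult: "chi5 (m * n) = chi5 m * chi5 n"
proof -
  define a b where "a = m mod 5" "b = n mod 5"
  have ab: "a \<in> {0, 1, 2, 3, 4}" "b \<in> {0, 1, 2, 3, 4}" by (auto simp: a_b_def)
  have "(m * n) mod 5 = (a * b) mod 5" by (simp add: a_b_def mod_mult_eq)
  then show ?thesis
    unfolding chi5_def a_b_def[symmetric] using ab by (elim insertE emptyE) simp_all
qed

lemma completely_multiplicative_chi5: "completely_multiplicative chi5"
  by unfold_locales (simp_all add: chi5_mult, simp add: chi5_def)

lemma completely_multiplicative_intros:
  "completely_multiplicative of_nat" "completely_multiplicative (\<lambda>_. 1)"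
  "completely_multiplicative (\<lambda>n. chi5 n * of_nat n)"
  by unfold_locales (auto simp: chi5_mult, simp add: chi5_def)

lemma sigma_P_dirichlet: "sigma_P = dirichlet (\<lambda>n. chi5 n * of_nat n) (\<lambda>_. 1)"
  by (simp add: fun_eq_iff sigma_P_def dirichlet_def)

lemma sigma_Q_dirichlet: "sigma_Q = dirichlet of_nat chi5"
  by (simp add: fun_eq_iff sigma_Q_def dirichlet_def mult.commute)

lemma pm1_mod5_iff: "pm1_mod5 p \<longleftrightarrow> p mod 5 = 1 \<or> p mod 5 = 4"
proof -
  define r where "r = p mod 5"
  have "int p mod 5 = int r" by (simp add: r_def zmod_int)
  then show ?thesis unfolding pm1_mod5_def cong_def r_def[symmetric] by auto
qed

lemma pm2_mod5_iff: "pm2_mod5 p \<longleftrightarrow> p mod 5 = 2 \<or> p mod 5 = 3"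
proof -
  define r where "r = p mod 5"
  have "int p mod 5 = int r" by (simp add: r_def zmod_int)
  then show ?thesis unfolding pm2_mod5_def cong_def r_def[symmetric] by auto
qed

text \<open>A geometric sum with ratio p, -p or 0; in the last case only the divisor 1 counts. The
  prime 2 is of the second kind, with denominator 3.\<close>

lemma sigma_P_prime_power:
  assumes "prime p"
  shows "pm1_mod5 p \<Longrightarrow> sigma_P (p ^ k) = (1 - of_nat p ^ (k + 1)) / (1 - of_nat p)"
    "pm2_mod5 p \<Longrightarrow> sigma_P (p ^ k) = (1 - (- of_nat p) ^ (k + 1)) / (1 + of_nat p)"
    "sigma_P (5 ^ k) = 1"
proof -
  have *: "sigma_P (p ^ k) = (\<Sum>i\<le>k. (chi5 p * of_nat p) ^ i)" if "prime p" for p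
    unfolding sigma_P_dirichlet by (subst dirichlet_prime_power) (use completely_multiplicative_intros that in auto)
  have "(of_nat p :: complex) \<noteq> 1" using assms prime_gt_1_nat by (metis of_nat_eq_1_iff less_irrefl)
  then show "pm1_mod5 p \<Longrightarrow> sigma_P (p ^ k) = (1 - of_nat p ^ (k + 1)) / (1 - of_nat p)"
    unfolding *[OF assms] by (auto simp: pm1_mod5_iff chi5_def sum_gp0)
  have "(- of_nat p :: complex) \<noteq> 1"
  proof
    assume "(- of_nat p :: complex) = 1"
    then have "(of_nat (p + 1) :: complex) = 0" by (simp add: neg_eq_iff_add_eq_0 add.commute)
    then show False by (simp only: of_nat_eq_0_iff)
  qed
  then show "pm2_mod5 p \<Longrightarrow> sigma_P (p ^ k) = (1 - (- of_nat p) ^ (k + 1)) / (1 + of_nat p)"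
    unfolding *[OF assms] by (auto simp: pm2_mod5_iff chi5_def sum_gp0)
  have "sigma_P (5 ^ k) = (\<Sum>i\<le>k. 0 ^ i)" using *[of 5] by (simp add: chi5_def)
  also have "\<dots> = 1" by (induction k) auto
  finally show "sigma_P (5 ^ k) = 1" .
qed

text \<open>Where \<open>chi5 p\<close> is a sign, moving it from codivisor to divisor costs the
  global sign \<open>chi5 p ^ k\<close>. At 5 only the divisor 5^k has a codivisor on which the
  character is nonzero.\<close>

lemma sigma_Q_prime_power:
  assumes "prime p"
  shows "pm1_mod5 p \<Longrightarrow> sigma_Q (p ^ k) = sigma_P (p ^ k)"
    "pm2_mod5 p \<Longrightarrow> sigma_Q (p ^ k) = (-1) ^ k * sigma_P (p ^ k)"
    "sigma_Q (5 ^ k) = 5 ^ k"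
proof -
  have *: "sigma_Q (p ^ k) = (\<Sum>i\<le>k. of_nat p ^ i * chi5 p ^ (k - i))" if "prime p" for p
    unfolding sigma_Q_dirichlet
    by (subst dirichlet_prime_power) (use completely_multiplicative_intros completely_multiplicative_chi5 that in auto)
  have **: "sigma_P (p ^ k) = (\<Sum>i\<le>k. (chi5 p * of_nat p) ^ i)"
    unfolding sigma_P_dirichlet by (subst dirichlet_prime_power) (use completely_multiplicative_intros assms in auto)
  show "pm1_mod5 p \<Longrightarrow> sigma_Q (p ^ k) = sigma_P (p ^ k)"
    unfolding *[OF assms] ** by (auto simp: pm1_mod5_iff chi5_def)
  have "(-1) ^ (k - i) = (-1) ^ k * (-1 :: complex) ^ i" if "i \<le> k" for i
    using that by (auto simp: minus_one_power_iff)
  then have "of_nat p ^ i * (-1) ^ (k - i) = (-1) ^ k * (- of_nat p :: complex) ^ i" if "i \<le> k" for i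
    using that by (simp add: power_minus[of "of_nat p"])
  then show "pm2_mod5 p \<Longrightarrow> sigma_Q (p ^ k) = (-1) ^ k * sigma_P (p ^ k)"
    unfolding *[OF assms] ** by (auto simp: pm2_mod5_iff chi5_def sum_distrib_left intro!: sum.cong)
  have "sigma_Q (5 ^ k) = (\<Sum>i\<le>k. 5 ^ i * 0 ^ (k - i))" using *[of 5] by (simp add: chi5_def)
  also have "\<dots> = (\<Sum>i\<le>k. if i = k then 5 ^ i else 0)" by (intro sum.cong) auto
  finally show "sigma_Q (5 ^ k) = 5 ^ k" by simp
qed

section \<open>Power series coefficients of the four theta products\<close>

definition half_coeff :: "(nat \<Rightarrow> complex) \<Rightarrow> nat \<Rightarrow> complex" where
  "half_coeff s n = (if even n then s (n div 2) else 0)"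

lemma half_coeff_sums:
  assumes "(\<lambda>n. s (Suc n) * (q ^ 2) ^ Suc n) sums S"
  shows "(\<lambda>n. half_coeff s (Suc n) * q ^ Suc n) sums S"
proof -
  \<comment> \<open>Index n stands for the exponent n + 1, so the even exponents sit at the odd
    indices.\<close>
  have "strict_mono (\<lambda>n::nat. 2 * n + 1)" by (auto intro!: strict_monoI)
  moreover have "half_coeff s (Suc n) * q ^ Suc n = 0" if "n \<notin> range (\<lambda>n. 2 * n + 1)" for n
  proof -
    have "even n" using that by (metis oddE rangeI)
    then show ?thesis by (simp add: half_coeff_def)
  qed
  ultimately have "(\<lambda>n. half_coeff s (Suc (2 * n + 1)) * q ^ Suc (2 * n + 1)) sums S \<longleftrightarrow> ?thesis"
    by (rule sums_mono_reindex)
  moreover have "half_coeff s (Suc (2 * n + 1)) * q ^ Suc (2 * n + 1) = s (Suc n) * (q ^ 2) ^ Suc n" for n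
  proof -
    have "Suc (2 * n + 1) = 2 * Suc n" by simp
    then show ?thesis unfolding half_coeff_def by (simp only: power_mult) simp
  qed
  ultimately show ?thesis using assms by simp
qed

lemma eta_expansions:
  assumes "norm q < 1"
  shows "(\<lambda>n. sigma_P (Suc n) * q ^ Suc n) sums ((1 - eta_P q) / 5)"
    "(\<lambda>n. half_coeff sigma_P (Suc n) * q ^ Suc n) sums ((1 - eta_P (q ^ 2)) / 5)"
    "(\<lambda>n. sigma_Q (Suc n) * q ^ Suc n) sums eta_Q q"
    "(\<lambda>n. half_coeff sigma_Q (Suc n) * q ^ Suc n) sums eta_Q (q ^ 2)"
  by (intro eta_P_sums eta_Q_sums half_coeff_sums norm_power_less_1 assms zero_less_numeral)+

text \<open>The sign (-1)^n undoes the passage to -q in the identities for \<phi>. The parameter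
  \<open>c\<close> is the coefficient 1 or 5 in front of the \<open>eta_Q\<close> part; the
  prefactor 1/5 cancels the 5 in the expansion of \<open>eta_P\<close>.\<close>

definition phi_coeff :: "complex \<Rightarrow> nat \<Rightarrow> complex" where
  "phi_coeff c n = (-1) ^ n * (- (sigma_P n + 4 * half_coeff sigma_P n) - c * (sigma_Q n - 4 * half_coeff sigma_Q n))"

definition psi_coeff :: "complex \<Rightarrow> nat \<Rightarrow> complex" where
  "psi_coeff c n = - (sigma_P n - half_coeff sigma_P n) + c * (sigma_Q n + half_coeff sigma_Q n)"

lemma phi_coeff_sums:
  assumes "norm q < 1"
  shows "(\<lambda>n. phi_coeff c (Suc n) * q ^ Suc n) sums
    (1/5 * (eta_P (-q) + 4 * eta_P ((-q) ^ 2)) - c * (eta_Q (-q) - 4 * eta_Q ((-q) ^ 2)) - 1)"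
proof -
  let ?e = "\<lambda>s n. s (Suc n) * (-q) ^ Suc n"
  have "norm (-q) < 1" using assms by simp
  note * = eta_expansions[OF this]
  have "(\<lambda>n. - (?e sigma_P n + 4 * ?e (half_coeff sigma_P) n) - c * (?e sigma_Q n - 4 * ?e (half_coeff sigma_Q) n)) sums
    (- ((1 - eta_P (-q)) / 5 + 4 * ((1 - eta_P ((-q) ^ 2)) / 5)) - c * (eta_Q (-q) - 4 * eta_Q ((-q) ^ 2)))"
    by (intro sums_diff sums_minus sums_add sums_mult *)
  moreover have "- (?e sigma_P n + 4 * ?e (half_coeff sigma_P) n) - c * (?e sigma_Q n - 4 * ?e (half_coeff sigma_Q) n) =
      phi_coeff c (Suc n) * q ^ Suc n" for n
    unfolding phi_coeff_def power_minus[of q]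
    by (simp only: algebra_simps mult_minus_left mult_minus_right minus_add_distrib)
  moreover have "- ((1 - x) / 5 + 4 * ((1 - y) / 5)) - z = 1/5 * (x + 4 * y) - z - 1" for x y z :: complex
    by (simp add: field_simps)
  ultimately show ?thesis by (simp only:)
qed

lemma psi_coeff_sums:
  assumes "norm q < 1"
  shows "(\<lambda>n. psi_coeff c (Suc n) * q ^ Suc n) sums
    (1/5 * (eta_P q - eta_P (q ^ 2)) + c * (eta_Q q + eta_Q (q ^ 2)))"
proof -
  let ?e = "\<lambda>s n. s (Suc n) * q ^ Suc n"
  note * = eta_expansions[OF assms]
  have "(\<lambda>n. - (?e sigma_P n - ?e (half_coeff sigma_P) n) + c * (?e sigma_Q n + ?e (half_coeff sigma_Q) n)) sums
    (- ((1 - eta_P q) / 5 - (1 - eta_P (q ^ 2)) / 5) + c * (eta_Q q + eta_Q (q ^ 2)))"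
    by (intro sums_diff sums_minus sums_add sums_mult *)
  moreover have "- (?e sigma_P n - ?e (half_coeff sigma_P) n) + c * (?e sigma_Q n + ?e (half_coeff sigma_Q) n) =
      psi_coeff c (Suc n) * q ^ Suc n" for n
    unfolding psi_coeff_def by (simp only: algebra_simps mult_minus_left mult_minus_right minus_diff_eq)
  moreover have "- ((1 - x) / 5 - (1 - y) / 5) + z = 1/5 * (x - y) + z" for x y z :: complex
    by (simp add: field_simps)
  ultimately show ?thesis by (simp only:)
qed

lemma theta_q_expansions:
  "has_q_expansion (\<lambda>q. theta_phi q * theta_phi (q ^ 5) ^ 3) 1 (phi_coeff 1)"
  "has_q_expansion (\<lambda>q. theta_phi q ^ 3 * theta_phi (q ^ 5)) 1 (phi_coeff 5)"
  "has_q_expansion (\<lambda>q. 4 * q * theta_psi q ^ 3 * theta_psi (q ^ 5)) 0 (psi_coeff 5)"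
  "has_q_expansion (\<lambda>q. 4 * q ^ 2 * theta_psi q * theta_psi (q ^ 5) ^ 3) 0 (psi_coeff 1)"
proof -
  have "norm (-q) < 1" if "norm q < 1" for q :: complex using that by simp
  then show "has_q_expansion (\<lambda>q. theta_phi q * theta_phi (q ^ 5) ^ 3) 1 (phi_coeff 1)"
    "has_q_expansion (\<lambda>q. theta_phi q ^ 3 * theta_phi (q ^ 5)) 1 (phi_coeff 5)"
    using level_10_identities(1,2)[of "- q" for q] phi_coeff_sums[of _ 1] phi_coeff_sums[of _ 5]
    unfolding has_q_expansion_def by auto
  show "has_q_expansion (\<lambda>q. 4 * q * theta_psi q ^ 3 * theta_psi (q ^ 5)) 0 (psi_coeff 5)"
    "has_q_expansion (\<lambda>q. 4 * q ^ 2 * theta_psi q * theta_psi (q ^ 5) ^ 3) 0 (psi_coeff 1)"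
    using psi_coeff_sums[of _ 1] psi_coeff_sums[of _ 5]
    unfolding has_q_expansion_def by (auto simp: level_10_identities(3,4))
qed

text \<open>The identity theorem for power series, applied to the difference with its irrelevant
  entry at 0 set to 0.\<close>

lemma has_q_expansion_unique:
  assumes "has_q_expansion F c0 a" "has_q_expansion F c0 b" "n > 0"
  shows "a n = b n"
proof -
  define f where "f n = (if n = 0 then 0 else a n - b n)" for n
  have f: "(\<lambda>n. f n * q ^ n) sums 0" if "norm q < 1" for q
  proof -
    have "(\<lambda>n. a (Suc n) * q ^ Suc n - b (Suc n) * q ^ Suc n) sums (F q - c0 - (F q - c0))"
      using assms that unfolding has_q_expansion_def by (intro sums_diff) auto
    then have "(\<lambda>n. f (Suc n) * q ^ Suc n) sums 0" by (simp add: f_def algebra_simps)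
    then show ?thesis by (subst (asm) sums_Suc_iff) (simp add: f_def)
  qed
  have "ereal (norm (1/2 :: complex)) \<le> conv_radius f"
    using f[of "1/2"] by (intro conv_radius_geI sums_summable[of _ 0]) auto
  then have "fps_conv_radius (Abs_fps f) > 0"
    unfolding fps_conv_radius_def by (auto simp: ereal_less_ereal_Ex elim!: less_le_trans[rotated])
  moreover have "eventually (\<lambda>z. eval_fps (Abs_fps f) z = eval_fps 0 z) (nhds 0)"
  proof -
    have "eventually (\<lambda>z::complex. z \<in> ball 0 1) (nhds 0)"
      by (intro eventually_nhds_in_open) auto
    then show ?thesis
      by eventually_elim (use f in \<open>auto simp: eval_fps_def sums_iff\<close>)
  qed
  ultimately have "Abs_fps f = 0"
    by (intro eval_fps_eqD) auto
  then have "f n = 0" by (metis fps_nth_Abs_fps fps_zero_nth)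
  then show ?thesis using assms(3) by (simp add: f_def)
qed

section \<open>Closed forms of the coefficients\<close>

text \<open>The exponent \<open>j\<close> of 2 is left free because the coefficients involve both n
  and n/2, which share the odd part m. The odd primes split into the classes +-1, +-2 and the prime
  5.\<close>

lemma sigma_factorization:
  fixes n :: nat
  assumes n: "n > 0"
  defines "P \<equiv> (\<Prod>p | p \<in> prime_factors n \<and> pm1_mod5 p.
      (1 - of_nat p ^ (multiplicity p n + 1)) / (1 - of_nat p) :: complex)"
    and "Q \<equiv> (\<Prod>p | p \<in> prime_factors n \<and> odd p \<and> pm2_mod5 p.
      (1 - (- of_nat p) ^ (multiplicity p n + 1)) / (1 + of_nat p) :: complex)"
    and "t \<equiv> size {#p \<in># prime_factorization n. odd p \<and> pm2_mod5 p#}"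
  obtains m where "n = 2 ^ multiplicity 2 n * m" "odd m"
    "\<And>j. sigma_P (2 ^ j * m) = (1 - (-2) ^ (j + 1)) / 3 * (P * Q)"
    "\<And>j. sigma_Q (2 ^ j * m) = (-1) ^ j * 5 ^ multiplicity 5 n * (-1) ^ t * ((1 - (-2) ^ (j + 1)) / 3 * (P * Q))"
proof -
  define S1 where "S1 = {p. p \<in> prime_factors n \<and> pm1_mod5 p}"
  define S2 where "S2 = {p. p \<in> prime_factors n \<and> odd p \<and> pm2_mod5 p}"
  define S3 where "S3 = prime_factors n \<inter> {5}"
  define m where "m = (\<Prod>p\<in>prime_factors n - {2}. p ^ multiplicity p n)"
  have S: "prime_factors n - {2} = S1 \<union> (S2 \<union> S3)"
  proof (intro equalityI subsetI)
    fix p assume p: "p \<in> prime_factors n - {2}"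
    then have "prime p" "p \<noteq> 2" by auto
    then have "odd p" using primes_dvd_imp_eq two_is_prime_nat by blast
    have "p mod 5 = 0 \<or> p mod 5 = 1 \<or> p mod 5 = 2 \<or> p mod 5 = 3 \<or> p mod 5 = 4" by linarith
    moreover have "p = 5" if "p mod 5 = 0"
      using that \<open>prime p\<close> primes_dvd_imp_eq[of 5 p] by (auto simp: mod_eq_0_iff_dvd)
    ultimately show "p \<in> S1 \<union> (S2 \<union> S3)"
      using p \<open>odd p\<close> by (auto simp: S1_def S2_def S3_def pm1_mod5_iff pm2_mod5_iff)
  qed (auto simp: S1_def S2_def S3_def pm1_mod5_iff pm2_mod5_iff)
  have disj: "S1 \<inter> (S2 \<union> S3) = {}" "S2 \<inter> S3 = {}"
    by (auto simp: S1_def S2_def S3_def pm1_mod5_iff pm2_mod5_iff)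
  have fin: "finite S1" "finite S2" "finite S3" by (auto simp: S1_def S2_def S3_def)
  have prime: "prime p" if "p \<in> prime_factors n - {2}" for p using that by auto
  have "odd m"
  proof
    assume "even m"
    moreover have "even m \<longleftrightarrow> (\<exists>p\<in>prime_factors n - {2}. even (p ^ multiplicity p n))"
      unfolding m_def by (rule prime_dvd_prod_iff) (use two_is_prime_nat in auto)
    ultimately obtain p where p: "p \<in> prime_factors n - {2}" "2 dvd p ^ multiplicity p n" by blast
    then have "2 dvd p" using prime_dvd_power two_is_prime_nat by blast
    then show False using primes_dvd_imp_eq[OF two_is_prime_nat prime[OF p(1)]] p(1) by auto
  qed
  have n_eq: "n = 2 ^ multiplicity 2 n * m"
  proof -
    have "n = (\<Prod>p\<in>prime_factors n. p ^ multiplicity p n)"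
      using n by (rule prime_factorization_nat)
    \<comment> \<open>For odd n the prime 2 is adjoined with exponent 0, so that the power of 2
      splits off uniformly.\<close>
    also have "\<dots> = (\<Prod>p\<in>insert 2 (prime_factors n). p ^ multiplicity p n)"
      by (rule prod.mono_neutral_left) (simp, blast, auto simp: prime_factors_multiplicity)
    also have "\<dots> = 2 ^ multiplicity 2 n * m"
      unfolding m_def by (subst prod.insert_remove) auto
    finally show ?thesis .
  qed
  have split: "(\<Prod>p\<in>prime_factors n - {2}. f p) = (\<Prod>p\<in>S1. f p) * ((\<Prod>p\<in>S2. f p) * (\<Prod>p\<in>S3. f p))"
    for f :: "nat \<Rightarrow> complex"
    unfolding S using fin disj by (simp add: prod.union_disjoint)
  have co: "coprime (2 ^ j) m" for j :: nat
    using \<open>odd m\<close> by simp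
  have P2: "sigma_P (2 ^ j) = (1 - (-2) ^ (j + 1)) / 3" for j
    using sigma_P_prime_power(2)[of 2 j] by (simp add: pm2_mod5_iff)
  have Q2: "sigma_Q (2 ^ j) = (-1) ^ j * ((1 - (-2) ^ (j + 1)) / 3)" for j
    using sigma_Q_prime_power(2)[of 2 j] by (simp add: pm2_mod5_iff P2)
  have P_eq: "(\<Prod>p\<in>S1. sigma_P (p ^ multiplicity p n)) = P"
    unfolding P_def S1_def using sigma_P_prime_power(1) by (intro prod.cong refl) blast
  have Q_eq: "(\<Prod>p\<in>S2. sigma_P (p ^ multiplicity p n)) = Q"
    unfolding Q_def S2_def using sigma_P_prime_power(2) by (intro prod.cong refl) blast
  have "sigma_P m = (\<Prod>p\<in>prime_factors n - {2}. sigma_P (p ^ multiplicity p n))"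
    unfolding m_def sigma_P_dirichlet
    by (rule dirichlet_prod_primes) (use completely_multiplicative_intros prime in auto)
  also have "\<dots> = P * Q"
  proof -
    have "(\<Prod>p\<in>S3. sigma_P (p ^ multiplicity p n)) = 1"
      by (rule prod.neutral) (auto simp: S3_def sigma_P_prime_power(3)[of 5])
    then show ?thesis unfolding split P_eq Q_eq by simp
  qed
  finally have Pm: "sigma_P m = P * Q" .
  have "sigma_Q m = (\<Prod>p\<in>prime_factors n - {2}. sigma_Q (p ^ multiplicity p n))"
    unfolding m_def sigma_Q_dirichlet
    by (rule dirichlet_prod_primes) (use completely_multiplicative_intros completely_multiplicative_chi5 prime in auto)
  also have "\<dots> = P * (((-1) ^ t * Q) * 5 ^ multiplicity 5 n)"
  proof -
    have "(\<Prod>p\<in>S3. sigma_Q (p ^ multiplicity p n)) = 5 ^ multiplicity 5 n"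
    proof (cases "5 \<in> prime_factors n")
      case True
      then show ?thesis by (simp add: S3_def sigma_Q_prime_power(3)[of 5])
    next
      case False
      then have "multiplicity 5 n = 0" by (auto simp: prime_factors_multiplicity)
      then show ?thesis using False by (simp add: S3_def)
    qed
    moreover have "(\<Prod>p\<in>S1. sigma_Q (p ^ multiplicity p n)) = P"
      unfolding P_eq[symmetric] by (intro prod.cong refl) (use sigma_Q_prime_power(1) S1_def in blast)
    moreover have "(\<Prod>p\<in>S2. sigma_Q (p ^ multiplicity p n)) = (-1) ^ t * Q"
    proof -
      \<comment> \<open>Counting with multiplicity makes (-1)^t the product of the signs that
        \<open>sigma_Q\<close> has against \<open>sigma_P\<close> at these primes.\<close>
      have "t = (\<Sum>p\<in>S2. multiplicity p n)"
        unfolding t_def size_multiset_overloaded_eq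
        by (intro sum.cong) (auto simp: S2_def count_prime_factorization_prime in_prime_factors_imp_prime)
      moreover have "(\<Prod>p\<in>S2. sigma_Q (p ^ multiplicity p n)) =
          (\<Prod>p\<in>S2. (-1) ^ multiplicity p n * sigma_P (p ^ multiplicity p n))"
        by (intro prod.cong refl) (use sigma_Q_prime_power(2) S2_def in blast)
      ultimately show ?thesis by (simp add: prod.distrib Q_eq power_sum)
    qed
    ultimately show ?thesis unfolding split by simp
  qed
  finally have Qm: "sigma_Q m = P * (((-1) ^ t * Q) * 5 ^ multiplicity 5 n)" .
  have "sigma_P (2 ^ j * m) = sigma_P (2 ^ j) * sigma_P m" for j
    unfolding sigma_P_dirichlet
    by (rule dirichlet_mult) (use completely_multiplicative_intros co in auto)
  then have "sigma_P (2 ^ j * m) = (1 - (-2) ^ (j + 1)) / 3 * (P * Q)" for j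
    by (simp only: P2 Pm)
  moreover have "sigma_Q (2 ^ j * m) = sigma_Q (2 ^ j) * sigma_Q m" for j
    unfolding sigma_Q_dirichlet
    by (rule dirichlet_mult) (use completely_multiplicative_intros completely_multiplicative_chi5 co in auto)
  then have "sigma_Q (2 ^ j * m) = (-1) ^ j * 5 ^ multiplicity 5 n * (-1) ^ t * ((1 - (-2) ^ (j + 1)) / 3 * (P * Q))" for j
    unfolding Q2 Qm by (simp only: mult_ac)
  ultimately show thesis using that[OF n_eq \<open>odd m\<close>] by blast
qed

text \<open>For odd n the halved terms vanish and both factors at 2 equal 1. For even n the sign of
  \<open>sigma_Q\<close> at 2 flips between n and n/2, so the combinations with opposite signs for
  the two sums lead to the same factor at 2.\<close>

lemma coeff_closed_forms:
  fixes n :: nat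
  assumes n: "n > 0"
  defines "g \<equiv> multiplicity 2 n" and "h \<equiv> multiplicity 5 n"
    and "t \<equiv> size {#p \<in># prime_factorization n. odd p \<and> pm2_mod5 p#}"
    and "P \<equiv> (\<Prod>p | p \<in> prime_factors n \<and> pm1_mod5 p.
      (1 - of_nat p ^ (multiplicity p n + 1)) / (1 - of_nat p) :: complex)"
    and "Q \<equiv> (\<Prod>p | p \<in> prime_factors n \<and> odd p \<and> pm2_mod5 p.
      (1 - (- of_nat p) ^ (multiplicity p n + 1)) / (1 + of_nat p) :: complex)"
  shows "phi_coeff c n = (-1) ^ (n - 1) * (1 + c * 5 ^ h * (-1) ^ (g + t)) * ((5 + (-2) ^ (g + 1)) / 3) * P * Q"
    "psi_coeff c n = (-2) ^ g * (-1 + c * 5 ^ h * (-1) ^ (g + t)) * P * Q"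
proof -
  obtain m where m: "n = 2 ^ g * m" "odd m"
    "\<And>j. sigma_P (2 ^ j * m) = (1 - (-2) ^ (j + 1)) / 3 * (P * Q)"
    "\<And>j. sigma_Q (2 ^ j * m) = (-1) ^ j * 5 ^ h * (-1) ^ t * ((1 - (-2) ^ (j + 1)) / 3 * (P * Q))"
    by (rule sigma_factorization[OF n, folded g_def h_def t_def P_def Q_def]) (rule that)
  define e where "e = (5 ^ h * (-1) ^ t :: complex)"
  have sgn: "(-1 :: complex) ^ n = - ((-1) ^ (n - 1))"
    using n by (cases n) auto
  have P: "sigma_P n = (1 - (-2) ^ (g + 1)) / 3 * (P * Q)"
    and Q: "sigma_Q n = (-1) ^ g * e * ((1 - (-2) ^ (g + 1)) / 3 * (P * Q))"
    using m(3)[of g] m(4)[of g] unfolding m(1)[symmetric] e_def by (simp_all only: mult_ac)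
  have "- (sigma_P n + 4 * half_coeff sigma_P n) - c * (sigma_Q n - 4 * half_coeff sigma_Q n) =
      - ((1 + c * e * (-1) ^ g) * ((5 + (-2) ^ (g + 1)) / 3) * P * Q) \<and>
    - (sigma_P n - half_coeff sigma_P n) + c * (sigma_Q n + half_coeff sigma_Q n) =
      (-2) ^ g * (-1 + c * e * (-1) ^ g) * P * Q"
  proof (cases g)
    case 0
    then have "odd n" using m by simp
    then have "half_coeff s n = 0" for s by (simp add: half_coeff_def)
    then show ?thesis unfolding P Q 0 by (simp add: algebra_simps)
  next
    case (Suc j)
    then have n_eq: "n = 2 * (2 ^ j * m)" using m by simp
    have half: "half_coeff s n = s (2 ^ j * m)" for s
      unfolding half_coeff_def n_eq by simp
    have hP: "half_coeff sigma_P n = (1 - (-2) ^ (j + 1)) / 3 * (P * Q)"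
      and hQ: "half_coeff sigma_Q n = (-1) ^ j * e * ((1 - (-2) ^ (j + 1)) / 3 * (P * Q))"
      unfolding half m(3,4) e_def by (simp_all only: mult_ac)
    \<comment> \<open>With z = (-2)^(g-1) the factors at 2 become (1 - 4z) + 4 (1 + 2z) = 5 + 4z,
      the origin of 5 + (-2)^(g+1), and (1 - 4z) - (1 + 2z) = -6z, which divided by 3 is
      (-2)^g.\<close>
    define z :: complex where "z = (-2) ^ j"
    define s :: complex where "s = (-1) ^ j"
    have pw: "(-2 :: complex) ^ (j + 1) = -2 * z" "(-2 :: complex) ^ (Suc j + 1) = 4 * z" "(-2 :: complex) ^ Suc j = -2 * z"
      "(-1 :: complex) ^ Suc j = - s"
      by (simp_all add: z_def s_def)
    show ?thesis unfolding P Q hP hQ Suc pw s_def[symmetric] by (simp add: field_simps)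
  qed
  then show "phi_coeff c n = (-1) ^ (n - 1) * (1 + c * 5 ^ h * (-1) ^ (g + t)) * ((5 + (-2) ^ (g + 1)) / 3) * P * Q"
    "psi_coeff c n = (-2) ^ g * (-1 + c * 5 ^ h * (-1) ^ (g + t)) * P * Q"
    unfolding phi_coeff_def psi_coeff_def sgn
    by (simp_all add: e_def power_add mult_ac)
qed

theorem theorem7p1:
  shows "(\<forall>q::complex. norm q < 1 \<longrightarrow>
      theta_phi (-q) * theta_phi (-(q^5)) ^ 3 =
        1/5 * (euler_E q ^ 5 / euler_E (q^5) + 4 * (euler_E (q^2) ^ 5 / euler_E (q^10)))
        - (q * (euler_E (q^5) ^ 5 / euler_E q) - 4 * q^2 * (euler_E (q^10) ^ 5 / euler_E (q^2)))
    \<and> theta_phi (-q) ^ 3 * theta_phi (-(q^5)) =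
        1/5 * (euler_E q ^ 5 / euler_E (q^5) + 4 * (euler_E (q^2) ^ 5 / euler_E (q^10)))
        - 5 * (q * (euler_E (q^5) ^ 5 / euler_E q) - 4 * q^2 * (euler_E (q^10) ^ 5 / euler_E (q^2)))
    \<and> 4 * q * theta_psi q ^ 3 * theta_psi (q^5) =
        1/5 * (euler_E q ^ 5 / euler_E (q^5) - euler_E (q^2) ^ 5 / euler_E (q^10))
        + 5 * (q * (euler_E (q^5) ^ 5 / euler_E q) + q^2 * (euler_E (q^10) ^ 5 / euler_E (q^2)))
    \<and> 4 * q^2 * theta_psi q * theta_psi (q^5) ^ 3 =
        1/5 * (euler_E q ^ 5 / euler_E (q^5) - euler_E (q^2) ^ 5 / euler_E (q^10))
        + (q * (euler_E (q^5) ^ 5 / euler_E q) + q^2 * (euler_E (q^10) ^ 5 / euler_E (q^2))))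
  \<and> (\<exists>a. has_q_expansion (\<lambda>q. theta_phi q * theta_phi (q^5) ^ 3) 1 a)
  \<and> (\<exists>b. has_q_expansion (\<lambda>q. theta_phi q ^ 3 * theta_phi (q^5)) 1 b)
  \<and> (\<exists>c. has_q_expansion (\<lambda>q. 4 * q * theta_psi q ^ 3 * theta_psi (q^5)) 0 c)
  \<and> (\<exists>d. has_q_expansion (\<lambda>q. 4 * q^2 * theta_psi q * theta_psi (q^5) ^ 3) 0 d)
  \<and> (\<forall>a b c d :: nat \<Rightarrow> complex.
        has_q_expansion (\<lambda>q. theta_phi q * theta_phi (q^5) ^ 3) 1 a \<longrightarrow>
        has_q_expansion (\<lambda>q. theta_phi q ^ 3 * theta_phi (q^5)) 1 b \<longrightarrow>
        has_q_expansion (\<lambda>q. 4 * q * theta_psi q ^ 3 * theta_psi (q^5)) 0 c \<longrightarrow>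
        has_q_expansion (\<lambda>q. 4 * q^2 * theta_psi q * theta_psi (q^5) ^ 3) 0 d \<longrightarrow>
        (\<forall>n::nat. n > 0 \<longrightarrow>
          (let g = multiplicity 2 n;
               h = multiplicity 5 n;
               t = size {#p \<in># prime_factorization n. odd p \<and> pm2_mod5 p#};
               P = (\<Prod>p | p \<in> prime_factors n \<and> pm1_mod5 p.
                      (1 - of_nat p ^ (multiplicity p n + 1)) / (1 - of_nat p));
               Q = (\<Prod>p | p \<in> prime_factors n \<and> odd p \<and> pm2_mod5 p.
                      (1 - (- of_nat p) ^ (multiplicity p n + 1)) / (1 + of_nat p))
           in a n = (-1) ^ (n - 1) * (1 + 5 ^ h * (-1) ^ (g + t)) * ((5 + (-2) ^ (g + 1)) / 3) * P * Q
            \<and> b n = (-1) ^ (n - 1) * (1 + 5 ^ (h + 1) * (-1) ^ (g + t)) * ((5 + (-2) ^ (g + 1)) / 3) * P * Q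
            \<and> c n = (-2) ^ g * (-1 + 5 ^ (h + 1) * (-1) ^ (g + t)) * P * Q
            \<and> d n = (-2) ^ g * (-1 + 5 ^ h * (-1) ^ (g + t)) * P * Q)))"
proof (intro conjI allI impI)
  fix q :: complex assume q: "norm q < 1"
  note ids = level_10_identities[OF q, unfolded eta_P_def eta_Q_def, folded power_mult]
  show "theta_phi (-q) * theta_phi (-(q^5)) ^ 3 =
        1/5 * (euler_E q ^ 5 / euler_E (q^5) + 4 * (euler_E (q^2) ^ 5 / euler_E (q^10)))
        - (q * (euler_E (q^5) ^ 5 / euler_E q) - 4 * q^2 * (euler_E (q^10) ^ 5 / euler_E (q^2)))"
    "theta_phi (-q) ^ 3 * theta_phi (-(q^5)) =
        1/5 * (euler_E q ^ 5 / euler_E (q^5) + 4 * (euler_E (q^2) ^ 5 / euler_E (q^10)))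
        - 5 * (q * (euler_E (q^5) ^ 5 / euler_E q) - 4 * q^2 * (euler_E (q^10) ^ 5 / euler_E (q^2)))"
    "4 * q * theta_psi q ^ 3 * theta_psi (q^5) =
        1/5 * (euler_E q ^ 5 / euler_E (q^5) - euler_E (q^2) ^ 5 / euler_E (q^10))
        + 5 * (q * (euler_E (q^5) ^ 5 / euler_E q) + q^2 * (euler_E (q^10) ^ 5 / euler_E (q^2)))"
    "4 * q^2 * theta_psi q * theta_psi (q^5) ^ 3 =
        1/5 * (euler_E q ^ 5 / euler_E (q^5) - euler_E (q^2) ^ 5 / euler_E (q^10))
        + (q * (euler_E (q^5) ^ 5 / euler_E q) + q^2 * (euler_E (q^10) ^ 5 / euler_E (q^2)))"
    using ids by (simp_all add: mult.assoc)
next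
  show "\<exists>a. has_q_expansion (\<lambda>q. theta_phi q * theta_phi (q^5) ^ 3) 1 a"
    "\<exists>b. has_q_expansion (\<lambda>q. theta_phi q ^ 3 * theta_phi (q^5)) 1 b"
    "\<exists>c. has_q_expansion (\<lambda>q. 4 * q * theta_psi q ^ 3 * theta_psi (q^5)) 0 c"
    "\<exists>d. has_q_expansion (\<lambda>q. 4 * q^2 * theta_psi q * theta_psi (q^5) ^ 3) 0 d"
    using theta_q_expansions by blast+
next
  fix a b c d :: "nat \<Rightarrow> complex" and n :: nat
  assume "has_q_expansion (\<lambda>q. theta_phi q * theta_phi (q^5) ^ 3) 1 a"
    "has_q_expansion (\<lambda>q. theta_phi q ^ 3 * theta_phi (q^5)) 1 b"
    "has_q_expansion (\<lambda>q. 4 * q * theta_psi q ^ 3 * theta_psi (q^5)) 0 c"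
    "has_q_expansion (\<lambda>q. 4 * q^2 * theta_psi q * theta_psi (q^5) ^ 3) 0 d"
    and n: "n > 0"
  \<comment> \<open>Uniqueness replaces the given sequences by the explicit ones; the parameter 5
    supplies the exponent h + 1 in place of h.\<close>
  then have "a n = phi_coeff 1 n" "b n = phi_coeff 5 n" "c n = psi_coeff 5 n" "d n = psi_coeff 1 n"
    using has_q_expansion_unique theta_q_expansions by blast+
  then show "let g = multiplicity 2 n;
               h = multiplicity 5 n;
               t = size {#p \<in># prime_factorization n. odd p \<and> pm2_mod5 p#};
               P = (\<Prod>p | p \<in> prime_factors n \<and> pm1_mod5 p.
                      (1 - of_nat p ^ (multiplicity p n + 1)) / (1 - of_nat p));
               Q = (\<Prod>p | p \<in> prime_factors n \<and> odd p \<and> pm2_mod5 p.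
                      (1 - (- of_nat p) ^ (multiplicity p n + 1)) / (1 + of_nat p))
           in a n = (-1) ^ (n - 1) * (1 + 5 ^ h * (-1) ^ (g + t)) * ((5 + (-2) ^ (g + 1)) / 3) * P * Q
            \<and> b n = (-1) ^ (n - 1) * (1 + 5 ^ (h + 1) * (-1) ^ (g + t)) * ((5 + (-2) ^ (g + 1)) / 3) * P * Q
            \<and> c n = (-2) ^ g * (-1 + 5 ^ (h + 1) * (-1) ^ (g + t)) * P * Q
            \<and> d n = (-2) ^ g * (-1 + 5 ^ h * (-1) ^ (g + t)) * P * Q"
    unfolding Let_def by (simp only: coeff_closed_forms[OF n] power_add power_one_right mult_1_left mult.commute[of _ 5])
qed

end
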